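(* Let $n\ge2$ be even and let $\mathcal P_\bullet$ be an $(n-1)$-supertransitive subfactor planar algebra of modulus $[2]=q+q^{-1}$ and multiplicity $2$ whose principal graphs $(\Gamma_+,\Gamma_-)$ are a translated extension of $\mathcal Q$, i.e. each of $\Gamma_\pm$ has exactly three vertices at depth $n$, each joined by a single edge to the unique vertex at depth $n-1$, one of them self-dual and the other two dual to each other. With notation as in the context, suppose that $r=\check r$, and that for every vertex $S$ of $\Gamma_+$ at depth $n+1$ connected to $P$, the only vertex at depth $n$ to which the dual vertex $\overline S$ connects is $\check P$. Then $\sigma_A+\sigma_A^{-1}=[n+2]-[n]=q^{n+1}+q^{-n-1}$, and thus $[2]\le 2$.
   Context: **Planar algebras.** $\mathcal P_\bullet=(\mathcal P_{k,\pm})_{k\ge 0}$ is a subfactor planar algebra (shaded, spherical planar $*$-algebra, finite-dimensional, $\mathcal P_{0,\pm}\cong\mathbb C$, positive definite trace form) of modulus $[2]$, where $[k]=\frac{q^k-q^{-k}}{q-q^{-1}}$ and $q\in\{\exp(2\pi i/(2j)):j\ge 3\}\cup[1,\infty)$ with $[2]=q+q^{-1}$ (if $q=1$, $[k]=k$). Elements of $\mathcal P_{k,\pm}$ are rectangles with $k$ strings on top and $k$ on the bottom, distinguished interval on the left; $\operatorname{Tr}$ is the unnormalized trace closing all strings. $\mathcal{TL}_\bullet$ is the Temperley-Lieb planar subalgebra. $\mathcal P_\bullet$ is $(n-1)$-supertransitive if $\mathcal P_{j,+}=\mathcal{TL}_{j,+}$ for $0\le j\le n-1$; its multiplicity is then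 $\dim\mathcal P_{n,+}-\dim\mathcal{TL}_{n,+}$. **Rotation and duals.** The one-click rotation $\mathcal F:\mathcal P_{n,\pm}\to\mathcal P_{n,\mp}$ bends the rightmost top string over to the right and down to the bottom, and the leftmost bottom string around to the left and up to the top; $\rho=\mathcal F^2$. The dual $\overline P$ of a projection $P\in\mathcal P_{k,\pm}$ is $P$ rotated by $180^\circ$. **Principal graphs.** $\Gamma_\pm$ is the bipartite multigraph whose vertices are isomorphism classes of minimal projections in $\bigsqcup_k\mathcal P_{k,\pm}$, the number of edges between $[p]$ and $[q]$ being the dimension of the space of morphisms from $p\otimes(\text{strand added on the right})$ to $q$; the base point is the empty diagram, depth is distance from it. Duality preserves depth, acts on each graph at even depths and exchanges $\Gamma_+$ and $\Gamma_-$ at odd depths. $\mathcal Q$ is the pair of two copies of the following graph: base point at depth 0, one vertex at depth 1, three vertices at depth 2 each joined to the depth-1 vertex, where the bottom depth-2 vertex is self-dual and the other two are dual to each other. (Translations are by an even amount, so $n$ is even.) **Quadruple point notation.** Let $P,Q,R\in\mathcal P_{n,+}$ be the projections at depth $n$ of $\Gamma_+$ from bottom to top ($P$ self-dual, $\overline Q=R$), and $\check P,\check Q,\check R\in\mathcal P_{n,-}$ similarly for $\Gamma_-$. Put $r=2\operatorname{Tr}(Q)/\operatorname{Tr}(P)$, $\check r=2\operatorname{Tr}(\check Q)/\operatorname{Tr}(\check P)$, $A=rP-(Q+R)$, $\check A=\check r\check P-(\check Q+\check R)$. $A$ is orthogonal to Temperley-Lieb and is an eigenvector of $\rho$ with eigenvalue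 $\omega_A$; the number $\sigma_A$ (with $\sigma_A^2=\omega_A$) is determined by $\mathcal F(A)=\frac{\sqrt r}{\sqrt{\check r}}\,\sigma_A\check A$. *)

theory Defs
  imports Complex_Main
begin

section \<open>Labelled planar tangles in standard form\<close>

text \<open>
  A (labelled, shaded) planar tangle is put in standard form: the external disc and all input
  discs are upright rectangles with their distinguished interval on the left, each input disc
  carrying k strings at its top and k at its bottom, and the maxima, minima and input discs have
  pairwise distinct heights.  Such a picture is the list, read from bottom to top, of its
  elementary horizontal slices.  The number given first in a slice is the number of vertical
  strings to the left of the local picture.  An input disc comes with the element x that is
  put into it.  Every planar tangle is isotopic to one in standard form.
\<close>

datatype shading = Plus | Minus

fun opposite :: "shading \<Rightarrow> shading" where
  "opposite Plus = Minus"
| "opposite Minus = Plus"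

text \<open>Shading of the region reached from a region of shading s by crossing i strings.\<close>

abbreviation cross :: "nat \<Rightarrow> shading \<Rightarrow> shading" where
  "cross i s \<equiv> (opposite ^^ i) s"

datatype 'v slice =
    Cup nat           \<comment> \<open>a local minimum: two new strings\<close>
  | Cap nat           \<comment> \<open>a local maximum: joins two neighbouring strings\<close>
  | Box nat nat 'v    \<comment> \<open>position, k, label: an input disc with k strings below and k above\<close>

type_synonym 'v diagram = "'v slice list"

text \<open>
  \<open>wf_diagram V s m w l\<close>: w is a tangle with m strings at the bottom and l at the top, with
  leftmost region shaded s, whose input discs carry labels from the appropriate spaces V.
\<close>

fun wf_diagram :: "(nat \<Rightarrow> shading \<Rightarrow> 'v set) \<Rightarrow> shading \<Rightarrow> nat \<Rightarrow> 'v diagram \<Rightarrow> nat \<Rightarrow> bool" where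
  "wf_diagram V s m [] l \<longleftrightarrow> m = l"
| "wf_diagram V s m (Cup i # w) l \<longleftrightarrow> i \<le> m \<and> wf_diagram V s (m + 2) w l"
| "wf_diagram V s m (Cap i # w) l \<longleftrightarrow> i + 2 \<le> m \<and> wf_diagram V s (m - 2) w l"
| "wf_diagram V s m (Box i k x # w) l \<longleftrightarrow>
     i + k \<le> m \<and> x \<in> V k (cross i s) \<and> wf_diagram V s m w l"

fun position :: "'v slice \<Rightarrow> nat" where
  "position (Cup i) = i"
| "position (Cap i) = i"
| "position (Box i k x) = i"

fun ins :: "'v slice \<Rightarrow> nat" where
  "ins (Cup i) = 0"
| "ins (Cap i) = 2"
| "ins (Box i k x) = k"

fun outs :: "'v slice \<Rightarrow> nat" where
  "outs (Cup i) = 2"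
| "outs (Cap i) = 0"
| "outs (Box i k x) = k"

text \<open>Adding j vertical strings on the left.\<close>

fun shift :: "nat \<Rightarrow> 'v slice \<Rightarrow> 'v slice" where
  "shift j (Cup i) = Cup (j + i)"
| "shift j (Cap i) = Cap (j + i)"
| "shift j (Box i k x) = Box (j + i) k x"

text \<open>k nested minima (maxima), occupying 2k neighbouring strings starting at position i.\<close>

definition cups :: "nat \<Rightarrow> nat \<Rightarrow> 'v diagram" where
  "cups k i = map Cup [i..<i + k]"

definition caps :: "nat \<Rightarrow> nat \<Rightarrow> 'v diagram" where
  "caps k i = map Cap (rev [i..<i + k])"

text \<open>
  Planar isotopy of tangles in standard form is generated by the following moves: exchanging the
  heights of two horizontally separated slices; straightening a zigzag; and rotating an input
  disc by a full turn.  The last move is written in the equivalent form that turning a disc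
  upside down clockwise and anticlockwise gives the same picture: in the first diagram the top
  strings of the box are bent over to the right and its bottom strings around to the left, in
  the second one it is the other way round.
\<close>

inductive isotopy_move :: "'v diagram \<Rightarrow> 'v diagram \<Rightarrow> bool" where
  exchange: "isotopy_move
     (u @ [a, shift (position a + outs a) b] @ v)
     (u @ [shift (position a + ins a) b, a] @ v)"
| zigzag_right: "isotopy_move (u @ [Cup i, Cap (Suc i)] @ v) (u @ v)"
| zigzag_left: "isotopy_move (u @ [Cup (Suc i), Cap i] @ v) (u @ v)"
| turn: "isotopy_move
     (u @ cups k i @ [Box (i + k) k x] @ caps k (i + k) @ v)
     (u @ cups k (i + k) @ [Box (i + k) k x] @ caps k i @ v)"

text \<open>Reflection in a horizontal line, applying the involution f to the labels.\<close>

fun reflect_slice :: "('v \<Rightarrow> 'v) \<Rightarrow> 'v slice \<Rightarrow> 'v slice" where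
  "reflect_slice f (Cup i) = Cap i"
| "reflect_slice f (Cap i) = Cup i"
| "reflect_slice f (Box i k x) = Box i k (f x)"

definition reflect :: "('v \<Rightarrow> 'v) \<Rightarrow> 'v diagram \<Rightarrow> 'v diagram" where
  "reflect f w = rev (map (reflect_slice f) w)"


section \<open>Subfactor planar algebras\<close>

text \<open>
  The spaces \<open>\<P>\<^sub>k\<^sub>,\<^sub>\<plusminus>\<close> are subspaces of one ambient complex vector space (for instance their direct
  sum).  \<open>act P s k w\<close> is the value in \<open>\<P>\<^sub>k\<^sub>,\<^sub>s\<close> of the labelled tangle w, i.e. the multilinear map
  associated with the underlying tangle, applied to the labels.
\<close>

record 'v planar_data =
  box_space :: "nat \<Rightarrow> shading \<Rightarrow> 'v set"
  smult :: "complex \<Rightarrow> 'v \<Rightarrow> 'v"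
  star :: "'v \<Rightarrow> 'v"
  act :: "shading \<Rightarrow> nat \<Rightarrow> 'v diagram \<Rightarrow> 'v"

locale shaded_planar_algebra = vector_space "smult P"
  for P :: "'v::ab_group_add planar_data" +
  assumes subspace_box_space: "subspace (box_space P k s)"
    and act_in: "wf_diagram (box_space P) s k w k \<Longrightarrow> act P s k w \<in> box_space P k s"
    and act_multilinear:
      "wf_diagram (box_space P) s k (u @ [Box i j x] @ v) k \<Longrightarrow>
       wf_diagram (box_space P) s k (u @ [Box i j y] @ v) k \<Longrightarrow>
       act P s k (u @ [Box i j (smult P a x + smult P b y)] @ v) =
       smult P a (act P s k (u @ [Box i j x] @ v)) + smult P b (act P s k (u @ [Box i j y] @ v))"
    and act_isotopy:
      "isotopy_move w w' \<Longrightarrow> wf_diagram (box_space P) s k w k \<Longrightarrow>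
       wf_diagram (box_space P) s k w' k \<Longrightarrow> act P s k w = act P s k w'"
    and act_identity: "x \<in> box_space P k s \<Longrightarrow> act P s k [Box 0 k x] = x"
    and act_composition:
      \<comment> \<open>compatibility with gluing the tangle w into an input disc\<close>
      "wf_diagram (box_space P) (cross i s) j w j \<Longrightarrow>
       wf_diagram (box_space P) s k (u @ [Box i j (act P (cross i s) j w)] @ v) k \<Longrightarrow>
       act P s k (u @ [Box i j (act P (cross i s) j w)] @ v) = act P s k (u @ map (shift i) w @ v)"

text \<open>
  If \<open>\<P>\<^sub>0\<^sub>,\<^sub>s\<close> is one-dimensional, spanned by the empty diagram, \<open>scalar\<close> is the
  resulting identification with the complex numbers.
\<close>

definition scalar :: "'v planar_data \<Rightarrow> shading \<Rightarrow> 'v \<Rightarrow> complex" where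
  "scalar P s x = (THE c. x = smult P c (act P s 0 []))"

text \<open>Multiplication is stacking, with x on top of y.\<close>

definition mult :: "'v planar_data \<Rightarrow> shading \<Rightarrow> nat \<Rightarrow> 'v \<Rightarrow> 'v \<Rightarrow> 'v" where
  "mult P s k x y = act P s k [Box 0 k y, Box 0 k x]"

text \<open>The unnormalized trace, closing all strings around the right.\<close>

definition Tr :: "'v planar_data \<Rightarrow> shading \<Rightarrow> nat \<Rightarrow> 'v \<Rightarrow> complex" where
  "Tr P s k x = scalar P s (act P s 0 (cups k 0 @ [Box 0 k x] @ caps k 0))"

locale planar_star_algebra = shaded_planar_algebra P
  for P :: "'v::ab_group_add planar_data" +
  assumes star_in: "x \<in> box_space P k s \<Longrightarrow> star P x \<in> box_space P k s"
    and star_star: "x \<in> box_space P k s \<Longrightarrow> star P (star P x) = x"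
    and star_antilinear:
      "x \<in> box_space P k s \<Longrightarrow> y \<in> box_space P k s \<Longrightarrow>
       star P (smult P a x + smult P b y) = smult P (cnj a) (star P x) + smult P (cnj b) (star P y)"
    and star_act:
      "wf_diagram (box_space P) s k w k \<Longrightarrow>
       star P (act P s k w) = act P s k (reflect (star P) w)"

text \<open>Here \<open>d\<close> is the modulus, the value of a closed loop.\<close>

locale subfactor_planar_algebra = planar_star_algebra P
  for P :: "'v::ab_group_add planar_data" and d :: real +
  assumes finite_dim: "\<exists>B. finite B \<and> box_space P k s = span B"
    and zero_box_space: "box_space P 0 s = span {act P s 0 []}"
    and empty_diagram_nonzero: "act P s 0 [] \<noteq> 0"
    and loop: "act P s 0 [Cup 0, Cap 0] = smult P (complex_of_real d) (act P s 0 [])"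
    and spherical:
      \<comment> \<open>the right and the left closure of a 1-box agree\<close>
      "x \<in> box_space P 1 s \<Longrightarrow>
       scalar P s (act P s 0 [Cup 0, Box 0 1 x, Cap 0]) =
       scalar P (opposite s) (act P (opposite s) 0 [Cup 0, Box 1 1 x, Cap 0])"
    and positive_definite:
      "x \<in> box_space P k s \<Longrightarrow> x \<noteq> 0 \<Longrightarrow>
       \<exists>t>0. Tr P s k (mult P s k (star P x) x) = complex_of_real t"

text \<open>Temperley-Lieb: the span of the tangles without input discs.\<close>

definition TL :: "'v::ab_group_add planar_data \<Rightarrow> nat \<Rightarrow> shading \<Rightarrow> 'v set" where
  "TL P k s = module.span (smult P) {act P s k w | w. wf_diagram (\<lambda>_ _. {}) s k w k}"

definition supertransitive :: "'v::ab_group_add planar_data \<Rightarrow> nat \<Rightarrow> bool" where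
  "supertransitive P m \<longleftrightarrow> (\<forall>j\<le>m. box_space P j Plus = TL P j Plus)"

text \<open>
  Only meaningful if the planar algebra is (n-1)-supertransitive.  There is no truncation in the
  subtraction, since TL is a subspace of the box space.
\<close>

definition multiplicity :: "'v::ab_group_add planar_data \<Rightarrow> nat \<Rightarrow> nat" where
  "multiplicity P n =
     vector_space.dim (smult P) (box_space P n Plus) - vector_space.dim (smult P) (TL P n Plus)"

text \<open>
  One-click rotation (\<open>n \<ge> 1\<close>) of an n-box of shading s: the leftmost bottom string of the box is
  bent around to the left and up, the rightmost top string over to the right and down.
\<close>

definition rotation :: "'v planar_data \<Rightarrow> shading \<Rightarrow> nat \<Rightarrow> 'v \<Rightarrow> 'v" where
  "rotation P s n x = act P (opposite s) n [Cup 0, Box 1 n x, Cap n]"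


section \<open>Principal graphs\<close>

text \<open>A triple \<open>(s, k, p)\<close> stands for the element p of the box space with parameters k and s.\<close>

type_synonym 'v box = "shading \<times> nat \<times> 'v"

fun is_projection :: "'v planar_data \<Rightarrow> 'v box \<Rightarrow> bool" where
  "is_projection P (s, k, p) \<longleftrightarrow> p \<in> box_space P k s \<and> star P p = p \<and> mult P s k p p = p"

fun minimal_projection :: "'v::zero planar_data \<Rightarrow> 'v box \<Rightarrow> bool" where
  "minimal_projection P (s, k, p) \<longleftrightarrow>
     is_projection P (s, k, p) \<and> p \<noteq> 0 \<and>
     (\<forall>x \<in> box_space P k s. \<exists>c. mult P s k p (mult P s k x p) = smult P c p)"

text \<open>
  For even k + l, the space \<open>\<P>\<^sub>k\<^sub>\<rightarrow>\<^sub>l\<close> of boxes with k strings at the bottom and l at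
  the top is \<open>\<P>\<^sub>m\<close> with m = (k + l)/2, strings being bent around on the right.
  \<open>draw k l x\<close> is the m-box x drawn with k strings below and l above; \<open>unbend k l w\<close> turns a
  diagram w with k strings below and l above back into one with m below and m above.  One of the
  truncated differences m - k and m - l is zero, unless k = l and both are.
\<close>

definition draw :: "nat \<Rightarrow> nat \<Rightarrow> 'v \<Rightarrow> 'v diagram" where
  "draw k l x = (let m = (k + l) div 2 in cups (m - k) k @ [Box 0 m x] @ caps (m - l) l)"

definition unbend :: "nat \<Rightarrow> nat \<Rightarrow> 'v diagram \<Rightarrow> 'v diagram" where
  "unbend k l w = (let m = (k + l) div 2 in cups (m - l) m @ w @ caps (m - k) m)"

text \<open>Morphisms from p to q: elements x of \<open>\<P>\<^sub>k\<^sub>\<rightarrow>\<^sub>l\<close> with q x p = x.\<close>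

fun hom :: "'v::zero planar_data \<Rightarrow> 'v box \<Rightarrow> 'v box \<Rightarrow> 'v set" where
  "hom P (s, k, p) (t, l, q) =
     (if s = t \<and> even (k + l)
      then {x \<in> box_space P ((k + l) div 2) s.
              act P s ((k + l) div 2) (unbend k l ([Box 0 k p] @ draw k l x @ [Box 0 l q])) = x}
      else {0})"

fun isomorphic :: "'v::zero planar_data \<Rightarrow> 'v box \<Rightarrow> 'v box \<Rightarrow> bool" where
  "isomorphic P (s, k, p) (t, l, q) \<longleftrightarrow>
     s = t \<and> even (k + l) \<and>
     (\<exists>f \<in> hom P (s, k, p) (t, l, q). \<exists>g \<in> hom P (t, l, q) (s, k, p).
        act P s k (draw k l f @ draw l k g) = p \<and> act P s l (draw l k g @ draw k l f) = q)"

text \<open>Adding a string on the right.\<close>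

fun add_strand :: "'v planar_data \<Rightarrow> 'v box \<Rightarrow> 'v box" where
  "add_strand P (s, k, p) = (s, Suc k, act P s (Suc k) [Box 0 k p])"

text \<open>\<open>\<Gamma>\<^sub>+\<close> and \<open>\<Gamma>\<^sub>-\<close> have the vertex sets \<open>vertices P Plus\<close> and \<open>vertices P Minus\<close>.\<close>

definition vertex :: "'v::zero planar_data \<Rightarrow> 'v box \<Rightarrow> 'v box set" where
  "vertex P p = {q. minimal_projection P q \<and> isomorphic P p q}"

definition vertices :: "'v::zero planar_data \<Rightarrow> shading \<Rightarrow> 'v box set set" where
  "vertices P s = {vertex P (s, k, p) | k p. minimal_projection P (s, k, p)}"

text \<open>Number of edges between two vertices; it does not depend on the representatives.\<close>

definition edges :: "'v::ab_group_add planar_data \<Rightarrow> 'v box set \<Rightarrow> 'v box set \<Rightarrow> nat" where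
  "edges P X Y =
     vector_space.dim (smult P) (hom P (add_strand P (SOME p. p \<in> X)) (SOME q. q \<in> Y))"

definition base_point :: "'v::zero planar_data \<Rightarrow> shading \<Rightarrow> 'v box set" where
  "base_point P s = vertex P (s, 0, act P s 0 [])"

definition adjacent ::
  "'v::ab_group_add planar_data \<Rightarrow> shading \<Rightarrow> 'v box set \<Rightarrow> 'v box set \<Rightarrow> bool" where
  "adjacent P s X Y \<longleftrightarrow> X \<in> vertices P s \<and> Y \<in> vertices P s \<and> edges P X Y \<noteq> 0"

definition depth :: "'v::ab_group_add planar_data \<Rightarrow> shading \<Rightarrow> 'v box set \<Rightarrow> nat" where
  "depth P s X = (LEAST d. (adjacent P s ^^ d) (base_point P s) X)"

definition vertices_at ::
  "'v::ab_group_add planar_data \<Rightarrow> shading \<Rightarrow> nat \<Rightarrow> 'v box set set" where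
  "vertices_at P s d = {X \<in> vertices P s. depth P s X = d}"

text \<open>
  The dual of a projection is its rotation by 180 degrees; on isomorphism classes, the dual
  vertex consists of the duals of all the members.
\<close>

fun dual :: "'v planar_data \<Rightarrow> 'v box \<Rightarrow> 'v box" where
  "dual P (s, k, p) =
     (cross k s, k, act P (cross k s) k (cups k 0 @ [Box k k p] @ caps k k))"

definition dual_vertex :: "'v planar_data \<Rightarrow> 'v box set \<Rightarrow> 'v box set" where
  "dual_vertex P X = dual P ` X"

text \<open>
  The graph of shading s has exactly the three vertices A, B, C at depth n, each joined
  by a single edge to the unique vertex at depth n-1; A is self-dual, and B and C are dual to
  each other (n is even).  The elements A, B, C are minimal projections among the n-boxes that
  represent these vertices.
\<close>

definition Q_at :: "'v::ab_group_add planar_data \<Rightarrow> shading \<Rightarrow> nat \<Rightarrow> 'v \<Rightarrow> 'v \<Rightarrow> 'v \<Rightarrow> bool" where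
  "Q_at P s n A B C \<longleftrightarrow>
     minimal_projection P (s, n, A) \<and> minimal_projection P (s, n, B) \<and>
     minimal_projection P (s, n, C) \<and>
     distinct [vertex P (s, n, A), vertex P (s, n, B), vertex P (s, n, C)] \<and>
     vertices_at P s n = {vertex P (s, n, A), vertex P (s, n, B), vertex P (s, n, C)} \<and>
     (\<exists>X. vertices_at P s (n - 1) = {X} \<and> (\<forall>Y \<in> vertices_at P s n. edges P X Y = 1)) \<and>
     dual_vertex P (vertex P (s, n, A)) = vertex P (s, n, A) \<and>
     dual_vertex P (vertex P (s, n, B)) = vertex P (s, n, C) \<and>
     dual_vertex P (vertex P (s, n, C)) = vertex P (s, n, B)"


section \<open>Quantum numbers\<close>

definition admissible :: "complex \<Rightarrow> bool" where
  "admissible q \<longleftrightarrow>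
     q \<in> {exp (2 * of_real pi * \<i> / (2 * of_nat j)) | j::nat. j \<ge> 3} \<union> complex_of_real ` {1..}"

definition qnum :: "complex \<Rightarrow> nat \<Rightarrow> complex" where
  "qnum q k = (if q = 1 then of_nat k else (q ^ k - inverse q ^ k) / (q - inverse q))"

end

theory Submission
  imports Defs "HOL-Computational_Algebra.Fundamental_Theorem_Algebra"
begin

text \<open>
  Write [k] for \<open>qreal d k\<close>, f and f' for the Jones-Wenzl projections on n strings of the two
  shadings, p, q, r and p', q', r' for the projections at depth n, ratio for the common
  value of the two ratios of traces, and A, A' for the elements ratio p - (q + r) and
  ratio p' - (q' + r').  By multiplicity two, the corner cut out by f is spanned by p, q and r;
  hence p + q + r = f and (ratio + 1) p = A + f.

  The rotation of A vanishes under all caps and cups, has trace zero, and is invariant under the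
  half turn, because duality fixes p and exchanges q and r.  So it is z A' for some number z
  (\<open>rotation_A\<close>).  The trace form is invariant under the rotation and gives A and A' the
  same length, so that z has modulus one (\<open>rotation_A_norm\<close>).  This z is the chirality,
  since the square roots in its definition cancel.

  The rotation of p is seen by q'.  On the one hand q' A' = - q'; on the other hand the
  rotation of f is - 1 / [n] times the identity modulo diagrams with a minimum at the top
  (\<open>jw_rotation_jw\<close>; the sign comes from n being even).  With
  gamma = (- 1 / [n] - z) / (ratio + 1) this says that q' times the rotated p is gamma q'
  (\<open>qprime_rotation_p\<close>).

  The hypothesis on the graphs gives the modulus of gamma.  Let kappa = Tr(p) / [n]; this is the factor
  by which the partial trace of p differs from the Jones-Wenzl projection on n - 1 strings.  As
  in Wenzl's recursion, the part Y of p with an added string that does not come from depth n - 1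
  is that element minus 1 / kappa times itself, a cap and a cup, and itself again.  It is a sum of
  minimal projections at depth n + 1 that are adjacent to p.  By hypothesis their duals are
  adjacent, among the vertices at depth n, only to p'; so q' with an added string annihilates
  the dual of Y (\<open>qprime_dl_Y\<close>).  Multiplying the dual of Y by q' from both sides and closing
  the last string turns its first term into kappa q', and its second term into q' times the
  rotated p times the adjoint of this product, divided by kappa.  Therefore kappa is the modulus
  of gamma (\<open>kap_square\<close>).  Since Tr(p) (ratio + 1) = [n+1], this is the equation
  [n+1]^2 = [n]^2 + [n] (z + 1 / z) + 1, and [n+1]^2 - [n] [n+2] = 1 turns it into
  z + 1 / z = [n+2] - [n] = q^(n+1) + q^(-n-1).  The left side is at most 2, which
  excludes q > 1 (\<open>modulus_le_2\<close>).

  These computations are made with diagrams, up to a relation \<open>eqv\<close> that can be applied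
  inside larger diagrams.  The principal graphs enter through three facts.  An edge means that
  some diagram between the two projections does not vanish (\<open>edges_nonzero_iff\<close>).  A minimal
  projection in which a non-vanishing diagram ends has a copy at the other end of that
  diagram (\<open>minimal_transport\<close>).  So a projection at depth n annihilates all diagrams
  that come from fewer than n strings (\<open>depth_null\<close>); in particular, it annihilates cups.
\<close>

hide_const (open) Polynomial.smult Multiset.mult Factorial_Ring.multiplicity
hide_fact (open) Multiset.mult_def Factorial_Ring.multiplicity_def

section \<open>Calculus of diagrams\<close>

lemma opposite_opposite [simp]: "opposite (opposite s) = s"
  by (cases s) auto

lemma cross_cross: "cross i (cross j s) = cross (i + j) s"
  by (simp add: funpow_add)

lemma cross_even: "even k \<Longrightarrow> cross k s = s"
proof (elim evenE)
  fix j assume "k = 2 * j"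
  moreover have "cross (2 * j) s = s" by (induction j) simp_all
  ultimately show ?thesis by simp
qed

lemma cross_cong: "even (i + j) \<Longrightarrow> cross i s = cross j s"
proof -
  assume "even (i + j)"
  then have "cross i s = cross i (cross (i + j) s)" by (simp only: cross_even)
  also have "\<dots> = cross (2 * i + j) s" by (simp only: cross_cross mult_2 add.assoc)
  also have "\<dots> = cross (2 * i) (cross j s)" by (simp only: cross_cross)
  finally show ?thesis by (simp only: cross_even even_mult_iff even_two_times_div_two) (simp add: cross_even)
qed

lemma wf_append:
  "wf_diagram V s m (u @ v) l \<longleftrightarrow> (\<exists>k. wf_diagram V s m u k \<and> wf_diagram V s k v l)"
proof (induction u arbitrary: m)
  case (Cons a u) then show ?case by (cases a) auto
qed simp

lemma wf_Cons:
  "wf_diagram V s m (a # w) l \<longleftrightarrow> (\<exists>k. wf_diagram V s m [a] k \<and> wf_diagram V s k w l)"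
  using wf_append[of V s m "[a]" w l] by simp

lemma wf_parity: "wf_diagram V s m w l \<Longrightarrow> even (m + l)"
proof (induction w arbitrary: m)
  case (Cons a w) then show ?case by (cases a) fastforce+
qed simp

lemma wf_unique: "wf_diagram V s m w l \<Longrightarrow> wf_diagram V s m w l' \<Longrightarrow> l = l'"
proof (induction w arbitrary: m)
  case (Cons a w) then show ?case by (cases a) auto
qed simp

lemma wf_widen: "wf_diagram V s m w l \<Longrightarrow> wf_diagram V s (m + r) w (l + r)"
proof (induction w arbitrary: m)
  case (Cons a w)
  show ?case
  proof (cases a)
    case (Cap i)
    then have *: "i + 2 \<le> m" "wf_diagram V s (m - 2 + r) w (l + r)"
      using Cons.prems Cons.IH[of "m - 2"] by auto
    then have "m - 2 + r = m + r - 2" by simp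
    then show ?thesis using Cap * by (simp del: One_nat_def)
  next
    case (Cup i)
    then have *: "i \<le> m" "wf_diagram V s (m + 2 + r) w (l + r)"
      using Cons.prems Cons.IH[of "m + 2"] by auto
    then show ?thesis using Cup by (simp add: add.commute add.left_commute)
  qed (use Cons in auto)
qed simp

lemma wf_shift: "wf_diagram V (cross j s) m w l \<Longrightarrow> wf_diagram V s (j + m) (map (shift j) w) (j + l)"
proof (induction w arbitrary: m)
  case (Cons a w)
  show ?case
  proof (cases a)
    case (Cap i)
    then have *: "i + 2 \<le> m" "wf_diagram V s (j + (m - 2)) (map (shift j) w) (j + l)"
      using Cons.prems Cons.IH[of "m - 2"] by auto
    then have "j + (m - 2) = j + m - 2" by simp
    then show ?thesis using Cap * by (simp del: One_nat_def)
  next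
    case (Box i k x)
    then have "i + k \<le> m" "x \<in> V k (cross (j + i) s)" "wf_diagram V s (j + m) (map (shift j) w) (j + l)"
      using Cons.prems Cons.IH[of m] by (auto simp: cross_cross add.commute)
    then show ?thesis using Box by simp
  next
    case (Cup i)
    then show ?thesis using Cons.prems Cons.IH[of "m + 2"] by auto
  qed
qed simp

lemma wf_shift_widen:
  "wf_diagram V (cross j s) m w l \<Longrightarrow> wf_diagram V s (j + m + r) (map (shift j) w) (j + l + r)"
  by (intro wf_widen wf_shift)

lemma cups_0 [simp]: "cups 0 i = []" and caps_0 [simp]: "caps 0 i = []"
  by (simp_all add: cups_def caps_def)

lemma cups_Suc: "cups (Suc k) i = Cup i # cups k (Suc i)"
  by (simp add: cups_def upt_rec)

lemma caps_Suc: "caps (Suc k) i = Cap (i + k) # caps k i"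
  by (simp add: caps_def)

lemma cups_Suc': "cups (Suc k) i = cups k i @ [Cup (i + k)]"
  by (simp add: cups_def)

lemma caps_Suc': "caps (Suc k) i = caps k (Suc i) @ [Cap i]"
  by (induction k) (simp_all add: caps_Suc)

lemma cups_add: "cups (k + l) i = cups k i @ cups l (i + k)"
  by (induction k arbitrary: i) (simp_all add: cups_Suc)

lemma caps_add: "caps (k + l) i = caps l (i + k) @ caps k i"
  by (induction l) (simp_all add: caps_Suc add.assoc)

lemma map_shift_cups [simp]: "map (shift j) (cups k i) = cups k (j + i)"
  by (induction k arbitrary: i) (simp_all add: cups_Suc)

lemma map_shift_caps [simp]: "map (shift j) (caps k i) = caps k (j + i)"
  by (induction k) (simp_all add: caps_Suc add.assoc)

lemma shift_shift [simp]: "shift i (shift j a) = shift (i + j) a"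
  by (cases a) auto

lemma shift_0 [simp]: "shift 0 a = a"
  by (cases a) auto

lemma map_shift_0 [simp]: "map (shift 0) w = w"
  by (simp add: map_idI)

lemma wf_cups: "i \<le> m \<Longrightarrow> wf_diagram V s m (cups k i) (m + 2 * k)"
  by (induction k) (auto simp: cups_Suc' wf_append)

lemma wf_cups_append [simp]:
  "i \<le> m \<Longrightarrow> wf_diagram V s m (cups k i @ w) l \<longleftrightarrow> wf_diagram V s (m + 2 * k) w l"
  using wf_cups wf_unique unfolding wf_append by metis

lemma wf_caps: "i + 2 * k \<le> m \<Longrightarrow> wf_diagram V s m (caps k i) (m - 2 * k)"
proof (induction k arbitrary: m)
  case (Suc k)
  have "i + 2 * k \<le> m - 2" "m - 2 - 2 * k = m - 2 * Suc k" using Suc.prems by auto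
  then have "wf_diagram V s (m - 2) (caps k i) (m - 2 * Suc k)" using Suc.IH[of "m - 2"] by metis
  moreover have "i + k + 2 \<le> m" using Suc.prems by simp
  ultimately show ?case by (simp add: caps_Suc)
qed auto

lemma wf_caps_iff [simp]:
  "i + 2 * k \<le> m \<Longrightarrow> wf_diagram V s m (caps k i) l \<longleftrightarrow> l = m - 2 * k"
  using wf_caps wf_unique by metis

lemma wf_cups_iff [simp]:
  "i \<le> m \<Longrightarrow> wf_diagram V s m (cups k i) l \<longleftrightarrow> l = m + 2 * k"
  using wf_cups wf_unique by metis

lemma isotopy_move_context: "isotopy_move w w' \<Longrightarrow> isotopy_move (u @ w @ v) (u @ w' @ v)"
proof (induction rule: isotopy_move.induct)
  case (exchange u' a b v')
  then show ?case using isotopy_move.exchange[of "u @ u'" a b "v' @ v"] by simp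
next
  case (zigzag_right u' i v')
  then show ?case using isotopy_move.zigzag_right[of "u @ u'" i "v' @ v"] by simp
next
  case (zigzag_left u' i v')
  then show ?case using isotopy_move.zigzag_left[of "u @ u'" i "v' @ v"] by simp
next
  case (turn u' k i x v')
  then show ?case using isotopy_move.turn[of "u @ u'" k i x "v' @ v"] by simp
qed

text \<open>
  Moving the picture of a slice to position j.  In contrast to \<open>shift\<close> this can also move
  it to the left.
\<close>

fun relocate :: "nat \<Rightarrow> 'v slice \<Rightarrow> 'v slice" where
  "relocate j (Cup i) = Cup j"
| "relocate j (Cap i) = Cap j"
| "relocate j (Box i k x) = Box j k x"

lemma relocate_eq_shift:
  "p \<le> position b \<Longrightarrow> relocate (position b - p + p') b = shift p' (relocate (position b - p) b)"
  by (cases b) auto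

lemma outs_position_relocate [simp]: "outs (relocate j b) = outs b" "position (relocate j b) = j"
  by (cases b; simp)+

lemma relocate_relocate [simp]: "relocate i (relocate j b) = relocate i b" 
  "relocate (position b) b = b"
  by (cases b; simp)+

text \<open>
  One step of an isotopy: the slices at places j and j+1 of a diagram cancel if they form a zigzag,
  and otherwise exchange their heights if they are horizontally separated.  A whole isotopy is then
  the list of the places at which it acts, and is checked by evaluation.
\<close>

fun zigzag :: "'v slice \<Rightarrow> 'v slice \<Rightarrow> bool" where
  "zigzag (Cup i) (Cap j) \<longleftrightarrow> j = Suc i \<or> i = Suc j"
| "zigzag _ _ \<longleftrightarrow> False"

fun slide_top :: "'v diagram \<Rightarrow> 'v diagram" where
  "slide_top (a # b # w) =
    (if zigzag a b then w
     else if position b + ins b \<le> position a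
       then b # relocate (position a - (position b + ins b) + (position b + outs b)) a # w
     else if position a + outs a \<le> position b
       then relocate (position b - (position a + outs a) + (position a + ins a)) b # a # w
     else a # b # w)"
| "slide_top w = w"

definition slide :: "nat \<Rightarrow> 'v diagram \<Rightarrow> 'v diagram" where
  [simp]: "slide j w = take j w @ slide_top (drop j w)"

lemma wf_swap:
  assumes "wf_diagram V s m [a, shift (position a + outs a) b] l"
  shows "wf_diagram V s m [shift (position a + ins a) b, a] l"
proof -
  have *: "cross (Suc (Suc i)) s = cross i s" for i by simp
  show ?thesis
  using assms by (cases a; cases b) (auto simp: numeral_2_eq_2)
qed

context shaded_planar_algebra
begin

abbreviation tangle :: "shading \<Rightarrow> nat \<Rightarrow> 'v diagram \<Rightarrow> nat \<Rightarrow> bool" where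
  "tangle \<equiv> wf_diagram (box_space P)"

text \<open>
  Equality of diagrams from m to l strings must be usable inside larger diagrams.  It is therefore
  tested in all contexts that complete the two diagrams, with any number r of strings passing by
  on the right; strings passing by on the left are then harmless too, by
  \<open>eqv_shift\<close> below.
\<close>

definition eqv :: "shading \<Rightarrow> nat \<Rightarrow> nat \<Rightarrow> 'v diagram \<Rightarrow> 'v diagram \<Rightarrow> bool" where
  "eqv s m l w w' \<longleftrightarrow> tangle s m w l \<and> tangle s m w' l \<and>
     (\<forall>r k u v. tangle s k u (m + r) \<longrightarrow> tangle s (l + r) v k \<longrightarrow>
        act P s k (u @ w @ v) = act P s k (u @ w' @ v))"

lemma eqv_tangle: "eqv s m l w w' \<Longrightarrow> tangle s m w l" "eqv s m l w w' \<Longrightarrow> tangle s m w' l"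
  by (simp_all add: eqv_def)

lemma eqv_refl: "tangle s m w l \<Longrightarrow> eqv s m l w w"
  by (simp add: eqv_def)

lemma eqv_sym: "eqv s m l w w' \<Longrightarrow> eqv s m l w' w"
  by (simp add: eqv_def)

lemma eqv_trans [trans]: "eqv s m l w w' \<Longrightarrow> eqv s m l w' w'' \<Longrightarrow> eqv s m l w w''"
  by (simp add: eqv_def)

lemma eqv_act: "eqv s k k w w' \<Longrightarrow> act P s k w = act P s k w'"
  unfolding eqv_def using wf_diagram.simps(1)[of "box_space P" s k k] by (metis add.right_neutral append.left_neutral append.right_neutral)

lemma eqv_context:
  assumes "eqv s m l w w'" "tangle s k u (m + r)" "tangle s (l + r) v k'"
  shows "eqv s k k' (u @ w @ v) (u @ w' @ v)"
  unfolding eqv_def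
proof (intro conjI allI impI)
  show "tangle s k (u @ w @ v) k'" "tangle s k (u @ w' @ v) k'"
    using assms wf_widen[OF eqv_tangle(1)[OF assms(1)], of r]
      wf_widen[OF eqv_tangle(2)[OF assms(1)], of r] by (auto simp: wf_append)
  fix r' j u' v' assume "tangle s j u' (k + r')" "tangle s (k' + r') v' j"
  then have "tangle s j (u' @ u) (m + (r + r'))" "tangle s (l + (r + r')) (v @ v') j"
    using wf_widen[OF assms(2), of r'] wf_widen[OF assms(3), of r']
    by (auto simp: wf_append add.assoc)
  then show "act P s j (u' @ (u @ w @ v) @ v') = act P s j (u' @ (u @ w' @ v) @ v')"
    using assms(1) unfolding eqv_def by (metis append.assoc)
qed

lemma eqv_append:
  assumes "eqv s m k u u'" "eqv s k l v v'" shows "eqv s m l (u @ v) (u' @ v')"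
proof -
  have "eqv s m l (u @ v) (u' @ v)"
    using eqv_context[OF assms(1), of m "[]" 0 v l] eqv_tangle(1)[OF assms(2)] by simp
  also have "eqv s m l (u' @ v) (u' @ v')"
    using eqv_context[OF assms(2), of m "u'" 0 "[]" l] eqv_tangle(2)[OF assms(1)] by simp
  finally show ?thesis .
qed

lemma eqv_prefix: "tangle s m u k \<Longrightarrow> eqv s k l v v' \<Longrightarrow> eqv s m l (u @ v) (u @ v')"
  using eqv_append eqv_refl by blast

lemma eqv_suffix: "eqv s m k u u' \<Longrightarrow> tangle s k v l \<Longrightarrow> eqv s m l (u @ v) (u' @ v)"
  using eqv_append eqv_refl by blast

lemma eqv_Cons: "tangle s m [a] k \<Longrightarrow> eqv s k l v v' \<Longrightarrow> eqv s m l (a # v) (a # v')"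
  using eqv_prefix[of s m "[a]"] by simp

lemma eqv_widen: "eqv s m l w w' \<Longrightarrow> eqv s (m + r) (l + r) w w'"
  using eqv_context[of s m l w w' "m + r" "[]" r "[]" "l + r"] by simp

lemma eqv_replace:
  assumes "tangle s m (u @ a @ v) l"
    and "\<And>m' l'. tangle s m' a l' \<Longrightarrow> eqv s m' l' a b"
  shows "eqv s m l (u @ a @ v) (u @ b @ v)"
proof -
  obtain m' l' where "tangle s m u m'" "tangle s m' a l'" "tangle s l' v l"
    using assms(1) by (auto simp: wf_append)
  then show ?thesis
    using eqv_context[OF assms(2), of m' l' m u 0 v l] by simp
qed

text \<open>
  The isotopy moves are themselves given in arbitrary contexts, but only as whole diagrams; this
  transfers them to parts of diagrams.
\<close>

lemma isotopy_move_eqv: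
  assumes "isotopy_move w w'" "tangle s m w l" "tangle s m w' l"
  shows "eqv s m l w w'"
  unfolding eqv_def
proof (intro conjI allI impI)
  fix r k u v assume *: "tangle s k u (m + r)" "tangle s (l + r) v k"
  then have "tangle s k (u @ w @ v) k" "tangle s k (u @ w' @ v) k"
    using wf_widen[OF assms(2), of r] wf_widen[OF assms(3), of r] by (auto simp: wf_append)
  then show "act P s k (u @ w @ v) = act P s k (u @ w' @ v)"
    using act_isotopy isotopy_move_context assms(1) by blast
qed (use assms in auto)

lemma eqv_exchange:
  assumes "tangle s m [a, shift (position a + outs a) b] l"
  shows "eqv s m l [a, shift (position a + outs a) b] [shift (position a + ins a) b, a]"
  using isotopy_move_eqv[OF isotopy_move.exchange[of "[]" a b "[]"]] assms wf_swap[OF assms] by simp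

lemma eqv_swap_right:
  assumes "tangle s m (u @ [a, b] @ v) l" "position a + outs a \<le> position b"
  shows "eqv s m l (u @ [a, b] @ v) (u @ [relocate (position b - (position a + outs a) + (position a + ins a)) b, a] @ v)"
proof (rule eqv_replace)
  define c where "c = relocate (position b - (position a + outs a)) b"
  have b: "shift (position a + outs a) c = b"
    using relocate_eq_shift[OF assms(2), of "position a + outs a"] assms(2) by (simp add: c_def)
  have b': "relocate (position b - (position a + outs a) + (position a + ins a)) b = shift (position a + ins a) c"
    using relocate_eq_shift[OF assms(2)] by (simp add: c_def)
  fix m' l' assume *: "tangle s m' [a, b] l'"
  show "eqv s m' l' [a, b] [relocate (position b - (position a + outs a) + (position a + ins a)) b, a]"
    using eqv_exchange[of s m' a c l'] * unfolding b' b by blast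
qed fact

lemma wf_swap':
  assumes "wf_diagram V s m [shift (position a + ins a) b, a] l"
  shows "wf_diagram V s m [a, shift (position a + outs a) b] l"
proof -
  have *: "cross (Suc (Suc i)) s = cross i s" for i by simp
  show ?thesis
  using assms by (cases a; cases b) (auto simp: numeral_2_eq_2)
qed

lemma eqv_swap_left:
  assumes "tangle s m (u @ [a, b] @ v) l" "position b + ins b \<le> position a"
  shows "eqv s m l (u @ [a, b] @ v) (u @ [b, relocate (position a - (position b + ins b) + (position b + outs b)) a] @ v)"
proof (rule eqv_replace)
  define c where "c = relocate (position a - (position b + ins b)) a"
  have a: "shift (position b + ins b) c = a"
    using relocate_eq_shift[OF assms(2), of "position b + ins b"] assms(2) by (simp add: c_def)
  have a': "relocate (position a - (position b + ins b) + (position b + outs b)) a = shift (position b + outs b) c"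
    using relocate_eq_shift[OF assms(2)] by (simp add: c_def)
  fix m' l' assume *: "tangle s m' [a, b] l'"
  show "eqv s m' l' [a, b] [b, relocate (position a - (position b + ins b) + (position b + outs b)) a]"
    using eqv_sym[OF eqv_exchange[of s m' b c l']] wf_swap'[of _ s m' b c l'] * unfolding a' a by blast
qed fact

lemma eqv_zigzag_right:
  assumes "tangle s m (u @ [Cup i, Cap (Suc i)] @ v) l"
  shows "eqv s m l (u @ [Cup i, Cap (Suc i)] @ v) (u @ v)"
  using eqv_replace[OF assms, of "[]"] isotopy_move_eqv[OF isotopy_move.zigzag_right[of "[]" i "[]"]] by auto

lemma eqv_zigzag_left:
  assumes "tangle s m (u @ [Cup (Suc i), Cap i] @ v) l"
  shows "eqv s m l (u @ [Cup (Suc i), Cap i] @ v) (u @ v)"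
  using eqv_replace[OF assms, of "[]"] isotopy_move_eqv[OF isotopy_move.zigzag_left[of "[]" i "[]"]] by auto

lemma eqv_slide: assumes "tangle s m w l" shows "eqv s m l w (slide j w)"
proof -
  have "eqv s m l (u @ v @ []) (u @ slide_top v @ [])" if t: "tangle s m (u @ v @ []) l" for u v
  proof (cases v rule: slide_top.cases)
    case (1 a b v')
    have t': "tangle s m (u @ [a, b] @ v') l" using t by (simp add: 1)
    show ?thesis
    proof (cases "zigzag a b")
      case True
      then obtain i where "a = Cup i \<and> b = Cap (Suc i) \<or> a = Cup (Suc i) \<and> b = Cap i"
        by (cases a; cases b) auto
      then have "eqv s m l (u @ [a, b] @ v') (u @ v')"
        using t' eqv_zigzag_right eqv_zigzag_left by blast
      then show ?thesis using True by (simp add: 1)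
    next
      case False
      then show ?thesis
        using eqv_swap_right[OF t'] eqv_swap_left[OF t'] eqv_refl[OF t'] by (simp add: 1)
    qed
  qed (use eqv_refl[OF t] in simp_all)
  from this[of "take j w" "drop j w"] show ?thesis using assms by (simp add: slide_def)
qed

text \<open>
  In applications js lists concrete places and the simplifier evaluates \<open>fold slide js w\<close>;
  only the bookkeeping of positions remains to be done.
\<close>

lemma eqv_slides: "tangle s m w l \<Longrightarrow> fold slide js w = w' \<Longrightarrow> eqv s m l w w'"
proof (induction js arbitrary: w)
  case (Cons j js)
  note e = eqv_slide[OF Cons.prems(1), of j]
  have "eqv s m l (slide j w) w'"
    by (rule Cons.IH[OF eqv_tangle(2)[OF e]]) (use Cons.prems(2) in simp)
  with e show ?case by (rule eqv_trans)
qed (simp add: eqv_refl)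

lemma eqv_block_slice:
  assumes "tangle s m U l" "tangle (cross m s) k [b] k'"
  shows "eqv s (m + k) (l + k') (U @ [shift l b]) ([shift m b] @ U)"
  using assms
proof (induction U arbitrary: m)
  case Nil
  then show ?case using wf_shift[of _ m s k "[b]" k'] eqv_refl by simp
next
  case (Cons a U)
  obtain m' where a: "tangle s m [a] m'" and U: "tangle s m' U l"
    using Cons.prems(1) wf_Cons by blast
  define j where "j = m - (position a + ins a)"
  have m: "m = position a + ins a + j" and m': "m' = position a + outs a + j"
    using a by (cases a; auto simp: j_def)+
  have "even (m + m')" using a wf_parity by blast
  then have b: "tangle (cross m' s) k [b] k'" using Cons.prems cross_cong[of m' m] by (simp add: add.commute)
  have sh: "shift m' b = shift (position a + outs a) (shift j b)" by (simp add: m')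
  have "eqv s (m + k) (l + k') ((a # U) @ [shift l b]) ([] @ [a, shift (position a + outs a) (shift j b)] @ U)"
    using eqv_prefix[OF wf_widen[OF a, of k] Cons.IH[OF U b]] unfolding sh by simp
  also have "eqv s (m + k) (l + k') ([] @ [a, shift (position a + outs a) (shift j b)] @ U) ([] @ [shift (position a + ins a) (shift j b), a] @ U)"
  proof (rule eqv_replace)
    have "tangle s (m' + k) [shift m' b] (m' + k')" using wf_shift[OF b] by simp
    then have "tangle s (m + k) ([a] @ [shift m' b] @ U) (l + k')"
      using wf_widen[OF a, of k] wf_widen[OF U, of k'] unfolding wf_append by blast
    then show "tangle s (m + k) ([] @ [a, shift (position a + outs a) (shift j b)] @ U) (l + k')"
      by (simp add: m' del: wf_diagram.simps)
  qed (rule eqv_exchange)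
  finally show ?case by (simp add: m)
qed

text \<open>
  The exchange move only concerns single slices; this is its version for whole diagrams standing
  side by side.
\<close>

lemma eqv_block:
  assumes "tangle s m U l" "tangle (cross m s) k W k'"
  shows "eqv s (m + k) (l + k') (U @ map (shift l) W) (map (shift m) W @ U)"
  using assms
proof (induction W arbitrary: k)
  case Nil
  then show ?case using eqv_widen[OF eqv_refl] by simp
next
  case (Cons b W)
  obtain j where b: "tangle (cross m s) k [b] j" and W: "tangle (cross m s) j W k'"
    using Cons.prems(2) wf_Cons by blast
  have "tangle s (l + j) (map (shift l) W) (l + k')"
    using wf_shift W cross_cong[OF wf_parity[OF Cons.prems(1)]] by metis
  then have "eqv s (m + k) (l + k') ((U @ [shift l b]) @ map (shift l) W) (([shift m b] @ U) @ map (shift l) W)"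
    using eqv_append[OF eqv_block_slice[OF Cons.prems(1) b]] eqv_refl by blast
  also have "([shift m b] @ U) @ map (shift l) W = [shift m b] @ (U @ map (shift l) W)" by simp
  also have "eqv s (m + k) (l + k') \<dots> ([shift m b] @ (map (shift m) W @ U))"
    using wf_shift[OF b] by (intro eqv_prefix[OF _ Cons.IH[OF Cons.prems(1) W]]) (simp del: wf_diagram.simps)
  finally show ?case by simp
qed

text \<open>
  The outermost of t nested cups can be straightened only after its cap, which is on top, has
  been slid down past the inner cups.
\<close>

lemma eqv_nested_zigzag_right:
  "i + t \<le> m \<Longrightarrow> eqv s m m (cups t i @ caps t (i + t)) []"
proof (induction t arbitrary: i)
  case 0 then show ?case by (simp add: eqv_refl)
next
  case (Suc t)
  have *: "tangle s (Suc i) (cups t (Suc i)) (Suc i + 2 * t)" "tangle (cross (Suc i) s) (m - Suc i + 2) [Cap 0] (m - Suc i)"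
    using Suc.prems by auto
  have "eqv s (m + 2) m (cups t (Suc i) @ [Cap (Suc i + 2 * t)] @ caps t (Suc i + t)) ([Cap (Suc i)] @ cups t (Suc i) @ caps t (Suc i + t))"
    using eqv_context[OF eqv_block[OF *], of "m + 2" "[]" 0 "caps t (Suc i + t)" m] Suc.prems by simp
  then have "eqv s m m (Cup i # cups t (Suc i) @ [Cap (Suc i + 2 * t)] @ caps t (Suc i + t)) ([] @ [Cup i, Cap (Suc i)] @ cups t (Suc i) @ caps t (Suc i + t))"
    using eqv_Cons[of s m "Cup i" "m + 2"] Suc.prems by simp
  also have "eqv s m m ([] @ [Cup i, Cap (Suc i)] @ cups t (Suc i) @ caps t (Suc i + t)) ([] @ cups t (Suc i) @ caps t (Suc i + t))"
    by (rule eqv_zigzag_right) (use Suc.prems in simp)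
  also have "eqv s m m ([] @ cups t (Suc i) @ caps t (Suc i + t)) []"
    using Suc.IH[of "Suc i"] Suc.prems by simp
  finally show ?case by (simp add: cups_Suc caps_Suc mult_2 add.assoc)
qed

lemma eqv_nested_zigzag_left:
  "i + t \<le> m \<Longrightarrow> eqv s m m (cups t (i + t) @ caps t i) []"
proof (induction t arbitrary: i)
  case 0 then show ?case by (simp add: eqv_refl)
next
  case (Suc t)
  have *: "tangle s (i + t + 2) [Cap (i + t)] (i + t)" "tangle (cross (i + t + 2) s) (m - (i + t)) (cups t 0) (m - (i + t) + 2 * t)"
    using Suc.prems by auto
  have "eqv s (m + 2) m ([Cap (i + t)] @ cups t (i + t) @ caps t i) (cups t (i + t + 2) @ [Cap (i + t)] @ caps t i)"
    using eqv_context[OF eqv_block[OF *], of "m + 2" "[]" 0 "caps t i" m] Suc.prems by simp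
  then have "eqv s m m (Cup (Suc (i + t)) # cups t (i + t + 2) @ [Cap (i + t)] @ caps t i) ([] @ [Cup (Suc (i + t)), Cap (i + t)] @ cups t (i + t) @ caps t i)"
    using eqv_Cons[OF _ eqv_sym, of s m "Cup (Suc (i + t))" "m + 2"] Suc.prems by simp
  also have "eqv s m m ([] @ [Cup (Suc (i + t)), Cap (i + t)] @ cups t (i + t) @ caps t i) ([] @ cups t (i + t) @ caps t i)"
    by (rule eqv_zigzag_left) (use Suc.prems in simp)
  also have "eqv s m m ([] @ cups t (i + t) @ caps t i) []"
    using Suc.IH[of "i"] Suc.prems by simp
  finally show ?case by (simp add: cups_Suc caps_Suc)
qed

text \<open>
  The composition axiom in the form in which it is used: boxes containing values of tangles can
  be opened and closed.
\<close>

lemma eqv_glue: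
  assumes "tangle (cross i s) k w k"
  shows "eqv s (i + k + r) (i + k + r) [Box i k (act P (cross i s) k w)] (map (shift i) w)"
  unfolding eqv_def
proof (intro conjI allI impI)
  have x: "act P (cross i s) k w \<in> box_space P k (cross i s)" using act_in[OF assms] .
  show "tangle s (i + k + r) [Box i k (act P (cross i s) k w)] (i + k + r)"
    using x by simp
  show "tangle s (i + k + r) (map (shift i) w) (i + k + r)"
    using wf_shift_widen[OF assms] .
  fix r' j u v assume "tangle s j u (i + k + r + r')" "tangle s (i + k + r + r') v j"
  then have "tangle s j (u @ [Box i k (act P (cross i s) k w)] @ v) j"
    using x by (auto simp: wf_append)
  then show "act P s j (u @ [Box i k (act P (cross i s) k w)] @ v) = act P s j (u @ map (shift i) w @ v)"
    using act_composition[OF assms] by blast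
qed

lemma eqv_glue_le:
  assumes "tangle (cross i s) k w k" "i + k \<le> m"
  shows "eqv s m m [Box i k (act P (cross i s) k w)] (map (shift i) w)"
  using eqv_glue[OF assms(1), of "m - (i + k)"] assms(2) by simp

lemma eqv_glue_0:
  assumes "tangle s k w k" "k \<le> m"
  shows "eqv s m m [Box 0 k (act P s k w)] w"
  using eqv_glue_le[of 0 s k w m] assms by simp

text \<open>
  The value of a diagram with different numbers of strings at the bottom and at the top.  The
  bending is undone by \<open>draw\<close>, so that two diagrams have the same value if and only if
  they are interchangeable (\<open>eqv_val\<close> and \<open>val_eqv\<close>).
\<close>

definition val :: "shading \<Rightarrow> nat \<Rightarrow> nat \<Rightarrow> 'v diagram \<Rightarrow> 'v" where
  "val s m l w = act P s ((m + l) div 2) (unbend m l w)"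

lemma unbend_diag [simp]: "unbend k k w = w"
  by (simp add: unbend_def)

lemma val_diag: "val s k k w = act P s k w"
  by (simp add: val_def)

lemma tangle_unbend:
  assumes "tangle s m w l" shows "tangle s ((m + l) div 2) (unbend m l w) ((m + l) div 2)"
proof -
  have "even (m + l)" using assms wf_parity by blast
  then have *: "2 * ((m + l) div 2) = m + l" by simp
  define M where "M = (m + l) div 2"
  show ?thesis
  proof (cases "m \<le> l")
    case True
    then have "M - l = 0" "M = m + (M - m)" "l + (M - m) - 2 * (M - m) = M" "M + 2 * (M - m) \<le> l + (M - m)"
      using * M_def by auto
    then show ?thesis using wf_widen[OF assms, of "M - m"]
      unfolding unbend_def M_def[symmetric] Let_def by (auto simp: wf_append)
  next
    case False
    then have "M - m = 0" "M + 2 * (M - l) = m + (M - l)" "l + (M - l) = M"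
      using * M_def by auto
    then show ?thesis using wf_widen[OF assms, of "M - l"]
      unfolding unbend_def M_def[symmetric] Let_def by (auto simp: wf_append)
  qed
qed

lemma val_in: "tangle s m w l \<Longrightarrow> val s m l w \<in> box_space P ((m + l) div 2) s"
  unfolding val_def by (intro act_in tangle_unbend)

lemma tangle_draw:
  assumes "x \<in> box_space P ((m + l) div 2) s" "even (m + l)"
  shows "tangle s m (draw m l x) l"
proof -
  define M where "M = (m + l) div 2"
  have "2 * M = m + l" using assms(2) by (simp add: M_def)
  then have "m + 2 * (M - m) - 2 * (M - l) = l" "M \<le> m + 2 * (M - m)" "l + 2 * (M - l) \<le> m + 2 * (M - m)"
    by arith+
  then show ?thesis using assms(1) unfolding draw_def M_def[symmetric] Let_def
    by (simp add: wf_append)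
qed

text \<open>
  Bending strings and bending them back: after the diagram has been slid to one side, what remains
  of the bent strings is a nested zigzag.
\<close>

lemma eqv_draw:
  assumes w: "tangle (cross j s) m w l"
  shows "eqv s (j + m + r) (j + l + r) (map (shift j) w) (map (shift j) (draw m l (val (cross j s) m l w)))"
proof -
  have "even (m + l)" using assms wf_parity by blast
  then have M2: "2 * ((m + l) div 2) = m + l" by simp
  define M where "M = (m + l) div 2"
  define A where "A = j + m + r"
  define B where "B = j + l + r"
  have w': "tangle s (j + m) (map (shift j) w) (j + l)" using wf_shift[OF w] .
  have dr: "map (shift j) (draw m l (val (cross j s) m l w)) =
      cups (M - m) (j + m) @ [Box j M (act P (cross j s) M (unbend m l w))] @ caps (M - l) (j + l)"
    by (simp add: draw_def M_def[symmetric] val_def Let_def)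
  have ub: "map (shift j) (unbend m l w) = cups (M - l) (j + M) @ map (shift j) w @ caps (M - m) (j + M)"
    by (simp add: unbend_def M_def[symmetric] Let_def)
  have ubt: "tangle (cross j s) M (unbend m l w) M" using tangle_unbend[OF w] by (simp add: M_def)
  show ?thesis
  proof (cases "m \<le> l")
    case True
    (* The cups come from drawing the value and the caps from bending w; after sliding w below the cups,
       these meet the caps. *)
    define t where "t = M - m"
    have l: "l = m + 2 * t" "M = m + t" "M - l = 0" using True M2 by (auto simp: t_def M_def)
    have "eqv s A B (cups t (j + m) @ [Box j M (act P (cross j s) M (unbend m l w))] @ []) (cups t (j + m) @ map (shift j) (unbend m l w) @ [])"
      by (rule eqv_context[OF eqv_glue[OF ubt, of 0], of A _ "t + r"]) (simp_all add: A_def B_def l)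
    also have "cups t (j + m) @ map (shift j) (unbend m l w) @ [] = cups t (j + m) @ map (shift j) w @ caps t (j + m + t)"
      by (simp add: ub l(3)) (simp add: l add.assoc)
    also have "eqv s A B (cups t (j + m) @ map (shift j) w @ caps t (j + m + t)) (map (shift j) w @ cups t (j + l) @ caps t (j + m + t))"
    proof -
      have "eqv s A (B + 2 * t) (cups t (j + m) @ map (shift j) w) (map (shift j) w @ cups t (j + l))"
        using eqv_sym[OF eqv_block[OF w', of r "cups t 0" "r + 2 * t"]] by (simp add: A_def B_def add.assoc)
      from eqv_context[OF this, of A "[]" 0 "caps t (j + m + t)" B] show ?thesis
        by (simp add: A_def B_def l)
    qed
    also have "eqv s A B (map (shift j) w @ cups t (j + l) @ caps t (j + m + t)) (map (shift j) w)"
    proof -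
      have "eqv s B B (cups t ((j + m + t) + t) @ caps t (j + m + t)) []"
        by (rule eqv_nested_zigzag_left) (simp add: B_def l)
      moreover have "tangle s A (map (shift j) w) B"
        using wf_widen[OF w', of r] by (simp add: A_def B_def)
      ultimately show ?thesis
        using eqv_append[OF eqv_refl, of s A "map (shift j) w" B B] by (fastforce simp: l mult_2 add.assoc)
    qed
    finally show ?thesis
      unfolding dr A_def B_def by (simp add: l eqv_sym t_def[symmetric])
  next
    case False
    define t where "t = M - l"
    have l: "m = l + 2 * t" "M = l + t" "M - m = 0" using False M2 by (auto simp: t_def M_def)
    have "eqv s A B ([] @ [Box j M (act P (cross j s) M (unbend m l w))] @ caps t (j + l)) ([] @ map (shift j) (unbend m l w) @ caps t (j + l))"
      by (rule eqv_context[OF eqv_glue[OF ubt, of 0], of A _ "t + r"]) (simp_all add: A_def B_def l)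
    also have "[] @ map (shift j) (unbend m l w) @ caps t (j + l) = cups t (j + M) @ map (shift j) w @ caps t (j + l)"
      by (simp add: ub l(3)) (simp add: l)
    also have "eqv s A B (cups t (j + M) @ map (shift j) w @ caps t (j + l)) (cups t (j + M) @ caps t (j + m) @ map (shift j) w)"
    proof -
      have "eqv s (A + 2 * t) B (map (shift j) w @ caps t (j + l)) (caps t (j + m) @ map (shift j) w)"
        using eqv_block[OF w', of "r + 2 * t" "caps t 0" r] by (simp add: A_def B_def add.assoc)
      from eqv_append[OF _ this, of A "cups t (j + M)" "cups t (j + M)"] show ?thesis
        by (simp add: A_def B_def l eqv_refl)
    qed
    also have "eqv s A B (cups t (j + M) @ caps t (j + m) @ map (shift j) w) (map (shift j) w)"
    proof -
      have "eqv s A A (cups t (j + M) @ caps t ((j + M) + t)) []"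
        by (rule eqv_nested_zigzag_right) (simp add: A_def l)
      moreover have "tangle s A (map (shift j) w) B"
        using wf_widen[OF w', of r] by (simp add: A_def B_def)
      ultimately show ?thesis
        using eqv_append[OF _ eqv_refl, of s A A _ _ "map (shift j) w" B] by (fastforce simp: l mult_2 add.assoc)
    qed
    finally show ?thesis
      unfolding dr A_def B_def by (simp add: l eqv_sym t_def[symmetric])
  qed
qed

lemma eqv_val: "eqv s m l w w' \<Longrightarrow> val s m l w = val s m l w'"
proof -
  assume eq: "eqv s m l w w'"
  define M where "M = (m + l) div 2"
  have M2: "2 * M = m + l" using wf_parity[OF eqv_tangle(1)[OF eq]] by (simp add: M_def)
  have "eqv s M M (unbend m l w) (unbend m l w')"
  proof (cases "m \<le> l")
    case True
    then have "M - l = 0" "M = m + (M - m)" "l + (M - m) - 2 * (M - m) = M" "M + 2 * (M - m) \<le> l + (M - m)"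
      using M2 by auto
    then show ?thesis using eqv_context[OF eq, of M "cups (M - l) M" "M - m" "caps (M - m) M" M]
      by (simp add: unbend_def M_def[symmetric])
  next
    case False
    then have "M - m = 0" "M + 2 * (M - l) = m + (M - l)" "l + (M - l) = M"
      using M2 by auto
    then show ?thesis using eqv_context[OF eq, of M "cups (M - l) M" "M - l" "caps (M - m) M" M]
      by (simp add: unbend_def M_def[symmetric])
  qed
  then show ?thesis unfolding val_def M_def[symmetric] by (rule eqv_act)
qed

lemma val_eqv:
  assumes "tangle s m w l" "tangle s m w' l" "val s m l w = val s m l w'"
  shows "eqv s m l w w'"
  using eqv_draw[of 0 s m w l 0] eqv_draw[of 0 s m w' l 0] assms by (auto intro: eqv_trans eqv_sym)

text \<open>
  The contexts in the definition of \<open>eqv\<close> have no extra strings on the left, but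
  the value of a diagram determines it in these contexts as well, by
  \<open>eqv_draw\<close> with a non-zero shift.
\<close>

lemma eqv_shift:
  assumes "eqv (cross j s) m l w w'"
  shows "eqv s (j + m) (j + l) (map (shift j) w) (map (shift j) w')"
  using eqv_draw[of j s m w l 0] eqv_draw[of j s m w' l 0] eqv_tangle[OF assms] eqv_val[OF assms]
  by (auto intro: eqv_trans eqv_sym)

end

section \<open>Linearity and vanishing diagrams\<close>

context shaded_planar_algebra
begin

abbreviation V :: "nat \<Rightarrow> shading \<Rightarrow> 'v set" where "V \<equiv> box_space P"
abbreviation sm :: "complex \<Rightarrow> 'v \<Rightarrow> 'v" where "sm \<equiv> smult P"
abbreviation mul :: "shading \<Rightarrow> nat \<Rightarrow> 'v \<Rightarrow> 'v \<Rightarrow> 'v" where "mul \<equiv> mult P"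
abbreviation one :: "shading \<Rightarrow> nat \<Rightarrow> 'v" where "one s k \<equiv> act P s k []"

lemma V_0 [simp]: "0 \<in> V k s" and V_add: "x \<in> V k s \<Longrightarrow> y \<in> V k s \<Longrightarrow> x + y \<in> V k s"
  and V_scale: "x \<in> V k s \<Longrightarrow> sm c x \<in> V k s" and V_diff: "x \<in> V k s \<Longrightarrow> y \<in> V k s \<Longrightarrow> x - y \<in> V k s"
  using subspace_box_space[of k s] by (auto intro: subspace_0 subspace_add subspace_scale subspace_diff)

lemma V_one [simp]: "one s k \<in> V k s"
  by (rule act_in) simp

text \<open>
  Linearity on a subspace only: the action of tangles is unspecified outside the box spaces.
\<close>

definition lin :: "'v set \<Rightarrow> ('v \<Rightarrow> 'v) \<Rightarrow> bool" where
  "lin S f \<longleftrightarrow> subspace S \<and> (\<forall>x\<in>S. \<forall>y\<in>S. \<forall>a b. f (sm a x + sm b y) = sm a (f x) + sm b (f y))"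

lemma lin_comb: "lin S f \<Longrightarrow> x \<in> S \<Longrightarrow> y \<in> S \<Longrightarrow> f (sm a x + sm b y) = sm a (f x) + sm b (f y)"
  by (simp add: lin_def)

lemma lin_0: "lin S f \<Longrightarrow> f 0 = 0"
  using lin_comb[of S f 0 0 0 0] by (auto simp: lin_def subspace_0)

lemma lin_add: "lin S f \<Longrightarrow> x \<in> S \<Longrightarrow> y \<in> S \<Longrightarrow> f (x + y) = f x + f y"
  using lin_comb[of S f x y 1 1] by simp

lemma lin_diff: "lin S f \<Longrightarrow> x \<in> S \<Longrightarrow> y \<in> S \<Longrightarrow> f (x - y) = f x - f y"
  using lin_comb[of S f x y 1 "-1"] by simp

lemma lin_scale: "lin S f \<Longrightarrow> x \<in> S \<Longrightarrow> f (sm a x) = sm a (f x)"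
  using lin_comb[of S f x x a 0] by simp

lemma lin_sum_list: "lin S f \<Longrightarrow> set xs \<subseteq> S \<Longrightarrow> f (sum_list xs) = sum_list (map f xs) \<and> sum_list xs \<in> S"
  by (induction xs) (auto simp: lin_0 lin_add lin_def subspace_0 subspace_add)

lemma lin_sum:
  assumes "finite I" "lin S f" "\<And>i. i \<in> I \<Longrightarrow> g i \<in> S"
  shows "f (sum g I) = (\<Sum>i\<in>I. f (g i)) \<and> sum g I \<in> S"
  using assms by (induction I rule: finite_induct) (auto simp: lin_0 lin_add lin_def subspace_0 subspace_add)

lemma lin_span: 
  assumes "lin S f" "B \<subseteq> S" "x \<in> span B" "\<And>b. b \<in> B \<Longrightarrow> f b \<in> T" "subspace T"
  shows "f x \<in> T"
proof -
  have "x \<in> S \<and> f x \<in> T"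
    using assms(3)
  proof (induction rule: span_induct_alt)
    case base
    then show ?case using assms(1,5) by (simp add: lin_0 lin_def subspace_0)
  next
    case (step c b y)
    then show ?case using assms(1,2,4,5) lin_comb[of S f b y c 1]
      by (auto simp: lin_def subset_iff intro: subspace_add subspace_scale)
  qed
  then show ?thesis by simp
qed

lemma wf_Box_change:
  assumes "tangle s m (u @ [Box i j x] @ v) l" "y \<in> V j (cross i s)"
  shows "tangle s m (u @ [Box i j y] @ v) l"
  using assms by (auto simp: wf_append)

lemma lin_val:
  assumes "tangle s m (u @ [Box i j 0] @ v) l"
  shows "lin (V j (cross i s)) (\<lambda>x. val s m l (u @ [Box i j x] @ v))"
  unfolding lin_def
proof (intro conjI ballI allI subspace_box_space)
  fix x y a b assume xy: "x \<in> V j (cross i s)" "y \<in> V j (cross i s)"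
  define M where "M = (m + l) div 2"
  define c1 :: "'v diagram" where "c1 = cups (M - l) M"
  define c2 :: "'v diagram" where "c2 = caps (M - m) M"
  have ub: "unbend m l (u @ w @ v) = (c1 @ u) @ w @ (v @ c2)" for w :: "'v diagram"
    by (simp add: unbend_def c1_def c2_def M_def Let_def)
  have t: "tangle s M ((c1 @ u) @ [Box i j z] @ (v @ c2)) M" if "z \<in> V j (cross i s)" for z
    using tangle_unbend[OF wf_Box_change[OF assms that]] unfolding ub M_def .
  show "val s m l (u @ [Box i j (sm a x + sm b y)] @ v) =
      sm a (val s m l (u @ [Box i j x] @ v)) + sm b (val s m l (u @ [Box i j y] @ v))"
    unfolding val_def ub M_def[symmetric] by (rule act_multilinear[OF t t]) (use xy in auto)
qed

lemma eqv_Box_act: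
  "tangle s k w k \<Longrightarrow> k \<le> m \<Longrightarrow> eqv s m m [Box 0 k (act P s k w)] w"
  by (rule eqv_glue_0)

definition null :: "shading \<Rightarrow> nat \<Rightarrow> nat \<Rightarrow> 'v diagram \<Rightarrow> bool" where
  "null s m l w \<longleftrightarrow> tangle s m w l \<and> val s m l w = 0"

lemma null_eqv: "eqv s m l w w' \<Longrightarrow> null s m l w \<longleftrightarrow> null s m l w'"
  using eqv_val eqv_tangle unfolding null_def by metis

text \<open>
  Vanishing is inherited by larger diagrams, because the diagram that
  vanishes can be replaced by a box labelled 0.
\<close>

lemma null_context:
  assumes "null (cross j s) m l w" "tangle s k u (j + m + r)" "tangle s (j + l + r) v k'"
  shows "null s k k' (u @ map (shift j) w @ v)"
proof -
  define M where "M = (m + l) div 2"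
  have w: "tangle (cross j s) m w l" "val (cross j s) m l w = 0" using assms(1) by (auto simp: null_def)
  have e: "eqv s k k' (u @ map (shift j) w @ v) (u @ map (shift j) (draw m l 0) @ v)"
    using eqv_context[OF eqv_draw[OF w(1), of r], of k u 0 v k'] w(2) assms(2,3) by simp
  have d: "u @ map (shift j) (draw m l 0) @ v = (u @ cups (M - m) (j + m)) @ [Box j M 0] @ (caps (M - l) (j + l) @ v)"
    by (simp add: draw_def M_def Let_def)
  have "val s k k' (u @ map (shift j) (draw m l 0) @ v) = 0"
    using lin_0[OF lin_val[of s k "u @ cups (M - m) (j + m)" j M "caps (M - l) (j + l) @ v" k']] eqv_tangle(2)[OF e]
    unfolding d by simp
  then have "null s k k' (u @ map (shift j) (draw m l 0) @ v)" using eqv_tangle(2)[OF e] by (simp add: null_def)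
  then show ?thesis using null_eqv[OF e] by simp
qed

lemma null_context_0:
  "null s m l w \<Longrightarrow> tangle s k u (m + r) \<Longrightarrow> tangle s (l + r) v k' \<Longrightarrow> null s k k' (u @ w @ v)"
  using null_context[of 0 s m l w k u r v k'] by simp

lemma null_append_right: "null s m l w \<Longrightarrow> tangle s l v k \<Longrightarrow> null s m k (w @ v)"
  using null_context_0[of s m l w m "[]" 0 v k] by simp

lemma null_append_left: "null s m l w \<Longrightarrow> tangle s k u m \<Longrightarrow> null s k l (u @ w)"
  using null_context_0[of s m l w k u 0 "[]" l] by simp

lemma null_diag: "null s k k w \<longleftrightarrow> tangle s k w k \<and> act P s k w = 0"
  by (simp add: null_def val_diag)

lemma mult_in: "x \<in> V k s \<Longrightarrow> y \<in> V k s \<Longrightarrow> mul s k x y \<in> V k s"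
  unfolding mult_def by (rule act_in) simp

lemma eqv_Box_mult:
  "x \<in> V k (cross i s) \<Longrightarrow> y \<in> V k (cross i s) \<Longrightarrow> i + k \<le> m \<Longrightarrow>
    eqv s m m [Box i k (mul (cross i s) k x y)] [Box i k y, Box i k x]"
  unfolding mult_def using eqv_glue_le[of i s k "[Box 0 k y, Box 0 k x]" m] by simp

lemma eqv_Box_mult_0:
  "x \<in> V k s \<Longrightarrow> y \<in> V k s \<Longrightarrow> k \<le> m \<Longrightarrow> eqv s m m [Box 0 k (mul s k x y)] [Box 0 k y, Box 0 k x]"
  using eqv_Box_mult[of x k 0 s y m] by simp

lemma act_append:
  assumes "tangle s k u k" "tangle s k v k"
  shows "act P s k (u @ v) = mul s k (act P s k v) (act P s k u)"
proof -
  have "eqv s k k (u @ v) ([Box 0 k (act P s k u)] @ [Box 0 k (act P s k v)])"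
    using eqv_append[OF eqv_sym[OF eqv_Box_act[OF assms(1) order_refl]] eqv_sym[OF eqv_Box_act[OF assms(2) order_refl]]] .
  then show ?thesis unfolding mult_def by (auto dest: eqv_act)
qed

lemma mult_assoc:
  assumes "x \<in> V k s" "y \<in> V k s" "z \<in> V k s"
  shows "mul s k (mul s k x y) z = mul s k x (mul s k y z)"
proof -
  have "mul s k (mul s k x y) z = act P s k [Box 0 k z, Box 0 k y, Box 0 k x]"
    using act_append[of s k "[Box 0 k z]" "[Box 0 k y, Box 0 k x]"] assms
    by (simp add: act_identity mult_def)
  also have "\<dots> = mul s k x (mul s k y z)"
    using act_append[of s k "[Box 0 k z, Box 0 k y]" "[Box 0 k x]"] assms
    by (simp add: act_identity mult_def)
  finally show ?thesis .
qed

lemma one_mult: "x \<in> V k s \<Longrightarrow> mul s k (one s k) x = x"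
  using act_append[of s k "[Box 0 k x]" "[]"] by (simp add: act_identity)

lemma mult_one: "x \<in> V k s \<Longrightarrow> mul s k x (one s k) = x"
  using act_append[of s k "[]" "[Box 0 k x]"] by (simp add: act_identity)

lemma lin_mult_left: "y \<in> V k s \<Longrightarrow> lin (V k s) (\<lambda>x. mul s k x y)"
  using lin_val[of s k "[Box 0 k y]" 0 k "[]" k] by (simp add: val_diag mult_def)

lemma lin_mult_right: "x \<in> V k s \<Longrightarrow> lin (V k s) (\<lambda>y. mul s k x y)"
  using lin_val[of s k "[]" 0 k "[Box 0 k x]" k] by (simp add: val_diag mult_def)

lemmas mult_simps_left =
  lin_add[OF lin_mult_left] lin_diff[OF lin_mult_left] lin_scale[OF lin_mult_left]
lemmas mult_simps_right =
  lin_add[OF lin_mult_right] lin_diff[OF lin_mult_right] lin_scale[OF lin_mult_right]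
lemmas mult_simps = mult_simps_left mult_simps_right

lemma mult_0_left [simp]: "x \<in> V k s \<Longrightarrow> mul s k 0 x = 0"
  and mult_0_right [simp]: "x \<in> V k s \<Longrightarrow> mul s k x 0 = 0"
  by (simp_all add: lin_0[OF lin_mult_left] lin_0[OF lin_mult_right])

end

context planar_star_algebra
begin

lemma star_0 [simp]: "star P 0 = 0"
  using star_antilinear[of 0 0 s 0 0 0] by simp

lemma star_add: "x \<in> V k s \<Longrightarrow> y \<in> V k s \<Longrightarrow> star P (x + y) = star P x + star P y"
  using star_antilinear[of x k s y 1 1] by simp

lemma star_diff: "x \<in> V k s \<Longrightarrow> y \<in> V k s \<Longrightarrow> star P (x - y) = star P x - star P y"
  using star_antilinear[of x k s y 1 "-1"] by simp

lemma star_scale: "x \<in> V k s \<Longrightarrow> star P (sm c x) = sm (cnj c) (star P x)"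
  using star_antilinear[of x k s x c 0] by simp

lemma reflect_append: "reflect f (u @ v) = reflect f v @ reflect f u"
  by (simp add: reflect_def)

lemma reflect_cups [simp]: "reflect f (cups k i) = caps k i"
  by (induction k) (simp_all add: reflect_def cups_Suc' caps_Suc)

lemma reflect_caps [simp]: "reflect f (caps k i) = cups k i"
  by (induction k) (simp_all add: reflect_def cups_Suc' caps_Suc)

lemma reflect_simps [simp]:
  "reflect f [] = []" "reflect f (a # w) = reflect f w @ [reflect_slice f a]"
  by (simp_all add: reflect_def)

lemma tangle_reflect: "tangle s m w l \<Longrightarrow> tangle s l (reflect (star P) w) m"
proof (induction w arbitrary: m)
  case (Cons a w)
  show ?case
  proof (cases a)
    case (Cup i)
    then show ?thesis using Cons.prems Cons.IH[of "m + 2"] unfolding reflect_simps wf_append by auto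
  next
    case (Cap i)
    then have "tangle s l (reflect (star P) w) (m - 2)" "tangle s (m - 2) [Cup i] m"
      using Cons.prems Cons.IH[of "m - 2"] by auto
    then show ?thesis unfolding reflect_simps wf_append Cap reflect_slice.simps by blast
  next
    case (Box i k x)
    then show ?thesis using Cons.prems Cons.IH[of "m"] star_in unfolding reflect_simps wf_append by auto
  qed
qed simp

lemma reflect_reflect: "tangle s m w l \<Longrightarrow> reflect (star P) (reflect (star P) w) = w"
proof (induction w arbitrary: m)
  case (Cons a w)
  then have "reflect (star P) (reflect (star P) w) = w" using wf_Cons by blast
  then show ?case using Cons.prems star_star by (cases a) (auto simp: reflect_append)
qed simp

lemma star_val: "tangle s m w l \<Longrightarrow> star P (val s m l w) = val s l m (reflect (star P) w)"
  using star_act[OF tangle_unbend] 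
  by (simp add: val_def unbend_def reflect_append add.commute[of l m] Let_def)

lemma null_reflect: "null s m l w \<Longrightarrow> null s l m (reflect (star P) w)"
  unfolding null_def using star_val tangle_reflect star_0 by metis

lemma eqv_reflect: "eqv s m l w w' \<Longrightarrow> eqv s l m (reflect (star P) w) (reflect (star P) w')"
proof (rule val_eqv)
  assume eq: "eqv s m l w w'"
  show "tangle s l (reflect (star P) w) m" "tangle s l (reflect (star P) w') m"
    using tangle_reflect eqv_tangle[OF eq] by blast+
  show "val s l m (reflect (star P) w) = val s l m (reflect (star P) w')"
    using star_val[OF eqv_tangle(1)[OF eq]] star_val[OF eqv_tangle(2)[OF eq]] eqv_val[OF eq] by simp
qed

lemma star_mult:
  "x \<in> V k s \<Longrightarrow> y \<in> V k s \<Longrightarrow> star P (mul s k x y) = mul s k (star P y) (star P x)"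
  unfolding mult_def by (subst star_act) auto

lemma star_one [simp]: "star P (one s k) = one s k"
  by (subst star_act) auto

end

section \<open>Projections\<close>

context subfactor_planar_algebra
begin

lemma scalar_eq: "scalar P s (sm c (one s 0)) = c"
  unfolding scalar_def using empty_diagram_nonzero[of s] by (intro the_equality) auto

lemma V0_eq: "x \<in> V 0 s \<Longrightarrow> x = sm (scalar P s x) (one s 0)"
  using zero_box_space[of s] scalar_eq by (auto simp: span_singleton)

lemma scalar_comb:
  assumes "x \<in> V 0 s" "y \<in> V 0 s"
  shows "scalar P s (sm a x + sm b y) = a * scalar P s x + b * scalar P s y"
proof -
  have "sm a x + sm b y = sm (a * scalar P s x + b * scalar P s y) (one s 0)"
    by (subst V0_eq[OF assms(1)], subst V0_eq[OF assms(2)]) (simp add: scale_left_distrib)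
  then show ?thesis by (simp only: scalar_eq)
qed

lemma Tr_tangle: "x \<in> V k s \<Longrightarrow> tangle s 0 (cups k 0 @ [Box 0 k x] @ caps k 0) 0"
  by simp

lemma Tr_comb:
  assumes "x \<in> V k s" "y \<in> V k s"
  shows "Tr P s k (sm a x + sm b y) = a * Tr P s k x + b * Tr P s k y"
  unfolding Tr_def using lin_comb[OF lin_val[of s 0 "cups k 0" 0 k "caps k 0" 0], of x y a b] assms
    scalar_comb[OF act_in act_in, OF Tr_tangle Tr_tangle] by (simp add: val_diag)

lemma Tr_0 [simp]: "Tr P s k 0 = 0"
  using Tr_comb[of 0 k s 0 0 0] by simp

lemma Tr_add: "x \<in> V k s \<Longrightarrow> y \<in> V k s \<Longrightarrow> Tr P s k (x + y) = Tr P s k x + Tr P s k y"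
  using Tr_comb[of x k s y 1 1] by simp

lemma Tr_diff: "x \<in> V k s \<Longrightarrow> y \<in> V k s \<Longrightarrow> Tr P s k (x - y) = Tr P s k x - Tr P s k y"
  using Tr_comb[of x k s y 1 "-1"] by simp

lemma Tr_scale: "x \<in> V k s \<Longrightarrow> Tr P s k (sm c x) = c * Tr P s k x"
  using Tr_comb[of x k s x c 0] by simp

lemma star_mult_eq_0: "x \<in> V k s \<Longrightarrow> mul s k (star P x) x = 0 \<Longrightarrow> x = 0"
  using positive_definite[of x k s] by fastforce

lemma projectionD:
  assumes "is_projection P (s, k, e)"
  shows "e \<in> V k s" "star P e = e" "mul s k e e = e"
  using assms by auto

lemma minimalD:
  assumes "minimal_projection P (s, k, e)"
  shows "e \<in> V k s" "star P e = e" "mul s k e e = e" "e \<noteq> 0"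
    "x \<in> V k s \<Longrightarrow> \<exists>c. mul s k e (mul s k x e) = sm c e"
  using assms by auto

lemma minimal_one: "minimal_projection P (s, 0, one s 0)"
proof -
  have "\<exists>c. mul s 0 (one s 0) (mul s 0 x (one s 0)) = sm c (one s 0)" if "x \<in> V 0 s" for x
    using that V0_eq[OF that] mult_one[OF that] one_mult[OF that] by metis
  then show ?thesis using empty_diagram_nonzero[of s] by (simp add: one_mult)
qed

lemma box_space_finite: obtains B where "finite B" "V k s = span B"
  using finite_dim by blast

lemma dim_strict_mono:
  assumes "subspace S" "subspace T" "S \<subseteq> T" "S \<noteq> T" "T \<subseteq> V k s"
  shows "dim S < dim T"
proof -
  obtain B where B: "finite B" "V k s = span B" using box_space_finite .
  obtain b where b: "b \<subseteq> S" "independent b" "S \<subseteq> span b" "card b = dim S" by (rule basis_exists)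
  obtain x where x: "x \<in> T" "x \<notin> S" using assms by blast
  then have "x \<notin> span b" using b(1) assms(1) span_minimal by blast
  then have ind: "independent (insert x b)" "x \<notin> b" using b(2) independent_insertI span_base by auto
  obtain c where c: "insert x b \<subseteq> c" "c \<subseteq> T" "independent c" "T \<subseteq> span c"
    using maximal_independent_subset_extend[OF _ ind(1), of T] x b(1) assms(3) by blast
  have "c \<subseteq> span B" using c(2) assms(5) B by blast
  then have fin: "finite c" using independent_span_bound[OF B(1) c(3)] by blast
  then have "card (insert x b) \<le> card c" using c(1) card_mono by blast
  moreover have "finite b" by (rule finite_subset[OF _ fin]) (use c(1) in auto)
  ultimately have "Suc (card b) \<le> card c" using ind(2) by simp
  then show ?thesis using b(4) basis_card_eq_dim[OF c(2) c(4) c(3)] by linarith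
qed

lemma dim_nonzero_iff:
  assumes "S \<subseteq> V k s" shows "dim S \<noteq> 0 \<longleftrightarrow> (\<exists>x\<in>S. x \<noteq> 0)"
proof
  assume "dim S \<noteq> 0"
  show "\<exists>x\<in>S. x \<noteq> 0"
  proof (rule ccontr)
    assume "\<not> ?thesis"
    then have "S \<subseteq> span {}" by auto
    then have "dim S \<le> card ({} :: 'v set)" by (intro dim_le_card) auto
    then show False using \<open>dim S \<noteq> 0\<close> by simp
  qed
next
  assume "\<exists>x\<in>S. x \<noteq> 0"
  then obtain x where x: "x \<in> S" "x \<noteq> 0" by blast
  have "dim {0::'v} < dim (span S)"
    by (rule dim_strict_mono[where k = k and s = s])
      (use x span_base assms span_minimal[OF assms subspace_box_space] in \<open>auto simp: span_zero\<close>)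
  then show "dim S \<noteq> 0" by simp
qed

text \<open>
  The polynomial p evaluated at a in the corner of the projection e, with e as the constant 1.
\<close>

definition ev :: "shading \<Rightarrow> nat \<Rightarrow> 'v \<Rightarrow> 'v \<Rightarrow> complex poly \<Rightarrow> 'v" where
  "ev s k e a p = (\<Sum>i\<le>degree p. sm (coeff p i) ((mul s k a ^^ i) e))"

lemma ev_le: "degree p \<le> N \<Longrightarrow> ev s k e a p = (\<Sum>i\<le>N. sm (coeff p i) ((mul s k a ^^ i) e))"
  unfolding ev_def by (rule sum.mono_neutral_left) (auto simp: coeff_eq_0)

lemma pow_in: "e \<in> V k s \<Longrightarrow> a \<in> V k s \<Longrightarrow> (mul s k a ^^ i) e \<in> V k s"
  by (induction i) (auto simp: mult_in)

lemma ev_in: "e \<in> V k s \<Longrightarrow> a \<in> V k s \<Longrightarrow> ev s k e a p \<in> V k s"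
  unfolding ev_def by (intro subspace_sum subspace_box_space V_scale pow_in)

lemma ev_pCons:
  assumes "e \<in> V k s" "a \<in> V k s"
  shows "ev s k e a (pCons c p) = sm c e + mul s k a (ev s k e a p)"
proof -
  have "ev s k e a (pCons c p) = (\<Sum>i\<le>Suc (degree p). sm (coeff (pCons c p) i) ((mul s k a ^^ i) e))"
    by (rule ev_le) (simp add: degree_pCons_le)
  also have "\<dots> = sm c e + (\<Sum>i\<le>degree p. sm (coeff p i) ((mul s k a ^^ Suc i) e))"
    by (subst sum.atMost_Suc_shift) simp
  also have "(\<Sum>i\<le>degree p. sm (coeff p i) ((mul s k a ^^ Suc i) e)) = mul s k a (ev s k e a p)"
    unfolding ev_def using lin_sum[OF _ lin_mult_right[OF assms(2)], of "{..degree p}" "\<lambda>i. sm (coeff p i) ((mul s k a ^^ i) e)"]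
    by (simp add: V_scale pow_in assms mult_simps)
  finally show ?thesis .
qed

lemma ev_diff: "ev s k e a (p - q) = ev s k e a p - ev s k e a q"
  using ev_le[of p "max (degree p) (degree q)" s k e a] ev_le[of q "max (degree p) (degree q)" s k e a]
    ev_le[of "p - q" "max (degree p) (degree q)" s k e a] degree_diff_le_max[of p q]
  by (simp add: scale_left_diff_distrib sum_subtractf)

lemma ev_smult: "ev s k e a (Polynomial.smult c p) = sm c (ev s k e a p)"
  using ev_le[of "Polynomial.smult c p" "degree p" s k e a]
  by (simp add: scale_sum_right ev_def degree_smult_le)

lemma ev_annihilator: 
  assumes "e \<in> V k s" "a \<in> V k s"
  shows "\<exists>p. p \<noteq> 0 \<and> ev s k e a p = 0"
proof -
  obtain B where B: "finite B" "V k s = span B" using box_space_finite .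
  define f where "f i = (mul s k a ^^ i) e" for i
  define N where "N = card B"
  have f: "f i \<in> V k s" for i using pow_in assms by (simp add: f_def)
  show ?thesis
  proof (cases "inj_on f {..N}")
    case False
    then obtain i j where ij: "f i = f j" "i \<noteq> j" unfolding inj_on_def by blast
    have ev: "ev s k e a (monom 1 i) = f i" for i
      by (subst ev_le[of _ i]) (simp_all add: degree_monom_le f_def if_distrib[of "\<lambda>c. sm c _"] cong: if_cong)
    have "coeff (monom 1 i - monom 1 j :: complex poly) i = 1" using ij by simp
    then have "monom 1 i - monom 1 j \<noteq> (0 :: complex poly)" by (metis coeff_0 zero_neq_one)
    then show ?thesis using ij ev by (metis ev_diff cancel_comm_monoid_add_class.diff_cancel)
  next
    case True
    have "\<not> independent (f ` {..N})"
    proof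
      assume "independent (f ` {..N})"
      then have "card (f ` {..N}) \<le> card B" using independent_span_bound[OF B(1)] f B(2) by auto
      then show False using card_image[OF True] by (simp add: N_def)
    qed
    then obtain u v where u: "v \<in> f ` {..N}" "u v \<noteq> 0" "(\<Sum>v\<in>f ` {..N}. sm (u v) v) = 0"
      using dependent_finite[of "f ` {..N}"] by auto
    define p where "p = (\<Sum>i\<le>N. monom (u (f i)) i)"
    have c: "coeff p i = (if i \<le> N then u (f i) else 0)" for i
      unfolding p_def by (simp add: coeff_sum)
    have "degree p \<le> N" by (rule degree_le) (simp add: c)
    then have "ev s k e a p = (\<Sum>i\<le>N. sm (u (f i)) (f i))"
      by (simp add: ev_le c f_def)
    also have "\<dots> = 0" using u(3) by (simp add: sum.reindex[OF True])
    finally have "ev s k e a p = 0" .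
    moreover obtain i where "i \<le> N" "v = f i" using u(1) by auto
    then have "coeff p i \<noteq> 0" using u(2) by (simp add: c)
    then have "p \<noteq> 0" by auto
    ultimately show ?thesis by blast
  qed
qed

text \<open>
  A spectral projection of a self-adjoint a in the corner of e: if m is the minimal polynomial of a
  and m = (X - c) g, then y = g(a) is an eigenvector of a, so that y* y, being a polynomial in a
  applied to y, is a multiple of y.
\<close>

lemma exists_eigenprojection:
  assumes e: "is_projection P (s, k, e)" "e \<noteq> 0"
    and a: "a \<in> V k s" "star P a = a" "mul s k e a = a"
  shows "\<exists>f c. is_projection P (s, k, f) \<and> f \<noteq> 0 \<and> mul s k e f = f \<and> mul s k a f = sm c f"
proof -
  note e1 = projectionD[OF e(1)]
  define E where "E = ev s k e a"
  obtain m where m: "m \<noteq> 0" "E m = 0" and least: "\<And>p. p \<noteq> 0 \<Longrightarrow> E p = 0 \<Longrightarrow> degree m \<le> degree p"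
    using ex_has_least_nat[of "\<lambda>p. p \<noteq> 0 \<and> E p = 0" _ degree] ev_annihilator[OF e1(1) a(1)]
    unfolding E_def by blast
  have "degree m \<noteq> 0"
  proof
    assume "degree m = 0"
    then obtain c where c: "m = [:c:]" by (meson degree_eq_zeroE)
    then have "sm c e = 0" using m(2) e1 a by (simp add: E_def ev_def)
    then show False using c m(1) e(2) by simp
  qed
  then obtain c where "poly m c = 0"
    using fundamental_theorem_of_algebra[of m] constant_degree[of m] by auto
  then obtain g where g: "m = [:- c, 1:] * g" by (auto simp: poly_eq_0_iff_dvd)
  then have g0: "g \<noteq> 0" using m(1) by auto
  have "degree m = Suc (degree g)" unfolding g using g0 by (subst degree_mult_eq) auto
  then have y0: "E g \<noteq> 0" using least[OF g0] by auto
  define y where "y = E g"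
  have y: "y \<in> V k s" unfolding y_def E_def by (rule ev_in[OF e1(1) a(1)])
  have "m = pCons 0 g - Polynomial.smult c g" unfolding g by simp
  then have "E m = mul s k a y - sm c y"
    unfolding E_def y_def by (simp only: ev_diff ev_smult ev_pCons[OF e1(1) a(1)] scale_zero_left add_0_left)
  then have ay: "mul s k a y = sm c y" using m(2) by simp
  have eE: "mul s k e (E p) = E p" for p
    unfolding E_def
    by (induction p) (use ev_in[OF e1(1) a(1)] e1 a in
      \<open>simp_all add: ev_pCons mult_simps V_scale mult_in flip: mult_assoc\<close>, simp add: ev_def)
  have ey: "mul s k e y = y" using eE by (simp add: y_def)
  have "\<exists>\<gamma>. mul s k (star P (E p)) y = sm \<gamma> y" for p
  proof (induction p)
    case 0
    have "E 0 = 0" by (simp add: E_def ev_def)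
    then have "mul s k (star P (E 0)) y = sm 0 y" using y by simp
    then show ?case by blast
  next
    case (pCons b p)
    then obtain \<gamma> where \<gamma>: "mul s k (star P (E p)) y = sm \<gamma> y" by blast
    have Ep: "E p \<in> V k s" unfolding E_def by (rule ev_in[OF e1(1) a(1)])
    have "E (pCons b p) = sm b e + mul s k a (E p)"
      using ev_pCons e1 a by (simp add: E_def)
    then have "star P (E (pCons b p)) = sm (cnj b) e + mul s k (star P (E p)) a"
      using Ep e1 a by (simp add: star_add[where k = k and s = s] star_scale[where k = k and s = s] star_mult V_scale mult_in)
    then have "mul s k (star P (E (pCons b p))) y = sm (cnj b) y + mul s k (star P (E p)) (sm c y)"
      using Ep e1 a y ey ay star_in[OF Ep] by (simp add: mult_simps V_scale mult_in mult_assoc)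
    also have "\<dots> = sm (cnj b + c * \<gamma>) y"
      using Ep y \<gamma> star_in[OF Ep] by (simp add: mult_simps scale_left_distrib)
    finally show ?case by blast
  qed
  then obtain \<gamma> where \<gamma>: "mul s k (star P y) y = sm \<gamma> y" unfolding y_def by blast
  have ys: "star P y \<in> V k s" using y star_in by blast
  have "mul s k (star P y) y \<noteq> 0" using star_mult_eq_0[OF y] y0 by (auto simp flip: y_def)
  then have \<gamma>0: "\<gamma> \<noteq> 0" using \<gamma> by auto
  have "star P (mul s k (star P y) y) = mul s k (star P y) y"
    using y ys star_star by (simp add: star_mult)
  then have sy: "sm (cnj \<gamma>) (star P y) = sm \<gamma> y" using \<gamma> star_scale[OF y] by simp
  define f where "f = sm (1 / cnj \<gamma>) y"
  have fV: "f \<in> V k s" using y by (simp add: f_def V_scale)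
  have fs: "star P f = f"
  proof -
    have "star P f = sm (1 / \<gamma>) (star P y)" using star_scale[OF y] by (simp add: f_def)
    also have "\<dots> = sm (1 / (\<gamma> * cnj \<gamma>)) (sm (cnj \<gamma>) (star P y))" using \<gamma>0 by simp
    also have "\<dots> = sm (1 / cnj \<gamma>) y" unfolding sy using \<gamma>0 by simp
    finally show ?thesis by (simp add: f_def)
  qed
  have "mul s k f f = mul s k (star P f) f" using fs by simp
  also have "\<dots> = sm (1 / \<gamma> * (1 / cnj \<gamma>)) (sm \<gamma> y)"
    using star_scale[OF y] y ys \<gamma> by (simp add: f_def mult_simps V_scale)
  also have "\<dots> = f" using \<gamma>0 by (simp add: f_def)
  finally have "mul s k f f = f" .
  moreover have "mul s k e f = f" "mul s k a f = sm c f" "f \<noteq> 0"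
    using ey ay e1 a y y0 \<gamma>0 by (simp_all add: f_def mult_simps y_def mult.commute)
  ultimately show ?thesis using fV fs by auto
qed

text \<open>
  If e is not minimal, its corner contains a self-adjoint element that is not a multiple of e;
  any of its eigenprojections is a proper subprojection.
\<close>

lemma exists_proper_subprojection:
  assumes e: "is_projection P (s, k, e)" "e \<noteq> 0" and nmin: "\<not> minimal_projection P (s, k, e)"
  shows "\<exists>f. is_projection P (s, k, f) \<and> f \<noteq> 0 \<and> f \<noteq> e \<and> mul s k e f = f"
proof -
  note e1 = projectionD[OF e(1)]
  obtain x where x: "x \<in> V k s" "\<And>c. mul s k e (mul s k x e) \<noteq> sm c e"
    using nmin e by auto
  define y where "y = mul s k e (mul s k x e)"
  have y: "y \<in> V k s" using x e1 by (simp add: y_def mult_in)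
  have ye: "mul s k e y = y" "mul s k y e = y" 
    using x e1 by (simp_all add: y_def mult_in mult_assoc) (simp_all add: mult_in flip: mult_assoc)
  have ys: "star P y \<in> V k s" using y star_in by blast
  have yse: "mul s k e (star P y) = star P y" 
    using star_mult[OF y e1(1)] ye e1 by simp
  (* a1 / 2 and a2 / 2 are the real part and, up to sign, the imaginary part of y. *)
  define a1 where "a1 = y + star P y"
  define a2 where "a2 = sm \<i> y + sm (- \<i>) (star P y)"
  have a1: "a1 \<in> V k s" "star P a1 = a1" "mul s k e a1 = a1"
    using y ys ye yse e1 by (simp_all add: a1_def V_add star_add[where k = k and s = s] star_star mult_simps add.commute)
  have a2: "a2 \<in> V k s" "star P a2 = a2" "mul s k e a2 = a2"
    using y ys ye yse e1 by (simp_all add: a2_def V_add V_diff V_scale star_antilinear[OF y ys] star_star mult_simps add.commute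
      flip: scale_minus_left)
  have *: "y = sm (1 / 2) a1 + sm (- \<i> / 2) a2"
  proof -
    have "sm (1 / 2) a1 + sm (- \<i> / 2) a2 = sm (1 / 2 + (- \<i> / 2) * \<i>) y + sm (1 / 2 + (- \<i> / 2) * (- \<i>)) (star P y)"
      unfolding a1_def a2_def by (simp only: scale_right_distrib scale_left_distrib scale_scale) (simp add: algebra_simps)
    also have "\<dots> = y" by (simp add: field_simps)
    finally show ?thesis by simp
  qed
  have "\<exists>a. a \<in> V k s \<and> star P a = a \<and> mul s k e a = a \<and> (\<forall>c. a \<noteq> sm c e)"
  proof (rule ccontr)
    assume "\<not> ?thesis"
    then obtain c1 c2 where "a1 = sm c1 e" "a2 = sm c2 e" using a1 a2 by blast
    then have "y = sm (1 / 2 * c1 + (- \<i> / 2) * c2) e"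
      using * by (simp add: scale_left_distrib scale_left_diff_distrib)
    then show False using x(2) unfolding y_def by blast
  qed
  then obtain a where a: "a \<in> V k s" "star P a = a" "mul s k e a = a" "\<And>c. a \<noteq> sm c e" by blast
  obtain f c where f: "is_projection P (s, k, f)" "f \<noteq> 0" "mul s k e f = f" "mul s k a f = sm c f"
    using exists_eigenprojection[OF e a(1-3)] by blast
  have "mul s k a e = a" using star_mult[OF e1(1) a(1)] a e1 by simp
  then have "f \<noteq> e" using f(4) a(4) by metis
  then show ?thesis using f by blast
qed

lemma subspace_image_mult: "e \<in> V k s \<Longrightarrow> subspace (mul s k e ` V k s)"
  unfolding subspace_def
proof (intro conjI ballI allI)
  assume e: "e \<in> V k s"
  show "0 \<in> mul s k e ` V k s" using e mult_0_right V_0 by (metis image_eqI)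
  fix x y c assume "x \<in> mul s k e ` V k s" 
  then obtain x' where x: "x' \<in> V k s" "x = mul s k e x'" by blast
  show "sm c x \<in> mul s k e ` V k s" using e x by (intro image_eqI[of _ _ "sm c x'"]) (auto simp: mult_simps V_scale)
  assume "y \<in> mul s k e ` V k s" 
  then obtain y' where y: "y' \<in> V k s" "y = mul s k e y'" by blast
  show "x + y \<in> mul s k e ` V k s" using e x y by (intro image_eqI[of _ _ "x' + y'"]) (auto simp: mult_simps V_add)
qed

lemma projection_diff:
  assumes "is_projection P (s, k, e)" "is_projection P (s, k, f)" "mul s k e f = f"
  shows "is_projection P (s, k, e - f)" "mul s k e (e - f) = e - f" "mul s k f e = f"
proof -
  note ef = projectionD[OF assms(1)] projectionD[OF assms(2)]
  show fe: "mul s k f e = f" using star_mult[OF ef(1) ef(4)] ef assms(3) by simp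
  show "mul s k e (e - f) = e - f" using ef assms(3) by (simp add: mult_simps)
  show "is_projection P (s, k, e - f)" using ef assms(3) fe by (simp add: V_diff mult_simps star_diff[where k = k and s = s])
qed

text \<open>
  Splitting off proper subprojections terminates because the right ideal generated by the
  projection loses dimension.
\<close>

lemma projection_sum_minimal:
  assumes "is_projection P (s, k, e)"
  shows "\<exists>qs. (\<forall>p\<in>set qs. minimal_projection P (s, k, p) \<and> mul s k e p = p) \<and> sum_list qs = e"
  using assms
proof (induction "dim (mul s k e ` V k s)" arbitrary: e rule: less_induct)
  case less
  note e = projectionD[OF less.prems]
  consider "e = 0" | "minimal_projection P (s, k, e)" | "e \<noteq> 0" "\<not> minimal_projection P (s, k, e)" by blast
  then show ?case
  proof cases
    case 1 then show ?thesis by (intro exI[of _ "[]"]) auto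
  next
    case 2 then show ?thesis using e by (intro exI[of _ "[e]"]) auto
  next
    case 3
    obtain f where f: "is_projection P (s, k, f)" "f \<noteq> 0" "f \<noteq> e" "mul s k e f = f"
      using exists_proper_subprojection[OF less.prems 3] by blast
    note f1 = projectionD[OF f(1)] and g = projection_diff[OF less.prems f(1) f(4)]
    note g1 = projectionD[OF g(1)]
    have sub: "dim (mul s k h ` V k s) < dim (mul s k e ` V k s)"
      if h: "is_projection P (s, k, h)" "mul s k e h = h" "h \<noteq> e" for h
    proof (rule dim_strict_mono[where k = k and s = s])
      note h1 = projectionD[OF h(1)]
      show "subspace (mul s k h ` V k s)" "subspace (mul s k e ` V k s)"
        using h1 e by (auto intro: subspace_image_mult)
      show "mul s k h ` V k s \<subseteq> mul s k e ` V k s"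
      proof
        fix x assume "x \<in> mul s k h ` V k s"
        then obtain x' where x: "x' \<in> V k s" "x = mul s k h x'" by blast
        then have "x = mul s k e (mul s k h x')" using h h1 e by (simp flip: mult_assoc)
        then show "x \<in> mul s k e ` V k s" using x h1 by (auto simp: mult_in)
      qed
      show "mul s k h ` V k s \<noteq> mul s k e ` V k s"
      proof
        assume "mul s k h ` V k s = mul s k e ` V k s"
        then have "e \<in> mul s k h ` V k s" using e by (metis image_eqI)
        then obtain x where x: "x \<in> V k s" "e = mul s k h x" by blast
        then have "mul s k h e = e" using h1 by (simp flip: mult_assoc)
        then show False using projection_diff(3)[OF less.prems h(1,2)] h(3) by simp
      qed
      show "mul s k e ` V k s \<subseteq> V k s" using e by (auto simp: mult_in)
    qed
    obtain qs where qs: "\<forall>p\<in>set qs. minimal_projection P (s, k, p) \<and> mul s k f p = p" "sum_list qs = f"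
      using less.hyps[OF sub[OF f(1) f(4) f(3)] f(1)] by blast
    obtain rs where rs: "\<forall>p\<in>set rs. minimal_projection P (s, k, p) \<and> mul s k (e - f) p = p" "sum_list rs = e - f"
      using less.hyps[OF sub[OF g(1) g(2)] g(1)] f(2) by auto
    have up: "mul s k e p = p" if "mul s k h p = p" "mul s k e h = h" "h \<in> V k s" "p \<in> V k s" for h p
      using that e by (metis mult_assoc)
    have "\<forall>p\<in>set (qs @ rs). minimal_projection P (s, k, p) \<and> mul s k e p = p"
    proof
      fix p assume "p \<in> set (qs @ rs)"
      then consider "p \<in> set qs" | "p \<in> set rs" by auto
      then show "minimal_projection P (s, k, p) \<and> mul s k e p = p"
        by cases (use qs(1) rs(1) up[OF _ f(4) f1(1)] up[OF _ g(2) g1(1)] minimalD(1) in blast)+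
    qed
    moreover have "sum_list (qs @ rs) = e" using qs(2) rs(2) by simp
    ultimately show ?thesis by blast
  qed
qed

end

section \<open>Isomorphism, edges and depth\<close>

context subfactor_planar_algebra
begin

definition idem :: "shading \<Rightarrow> nat \<Rightarrow> 'v \<Rightarrow> bool" where
  "idem s k p \<longleftrightarrow> p \<in> V k s \<and> mul s k p p = p"

lemma minimal_idem: "minimal_projection P (s, k, p) \<Longrightarrow> idem s k p"
  by (simp add: idem_def)

lemma idem_V: "idem s k p \<Longrightarrow> p \<in> V k s"
  by (simp add: idem_def)

lemma eqv_idem: "idem s k p \<Longrightarrow> k \<le> m \<Longrightarrow> eqv s m m [Box 0 k p, Box 0 k p] [Box 0 k p]"
  using eqv_sym[OF eqv_Box_mult_0[of p k s p m]] by (simp add: idem_def)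

text \<open>
  Isomorphism of idempotents in terms of arbitrary diagrams instead of elements of box spaces;
  in this form composition is just concatenation.
\<close>

definition iso :: "shading \<Rightarrow> nat \<Rightarrow> 'v \<Rightarrow> nat \<Rightarrow> 'v \<Rightarrow> bool" where
  "iso s k p l q \<longleftrightarrow> (\<exists>F G. tangle s k F l \<and> tangle s l G k \<and>
     eqv s k k (F @ G) [Box 0 k p] \<and> eqv s l l (G @ F) [Box 0 l q])"

lemma eqv_conjugate_draw:
  assumes "tangle s k F l"
  shows "eqv s k l (draw k l (val s k l F)) F"
  using eqv_sym[OF eqv_draw[of 0 s k F l 0]] assms by simp

lemma eqv_sandwich:
  assumes p: "idem s k p" and F: "tangle s k F l" and G: "tangle s l G k"
    and FG: "eqv s k k (F @ G) [Box 0 k p]" and GF: "eqv s l l (G @ F) [Box 0 l q]"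
  shows "eqv s k k (F @ [Box 0 l q] @ G) [Box 0 k p]"
proof -
  have "eqv s k k (F @ [Box 0 l q] @ G) (F @ (G @ F) @ G)"
    by (rule eqv_prefix[OF F eqv_suffix[OF eqv_sym[OF GF] G]])
  also have "F @ (G @ F) @ G = (F @ G) @ (F @ G)" by simp
  also have "eqv s k k \<dots> ([Box 0 k p] @ [Box 0 k p])" by (rule eqv_append[OF FG FG])
  also have "eqv s k k \<dots> [Box 0 k p]" using eqv_idem[OF p, of k] by simp
  finally show ?thesis .
qed

lemma eqv_conjugate_comp:
  assumes p: "idem s k p" and q: "idem s l q" and F: "tangle s k F l" and G: "tangle s l G k"
    and FG: "eqv s k k (F @ G) [Box 0 k p]" and GF: "eqv s l l (G @ F) [Box 0 l q]"
  shows "eqv s k k (([Box 0 k p] @ F @ [Box 0 l q]) @ ([Box 0 l q] @ G @ [Box 0 k p])) [Box 0 k p]"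
proof -
  have pt: "tangle s k [Box 0 k p] k" using p by (simp add: idem_def)
  note pr0 = eqv_refl[OF pt] and F' = eqv_refl[OF F] and G' = eqv_refl[OF G]
  have pp: "eqv s k k ([Box 0 k p] @ [Box 0 k p]) [Box 0 k p]" and qq: "eqv s l l ([Box 0 l q] @ [Box 0 l q]) [Box 0 l q]"
    using eqv_idem p q by auto
  have "eqv s k k ([Box 0 k p] @ F @ (([Box 0 l q] @ [Box 0 l q]) @ G @ [Box 0 k p])) ([Box 0 k p] @ F @ ([Box 0 l q] @ G @ [Box 0 k p]))"
    by (intro eqv_append[OF pr0] eqv_append[OF F'] eqv_append[OF qq] eqv_append[OF G' pr0])
  also have "[Box 0 k p] @ F @ ([Box 0 l q] @ G @ [Box 0 k p]) = [Box 0 k p] @ (F @ [Box 0 l q] @ G) @ [Box 0 k p]" by simp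
  also have "eqv s k k \<dots> ([Box 0 k p] @ [Box 0 k p] @ [Box 0 k p])"
    by (intro eqv_append[OF pr0] eqv_append[OF eqv_sandwich[OF p F G FG GF] pr0])
  also have "eqv s k k \<dots> ([Box 0 k p] @ [Box 0 k p])" by (rule eqv_append[OF pr0 pp])
  also note pp
  finally show ?thesis by simp
qed

text \<open>
  From F and G one obtains morphisms between the projections by composing with the
  projections at both ends.
\<close>

lemma isomorphic_iff_iso:
  assumes p: "idem s k p" and q: "idem t l q"
  shows "isomorphic P (s, k, p) (t, l, q) \<longleftrightarrow> s = t \<and> iso s k p l q"
proof
  assume "isomorphic P (s, k, p) (t, l, q)"
  then obtain f g where st: "s = t" "even (k + l)" and f: "f \<in> hom P (s, k, p) (t, l, q)"
    and g: "g \<in> hom P (t, l, q) (s, k, p)"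
    and fg: "act P s k (draw k l f @ draw l k g) = p" "act P s l (draw l k g @ draw k l f) = q" by auto
  have fV: "f \<in> V ((k + l) div 2) s" and gV: "g \<in> V ((l + k) div 2) s" 
    using f g st by (auto split: if_splits)
  have t: "tangle s k (draw k l f) l" "tangle s l (draw l k g) k"
    using tangle_draw[OF fV] tangle_draw[OF gV] st by (auto simp: add.commute)
  have "eqv s k k (draw k l f @ draw l k g) [Box 0 k p]" "eqv s l l (draw l k g @ draw k l f) [Box 0 l q]"
    using fg t p q st by (auto intro!: val_eqv simp: val_diag act_identity idem_def wf_append)
  then show "s = t \<and> iso s k p l q" using t st unfolding iso_def by blast
next
  assume "s = t \<and> iso s k p l q"
  then obtain F G where st: "s = t" and F: "tangle s k F l" and G: "tangle s l G k"
    and FG: "eqv s k k (F @ G) [Box 0 k p]" and GF: "eqv s l l (G @ F) [Box 0 l q]"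
    unfolding iso_def by blast
  have ev: "even (k + l)" "even (l + k)" using wf_parity[OF F] by auto
  have q': "idem s l q" using q st by simp
  have pt: "tangle s k [Box 0 k p] k" "tangle s l [Box 0 l q] l" using p q' by (auto simp: idem_def)
  define F' where "F' = [Box 0 k p] @ F @ [Box 0 l q]"
  define G' where "G' = [Box 0 l q] @ G @ [Box 0 k p]"
  have F': "tangle s k F' l" and G': "tangle s l G' k" 
    using F G pt by (auto simp: F'_def G'_def wf_append)
  have p3: "eqv s k k ([Box 0 k p] @ [Box 0 k p]) [Box 0 k p]" 
    and q3: "eqv s l l ([Box 0 l q] @ [Box 0 l q]) [Box 0 l q]" 
    using eqv_idem[OF p] eqv_idem[OF q'] by auto
  have absF: "eqv s k l ([Box 0 k p] @ F' @ [Box 0 l q]) F'"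
    unfolding F'_def using eqv_append[OF p3 eqv_append[OF eqv_refl[OF F] q3]] by simp
  have absG: "eqv s l k ([Box 0 l q] @ G' @ [Box 0 k p]) G'"
    unfolding G'_def using eqv_append[OF q3 eqv_append[OF eqv_refl[OF G] p3]] by simp
  have FG': "eqv s k k (F' @ G') [Box 0 k p]" and GF': "eqv s l l (G' @ F') [Box 0 l q]"
    unfolding F'_def G'_def using eqv_conjugate_comp[OF p q' F G FG GF] eqv_conjugate_comp[OF q' p G F GF FG] .
  define f where "f = val s k l F'"
  define g where "g = val s l k G'"
  have df: "eqv s k l (draw k l f) F'" and dg: "eqv s l k (draw l k g) G'"
    unfolding f_def g_def using eqv_conjugate_draw F' G' by auto
  have "f \<in> hom P (s, k, p) (t, l, q)"
  proof -
    have "val s k l ([Box 0 k p] @ draw k l f @ [Box 0 l q]) = f"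
      using eqv_val[OF eqv_trans[OF eqv_append[OF eqv_refl[OF pt(1)] eqv_append[OF df eqv_refl[OF pt(2)]]] absF]]
      by (simp add: f_def)
    then show ?thesis using st ev val_in[OF F'] by (simp add: val_def f_def)
  qed
  moreover have "g \<in> hom P (t, l, q) (s, k, p)"
  proof -
    have "val s l k ([Box 0 l q] @ draw l k g @ [Box 0 k p]) = g"
      using eqv_val[OF eqv_trans[OF eqv_append[OF eqv_refl[OF pt(2)] eqv_append[OF dg eqv_refl[OF pt(1)]]] absG]]
      by (simp add: g_def)
    then show ?thesis using st ev val_in[OF G'] by (simp add: val_def g_def)
  qed
  moreover have "act P s k (draw k l f @ draw l k g) = p" "act P s l (draw l k g @ draw k l f) = q"
    using eqv_act[OF eqv_trans[OF eqv_append[OF df dg] FG']] eqv_act[OF eqv_trans[OF eqv_append[OF dg df] GF']]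
      p q' by (auto simp: act_identity idem_def)
  ultimately show "isomorphic P (s, k, p) (t, l, q)" using st ev by auto
qed

lemma iso_refl: "idem s k p \<Longrightarrow> iso s k p k p"
  unfolding iso_def using eqv_idem[of s k p k]
  by (intro exI[of _ "[Box 0 k p]"]) (auto simp: idem_def)

lemma iso_sym: "iso s k p l q \<Longrightarrow> iso s l q k p"
  unfolding iso_def by blast

lemma iso_trans:
  assumes "idem s k p" "idem s l q" "idem s m r" "iso s k p l q" "iso s l q m r"
  shows "iso s k p m r"
proof -
  obtain F G where F: "tangle s k F l" "tangle s l G k" "eqv s k k (F @ G) [Box 0 k p]" "eqv s l l (G @ F) [Box 0 l q]"
    using assms(4) unfolding iso_def by blast
  obtain F' G' where F': "tangle s l F' m" "tangle s m G' l" "eqv s l l (F' @ G') [Box 0 l q]" "eqv s m m (G' @ F') [Box 0 m r]"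
    using assms(5) unfolding iso_def by blast
  note pt = idem_V[OF assms(1)] idem_V[OF assms(2)] idem_V[OF assms(3)]
  have p3: "eqv s k k ([Box 0 k p] @ [Box 0 k p]) [Box 0 k p]" "eqv s m m ([Box 0 m r] @ [Box 0 m r]) [Box 0 m r]"
    using eqv_idem[OF assms(1)] eqv_idem[OF assms(3)] by auto
  have "eqv s k k (F @ ((F' @ G') @ G)) (F @ ((G @ F) @ G))"
    by (intro eqv_append[OF eqv_refl[OF F(1)] eqv_append[OF eqv_trans[OF F'(3) eqv_sym[OF F(4)]] eqv_refl[OF F(2)]]])
  also have "F @ ((G @ F) @ G) = (F @ G) @ (F @ G)" by simp
  also have "eqv s k k \<dots> ([Box 0 k p] @ [Box 0 k p])" by (rule eqv_append[OF F(3) F(3)])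
  also note p3(1)
  finally have 1: "eqv s k k ((F @ F') @ (G' @ G)) [Box 0 k p]" by simp
  have "eqv s m m (G' @ ((G @ F) @ F')) (G' @ ((F' @ G') @ F'))"
    by (intro eqv_append[OF eqv_refl[OF F'(2)] eqv_append[OF eqv_trans[OF F(4) eqv_sym[OF F'(3)]] eqv_refl[OF F'(1)]]])
  also have "G' @ ((F' @ G') @ F') = (G' @ F') @ (G' @ F')" by simp
  also have "eqv s m m \<dots> ([Box 0 m r] @ [Box 0 m r])" by (rule eqv_append[OF F'(4) F'(4)])
  also note p3(2)
  finally have 2: "eqv s m m ((G' @ G) @ (F @ F')) [Box 0 m r]" by simp
  show ?thesis unfolding iso_def using 1 2 F F'
    by (intro exI[of _ "F @ F'"] exI[of _ "G' @ G"]) (auto simp: wf_append)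
qed

lemma vertex_iff:
  assumes "minimal_projection P (s, k, p)"
  shows "(t, l, q) \<in> vertex P (s, k, p) \<longleftrightarrow> t = s \<and> minimal_projection P (s, l, q) \<and> iso s k p l q"
  using isomorphic_iff_iso[OF minimal_idem[OF assms] minimal_idem, of t l q]
  unfolding vertex_def by (auto simp del: minimal_projection.simps isomorphic.simps)

lemma vertex_self: "minimal_projection P (s, k, p) \<Longrightarrow> (s, k, p) \<in> vertex P (s, k, p)"
  using vertex_iff iso_refl minimal_idem by blast

lemma vertex_eq_iff:
  assumes "minimal_projection P (s, k, p)" "minimal_projection P (s, l, q)"
  shows "vertex P (s, k, p) = vertex P (s, l, q) \<longleftrightarrow> iso s k p l q"
proof
  assume "vertex P (s, k, p) = vertex P (s, l, q)"
  then show "iso s k p l q" using vertex_self[OF assms(2)] vertex_iff[OF assms(1)] by blast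
next
  assume i: "iso s k p l q"
  have "x \<in> vertex P (s, k, p) \<longleftrightarrow> x \<in> vertex P (s, l, q)" for x
  proof -
    obtain t m r where x: "x = (t, m, r)" by (cases x)
    note a = minimal_idem[OF assms(1)] and b = minimal_idem[OF assms(2)]
    have "iso s k p m r \<longleftrightarrow> iso s l q m r" if "minimal_projection P (s, m, r)"
      using iso_trans[OF b a minimal_idem[OF that] iso_sym[OF i]] iso_trans[OF a b minimal_idem[OF that] i] by metis
    then show ?thesis unfolding x vertex_iff[OF assms(1)] vertex_iff[OF assms(2)] by metis
  qed
  then show "vertex P (s, k, p) = vertex P (s, l, q)" by blast
qed

text \<open>
  A weaker notion than being a representative of the vertex X, for the sake of dual vertices: these
  are classes of isomorphic idempotents, but not written in the form \<open>vertex P (s, k, p)\<close>.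
\<close>

definition rep_of :: "shading \<Rightarrow> nat \<Rightarrow> 'v \<Rightarrow> 'v box set \<Rightarrow> bool" where
  "rep_of s k p X \<longleftrightarrow> idem s k p \<and> X \<noteq> {} \<and> (\<forall>x\<in>X. \<exists>l q. x = (s, l, q) \<and> idem s l q \<and> iso s k p l q)"

lemma rep_of_vertex:
  assumes p: "minimal_projection P (s, k, p)" shows "rep_of s k p (vertex P (s, k, p))"
  unfolding rep_of_def
proof (intro conjI ballI)
  fix x assume x: "x \<in> vertex P (s, k, p)"
  obtain t l q where "x = (t, l, q)" by (cases x)
  then show "\<exists>l q. x = (s, l, q) \<and> idem s l q \<and> iso s k p l q"
    using x vertex_iff[OF p, of t l q] minimal_idem[of s l q] by (intro exI[of _ l] exI[of _ q]) blast
qed (use minimal_idem[OF p] vertex_self[OF p] in auto)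

lemma not_null_transport:
  assumes p: "iso s k p k' p'" "idem s k p" "idem s k' p'" and q: "iso s l q l' q'" "idem s l q" "idem s l' q'"
    and H: "tangle s (Suc k) H l" "\<not> null s (Suc k) l ([Box 0 k p] @ H @ [Box 0 l q])"
  shows "\<exists>H'. tangle s (Suc k') H' l' \<and> \<not> null s (Suc k') l' ([Box 0 k' p'] @ H' @ [Box 0 l' q'])"
proof -
  obtain F G where F: "tangle s k F k'" "tangle s k' G k" "eqv s k k (F @ G) [Box 0 k p]" "eqv s k' k' (G @ F) [Box 0 k' p']"
    using p(1) unfolding iso_def by blast
  obtain F' G' where F': "tangle s l F' l'" "tangle s l' G' l" "eqv s l l (F' @ G') [Box 0 l q]" "eqv s l' l' (G' @ F') [Box 0 l' q']"
    using q(1) unfolding iso_def by blast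
  have Ft: "tangle s (Suc k) F (Suc k')" "tangle s (Suc k') G (Suc k)" using wf_widen[OF F(1), of 1] wf_widen[OF F(2), of 1] by simp_all
  define H' where "H' = G @ H @ F'"
  have H': "tangle s (Suc k') H' l'" using Ft F' H by (auto simp: H'_def wf_append)
  have p2: "eqv s (Suc k) (Suc k) (F @ ([Box 0 k' p'] @ G)) [Box 0 k p]"
    using eqv_widen[OF eqv_sandwich[OF p(2) F], of 1] by simp
  have q2: "eqv s l l (F' @ ([Box 0 l' q'] @ G')) [Box 0 l q]" by (rule eqv_sandwich[OF q(2) F'])
  have "\<not> null s (Suc k') l' ([Box 0 k' p'] @ H' @ [Box 0 l' q'])"
  proof
    assume "null s (Suc k') l' ([Box 0 k' p'] @ H' @ [Box 0 l' q'])"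
    then have "null s (Suc k) l (F @ ([Box 0 k' p'] @ H' @ [Box 0 l' q']) @ G')"
      by (rule null_append_left[OF null_append_right[OF _ F'(2)] Ft(1)])
    moreover have "eqv s (Suc k) l ((F @ ([Box 0 k' p'] @ G)) @ H @ (F' @ ([Box 0 l' q'] @ G'))) ([Box 0 k p] @ H @ [Box 0 l q])"
      by (intro eqv_append[OF p2 eqv_append[OF eqv_refl[OF H(1)] q2]])
    ultimately show False using H(2) null_eqv by (auto simp: H'_def)
  qed
  then show ?thesis using H' by blast
qed

lemma edges_rep:
  assumes "idem s k p" "idem s l q" "(SOME x. x \<in> X) = (s, k, p)" "(SOME y. y \<in> Y) = (s, l, q)"
  shows "edges P X Y \<noteq> 0 \<longleftrightarrow> (\<exists>H. tangle s (Suc k) H l \<and> \<not> null s (Suc k) l ([Box 0 k p] @ H @ [Box 0 l q]))"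
proof -
  define p1 where "p1 = act P s (Suc k) [Box 0 k p]"
  define M where "M = (Suc k + l) div 2"
  have pV: "p \<in> V k s" "q \<in> V l s" using assms idem_V by auto
  have p1: "eqv s (Suc k) (Suc k) [Box 0 (Suc k) p1] [Box 0 k p]"
    unfolding p1_def using eqv_Box_act[of s "Suc k" "[Box 0 k p]" "Suc k"] pV by simp
  have p1t: "tangle s (Suc k) [Box 0 (Suc k) p1] (Suc k)" using eqv_tangle(1)[OF p1] .
  have qt: "tangle s l [Box 0 l q] l" using pV by simp
  have e: "edges P X Y = dim (hom P (s, Suc k, p1) (s, l, q))"
    unfolding edges_def assms(3,4) p1_def by simp
  have hom: "hom P (s, Suc k, p1) (s, l, q) = (if even (Suc k + l) then
      {x \<in> V M s. val s (Suc k) l ([Box 0 (Suc k) p1] @ draw (Suc k) l x @ [Box 0 l q]) = x} else {0})"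
    unfolding val_def M_def by simp
  have sub: "hom P (s, Suc k, p1) (s, l, q) \<subseteq> V M s" unfolding hom by auto
  have "edges P X Y \<noteq> 0 \<longleftrightarrow> (\<exists>x \<in> hom P (s, Suc k, p1) (s, l, q). x \<noteq> 0)"
    unfolding e by (rule dim_nonzero_iff[OF sub])
  also have "\<dots> \<longleftrightarrow> (\<exists>H. tangle s (Suc k) H l \<and> \<not> null s (Suc k) l ([Box 0 k p] @ H @ [Box 0 l q]))"
  proof
    assume "\<exists>x \<in> hom P (s, Suc k, p1) (s, l, q). x \<noteq> 0"
    then obtain x where ev: "even (Suc k + l)" and x: "x \<in> V M s" "x \<noteq> 0"
      "val s (Suc k) l ([Box 0 (Suc k) p1] @ draw (Suc k) l x @ [Box 0 l q]) = x"
      unfolding hom by (auto split: if_splits)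
    have t: "tangle s (Suc k) (draw (Suc k) l x) l" using tangle_draw x(1) ev unfolding M_def by blast
    have "eqv s (Suc k) l ([Box 0 (Suc k) p1] @ draw (Suc k) l x @ [Box 0 l q]) ([Box 0 k p] @ draw (Suc k) l x @ [Box 0 l q])"
      by (intro eqv_append[OF p1 eqv_append[OF eqv_refl[OF t] eqv_refl[OF qt]]])
    then have "val s (Suc k) l ([Box 0 k p] @ draw (Suc k) l x @ [Box 0 l q]) = x" using eqv_val x(3) by metis
    then show "\<exists>H. tangle s (Suc k) H l \<and> \<not> null s (Suc k) l ([Box 0 k p] @ H @ [Box 0 l q])"
      using t x(2) unfolding null_def by metis
  next
    assume "\<exists>H. tangle s (Suc k) H l \<and> \<not> null s (Suc k) l ([Box 0 k p] @ H @ [Box 0 l q])"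
    then obtain H where H: "tangle s (Suc k) H l" "\<not> null s (Suc k) l ([Box 0 k p] @ H @ [Box 0 l q])" by blast
    define w where "w = [Box 0 k p] @ H @ [Box 0 l q]"
    define x where "x = val s (Suc k) l w"
    have w: "tangle s (Suc k) w l" using H pV by (auto simp: w_def wf_append)
    have x0: "x \<noteq> 0" using H(2) w by (simp add: null_def x_def w_def)
    have "eqv s (Suc k) l ([Box 0 (Suc k) p1] @ draw (Suc k) l x @ [Box 0 l q]) ([Box 0 k p] @ w @ [Box 0 l q])"
      unfolding x_def by (intro eqv_append[OF p1 eqv_append[OF eqv_conjugate_draw[OF w] eqv_refl[OF qt]]])
    also have "[Box 0 k p] @ w @ [Box 0 l q] = [Box 0 k p, Box 0 k p] @ H @ [Box 0 l q, Box 0 l q]" by (simp add: w_def)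
    also have "eqv s (Suc k) l \<dots> w"
      unfolding w_def by (intro eqv_append[OF eqv_idem eqv_append[OF eqv_refl[OF H(1)] eqv_idem]] assms) simp_all
    finally have "val s (Suc k) l ([Box 0 (Suc k) p1] @ draw (Suc k) l x @ [Box 0 l q]) = x"
      using eqv_val unfolding x_def by blast
    moreover have "x \<in> V M s" using val_in[OF w] by (simp add: x_def M_def)
    moreover have "even (Suc k + l)" using wf_parity[OF w] .
    ultimately have "x \<in> hom P (s, Suc k, p1) (s, l, q)" unfolding hom by simp
    then show "\<exists>x \<in> hom P (s, Suc k, p1) (s, l, q). x \<noteq> 0" using x0 by blast
  qed
  finally show ?thesis .
qed

text \<open>
  Only whether there is an edge matters, and this can be tested with any representatives and with
  any diagram H; the most important one is the diagram without slices.
\<close>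

lemma edges_nonzero_iff:
  assumes X: "rep_of s k p X" and Y: "rep_of s l q Y"
  shows "edges P X Y \<noteq> 0 \<longleftrightarrow> (\<exists>H. tangle s (Suc k) H l \<and> \<not> null s (Suc k) l ([Box 0 k p] @ H @ [Box 0 l q]))"
proof -
  have "(SOME x. x \<in> X) \<in> X" using X unfolding rep_of_def by (metis some_in_eq)
  then obtain k' p' where p': "(SOME x. x \<in> X) = (s, k', p')" "idem s k' p'" "iso s k p k' p'"
    using X unfolding rep_of_def by blast
  have "(SOME x. x \<in> Y) \<in> Y" using Y unfolding rep_of_def by (metis some_in_eq)
  then obtain l' q' where q': "(SOME x. x \<in> Y) = (s, l', q')" "idem s l' q'" "iso s l q l' q'"
    using Y unfolding rep_of_def by blast
  have i: "idem s k p" "idem s l q" using X Y by (auto simp: rep_of_def)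
  show ?thesis unfolding edges_rep[OF p'(2) q'(2) p'(1) q'(1)]
    using not_null_transport[OF p'(3) i(1) p'(2) q'(3) i(2) q'(2)]
      not_null_transport[OF iso_sym[OF p'(3)] p'(2) i(1) iso_sym[OF q'(3)] q'(2) i(2)] by blast
qed

text \<open>
  Closing the composite at its k ends turns the bent strings of x and y into the remaining strings of the
  trace of their product.
\<close>

lemma Tr_mult_eq_0_if_null_draw:
  assumes x: "x \<in> V M s" and y: "y \<in> V M s" and M: "2 * M = k + l" and kl: "k \<le> l"
    and n: "null s k k (draw k l x @ draw l k y)"
  shows "Tr P s M (mul s M y x) = 0"
proof -
  have kM: "k + (M - k) = M" "M - l = 0" "(k + l) div 2 = M" "(l + k) div 2 = M" using M kl by auto
  have cl: "cups k 0 @ cups (M - k) k @ u = cups M 0 @ u" "caps (M - k) k @ caps k 0 = caps M 0" for u :: "'v diagram"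
    using cups_add[of k "M - k" 0] caps_add[of k "M - k" 0] kM by (metis append.assoc add_0)+
  have "cups k 0 @ (draw k l x @ draw l k y) @ caps k 0 = cups M 0 @ [Box 0 M x, Box 0 M y] @ caps M 0"
    by (simp add: draw_def kM cl)
  moreover have "null s 0 0 (cups k 0 @ (draw k l x @ draw l k y) @ caps k 0)"
    by (rule null_context_0[OF n, of _ _ k]) simp_all
  ultimately have "act P s 0 (cups M 0 @ [Box 0 M x, Box 0 M y] @ caps M 0) = 0" by (metis null_diag)
  moreover have "eqv s 0 0 (cups M 0 @ [Box 0 M (mul s M y x)] @ caps M 0) (cups M 0 @ [Box 0 M x, Box 0 M y] @ caps M 0)"
    using eqv_context[OF eqv_Box_mult_0[OF y x order_refl], of 0 "cups M 0" M "caps M 0" 0] by simp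
  ultimately show ?thesis
    unfolding Tr_def using Tr_0[of s 0] scalar_eq[of s 0] by (auto dest: eqv_act)
qed

text \<open>
  Positivity for diagrams with different numbers of strings at the bottom and at the top.  After
  bending strings, the trace of w* w is the trace of x* x, where x is the box obtained from w.
  For k < l the composite must be closed at the other end; there w w* vanishes, too, being
  self-adjoint with vanishing square.
\<close>

lemma null_if_reflect_null:
  assumes w: "tangle s k w l" and n: "null s l l (reflect (star P) w @ w)"
  shows "null s k l w"
proof -
  define w' where "w' = reflect (star P) w"
  define x where "x = val s k l w"
  define M where "M = (k + l) div 2"
  have M2: "2 * M = k + l" using wf_parity[OF w] by (simp add: M_def)
  have w': "tangle s l w' k" unfolding w'_def using tangle_reflect[OF w] .
  have x: "x \<in> V M s" unfolding x_def M_def using val_in[OF w] .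
  have xs: "star P x \<in> V M s" using x star_in by blast
  have rd: "reflect (star P) (draw k l x) = draw l k (star P x)"
    by (simp add: draw_def reflect_append M_def[symmetric] add.commute[of l k] Let_def)
  have d: "eqv s k l (draw k l x) w" unfolding x_def by (rule eqv_conjugate_draw[OF w])
  have d': "eqv s l k (draw l k (star P x)) w'" using eqv_reflect[OF d] unfolding rd w'_def .
  have "null s k k (w @ w')"
  proof -
    have "null s l l (w' @ w)" using n by (simp add: w'_def)
    then have "null s k k (w @ (w' @ w) @ w')"
      by (rule null_append_left[OF null_append_right[OF _ w'] w])
    then have z: "act P s k ((w @ w') @ (w @ w')) = 0" by (simp add: null_diag)
    have t: "tangle s k (w @ w') k" using w w' by (auto simp: wf_append)
    define z where "z = act P s k (w @ w')"
    have zV: "z \<in> V k s" unfolding z_def using act_in[OF t] .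
    have "star P z = z"
      unfolding z_def star_act[OF t] by (simp add: reflect_append w'_def reflect_reflect[OF w])
    moreover have "mul s k z z = 0" using z act_append[OF t t] by (simp add: z_def)
    ultimately have "z = 0" using star_mult_eq_0[OF zV] by simp
    then show ?thesis using t by (simp add: null_diag z_def)
  qed
  have "Tr P s M (mul s M (star P x) x) = 0 \<or> Tr P s M (mul s M (star P (star P x)) (star P x)) = 0"
  proof (cases "k \<le> l")
    case True
    have "null s k k (draw k l x @ draw l k (star P x))"
      using null_eqv[OF eqv_append[OF d d']] \<open>null s k k (w @ w')\<close> by blast
    then show ?thesis using Tr_mult_eq_0_if_null_draw[OF x xs M2 True] by blast
  next
    case False
    have "null s l l (draw l k (star P x) @ draw k l x)"
      using null_eqv[OF eqv_append[OF d' d]] n by (simp add: w'_def)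
    then show ?thesis using Tr_mult_eq_0_if_null_draw[OF xs x, of l k] M2 False star_star[OF x] by simp
  qed
  then have "x = 0" using positive_definite[OF x] positive_definite[OF xs] star_star[OF x] star_0 by fastforce
  then show ?thesis using w by (simp add: null_def x_def)
qed

text \<open>
  If w does not vanish and ends in the minimal projection q, then w w* is a non-zero multiple
  of q, so that a multiple of w* w is a minimal projection isomorphic to q.
\<close>

lemma minimal_transport:
  assumes q: "minimal_projection P (s, l, q)" and w: "tangle s k w l"
    and nn: "\<not> null s k l (w @ [Box 0 l q])"
  shows "\<exists>p. minimal_projection P (s, k, p) \<and> iso s k p l q"
proof -
  note q1 = minimalD[OF q]
  define h where "h = w @ [Box 0 l q]"
  define h' where "h' = [Box 0 l q] @ reflect (star P) w"
  have h: "tangle s k h l" using w q1 by (auto simp: h_def wf_append)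
  have hr: "reflect (star P) h = h'" using q1 by (simp add: h_def h'_def reflect_append)
  have h': "tangle s l h' k" using tangle_reflect[OF h] hr by simp
  have t: "tangle s l (reflect (star P) w @ w) l" using w tangle_reflect[OF w] by (auto simp: wf_append)
  define x where "x = act P s l (reflect (star P) w @ w)"
  have x: "x \<in> V l s" unfolding x_def by (rule act_in[OF t])
  obtain c where c: "mul s l q (mul s l x q) = sm c q" using q1(5)[OF x] by blast
  have qt: "tangle s l [Box 0 l q] l" using q1 by simp
  have hh: "act P s l (h' @ h) = sm c q"
    using act_append[OF _ qt, of "[Box 0 l q] @ (reflect (star P) w @ w)"] act_append[OF qt t] t qt c q1
    by (simp add: h_def h'_def wf_append act_identity x_def)
  have c0: "c \<noteq> 0"
  proof
    assume "c = 0"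
    then have "null s l l (reflect (star P) h @ h)" using hh h h' by (auto simp: null_diag hr wf_append)
    then show False using null_if_reflect_null[OF h] nn by (simp add: h_def)
  qed
  have th: "tangle s k (h @ h') k" using h h' by (auto simp: wf_append)
  define z where "z = act P s k (h @ h')"
  have z: "z \<in> V k s" unfolding z_def by (rule act_in[OF th])
  have rh: "reflect (star P) h' = h" using reflect_reflect[OF h] hr by simp
  have zs: "star P z = z" unfolding z_def star_act[OF th] by (simp add: reflect_append hr rh)
  have "tangle s l (h' @ h) l" using h h' by (auto simp: wf_append)
  then have "star P (sm c q) = sm c q" unfolding hh[symmetric] by (simp add: star_act reflect_append hr rh)
  then have "sm (cnj c) q = sm c q" using star_scale[OF q1(1)] q1(2) by simp
  then have creal: "cnj c = c" using q1(4) scale_right_imp_eq by blast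
  have hq: "eqv s l l (h' @ h) [Box 0 l (sm c q)]"
    by (rule val_eqv) (use h h' hh q1 in \<open>auto simp: wf_append val_diag act_identity V_scale\<close>)
  have boxes: "act P s k (h @ [Box 0 l (sm a q)] @ v) = sm a (act P s k (h @ [Box 0 l q] @ v))" if "tangle s l v k" for a v
    using lin_scale[OF lin_val[of s k h 0 l v k], of q a] h that q1 by (auto simp: wf_append val_diag)
  have absq: "eqv s k l (h @ [Box 0 l q]) h"
    using eqv_prefix[OF w eqv_idem[OF minimal_idem[OF q] order_refl]] by (simp add: h_def)
  define p where "p = sm (1 / c) z"
  have p: "p \<in> V k s" using z by (simp add: p_def V_scale)
  have zz: "mul s k z z = sm c z"
  proof -
    have "mul s k z z = act P s k (h @ (h' @ h) @ h')" using act_append[OF th th] by (simp add: z_def)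
    also have "\<dots> = act P s k (h @ [Box 0 l (sm c q)] @ h')" 
      by (intro eqv_act eqv_prefix[OF h] eqv_suffix[OF _ h'] hq)
    also have "\<dots> = sm c (act P s k ((h @ [Box 0 l q]) @ h'))" using boxes[OF h'] by simp
    also have "act P s k ((h @ [Box 0 l q]) @ h') = z" unfolding z_def by (intro eqv_act eqv_suffix[OF absq h'])
    finally show ?thesis .
  qed
  have "z \<noteq> 0"
  proof
    assume "z = 0"
    then have "null s k k (h @ h')" using th by (simp add: null_diag z_def)
    then have "null s l l (h' @ (h @ h') @ h)" 
      by (intro null_append_left[OF null_append_right[OF _ h] h'])
    then have "act P s l ((h' @ h) @ (h' @ h)) = 0" by (simp add: null_diag)
    then have "mul s l (sm c q) (sm c q) = 0" using act_append[of s l "h' @ h" "h' @ h"] h h' hh by (auto simp: wf_append)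
    then have "sm (c * c) q = 0" using q1 by (simp add: mult_simps V_scale)
    then show False using c0 q1(4) by simp
  qed
  then have p0: "p \<noteq> 0" using c0 by (simp add: p_def)
  have pp: "mul s k p p = p" using zz z c0 by (simp add: p_def mult_simps V_scale)
  have ps: "star P p = p" using zs z creal by (simp add: p_def star_scale)
  have "\<exists>d. mul s k p (mul s k y p) = sm d p" if y: "y \<in> V k s" for y
  proof -
    have tw: "tangle s l (reflect (star P) w @ [Box 0 k y] @ w) l" using w tangle_reflect[OF w] y by (auto simp: wf_append)
    define u where "u = act P s l (reflect (star P) w @ [Box 0 k y] @ w)"
    obtain e where e: "mul s l q (mul s l u q) = sm e q" using q1(5)[OF act_in[OF tw]] unfolding u_def by blast
    have hyh: "act P s l (h' @ [Box 0 k y] @ h) = sm e q"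
      using act_append[OF _ qt, of "[Box 0 l q] @ (reflect (star P) w @ [Box 0 k y] @ w)"] act_append[OF qt tw] tw qt e q1
      by (simp add: h_def h'_def wf_append act_identity u_def)
    have hye: "eqv s l l (h' @ [Box 0 k y] @ h) [Box 0 l (sm e q)]"
      by (rule val_eqv) (use h h' hyh q1 y in \<open>auto simp: wf_append val_diag act_identity V_scale\<close>)
    have "mul s k z (mul s k y z) = act P s k (((h @ h') @ [Box 0 k y]) @ (h @ h'))"
      using act_append[of s k "(h @ h') @ [Box 0 k y]" "h @ h'"] act_append[OF th, of "[Box 0 k y]"] th y 
      by (auto simp: z_def act_identity wf_append)
    also have "\<dots> = act P s k (h @ (h' @ [Box 0 k y] @ h) @ h')" by simp
    also have "\<dots> = act P s k (h @ [Box 0 l (sm e q)] @ h')" 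
      by (intro eqv_act eqv_prefix[OF h] eqv_suffix[OF _ h'] hye)
    also have "\<dots> = sm e (act P s k ((h @ [Box 0 l q]) @ h'))" using boxes[OF h'] by simp
    also have "act P s k ((h @ [Box 0 l q]) @ h') = z" unfolding z_def by (intro eqv_act eqv_suffix[OF absq h'])
    finally have "mul s k z (mul s k y z) = sm e z" .
    then have "mul s k p (mul s k y p) = sm (e / c) p"
      using z y by (simp add: p_def mult_simps V_scale mult_in)
    then show ?thesis by blast
  qed
  then have "minimal_projection P (s, k, p)" using p p0 pp ps by auto
  moreover have "iso s k p l q"
    unfolding iso_def
  proof (intro exI conjI)
    define g where "g = [Box 0 l (sm (1 / c) q)] @ h'"
    have q': "sm (1 / c) q \<in> V l s" using q1 by (simp add: V_scale)
    show "tangle s k h l" by fact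
    show tg: "tangle s l g k" using h' q' by (simp add: g_def)
    show "eqv s k k (h @ g) [Box 0 k p]"
    proof (rule val_eqv)
      have "act P s k (h @ g) = sm (1 / c) (act P s k ((h @ [Box 0 l q]) @ h'))" using boxes[OF h'] by (simp add: g_def)
      also have "act P s k ((h @ [Box 0 l q]) @ h') = z" unfolding z_def by (intro eqv_act eqv_suffix[OF absq h'])
      finally show "val s k k (h @ g) = val s k k [Box 0 k p]" using p by (simp add: val_diag act_identity p_def)
    qed (use h tg p in \<open>auto simp: wf_append\<close>)
    show "eqv s l l (g @ h) [Box 0 l q]"
    proof (rule val_eqv)
      have "act P s l ([Box 0 l (sm (1 / c) q)] @ (h' @ h)) = mul s l (sm c q) (sm (1 / c) q)"
        using act_append[of s l "[Box 0 l (sm (1 / c) q)]" "h' @ h"] h h' hh q' by (auto simp: wf_append act_identity)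
      also have "\<dots> = q" using q1 c0 by (simp add: mult_simps V_scale)
      finally show "val s l l (g @ h) = val s l l [Box 0 l q]" using q1 by (simp add: val_diag act_identity g_def)
    qed (use h tg q1 in \<open>auto simp: wf_append\<close>)
  qed
  ultimately show ?thesis by blast
qed

lemma vertices_iff: "X \<in> vertices P s \<longleftrightarrow> (\<exists>k p. minimal_projection P (s, k, p) \<and> X = vertex P (s, k, p))"
  unfolding vertices_def by blast

text \<open>
  Every minimal projection in the k-box space is reached from the base point by a walk of length k:
  restrict it to one of the minimal projections that decompose the identity of the (k-1)-box space.
\<close>

lemma path_to_minimal:
  "minimal_projection P (s, k, p) \<Longrightarrow> (adjacent P s ^^ k) (base_point P s) (vertex P (s, k, p))"
proof (induction k arbitrary: p)
  case 0
  note p1 = minimalD[OF 0]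
  obtain c where c: "p = sm c (one s 0)" using V0_eq p1 by blast
  have "sm (c * c) (one s 0) = sm c (one s 0)" using p1(3) unfolding c by (simp add: mult_simps V_scale one_mult)
  then have "c * c = c" using empty_diagram_nonzero[of s] by (simp add: scale_right_imp_eq)
  then have "p = one s 0" using c p1(4) by auto
  then show ?case by (simp add: base_point_def)
next
  case (Suc k)
  note p1 = minimalD[OF Suc.prems]
  have "is_projection P (s, k, one s k)" by (simp add: one_mult)
  then obtain qs where qs: "\<forall>q\<in>set qs. minimal_projection P (s, k, q) \<and> mul s k (one s k) q = q" "sum_list qs = one s k"
    using projection_sum_minimal by blast
  define f where "f q = val s (Suc k) (Suc k) ([] @ [Box 0 k q] @ [Box 0 (Suc k) p])" for q
  have lf: "lin (V k s) f" unfolding f_def using lin_val[of s "Suc k" "[]" 0 k "[Box 0 (Suc k) p]" "Suc k"] p1 by simp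
  have "f (one s k) = p"
    using eqv_val[OF eqv_suffix[OF eqv_Box_act[of s k "[]" "Suc k"], of "[Box 0 (Suc k) p]" "Suc k"]] p1
    by (simp add: f_def val_diag act_identity)
  moreover have "f (sum_list qs) = sum_list (map f qs)"
    using lin_sum_list[OF lf] qs(1) minimalD(1) by blast
  ultimately have "sum_list (map f qs) \<noteq> 0" using qs(2) p1(4) by simp
  moreover have "sum_list (map f qs) = 0" if "\<forall>q\<in>set qs. f q = 0" using that by (induction qs) auto
  ultimately obtain q where q: "q \<in> set qs" "f q \<noteq> 0" by blast
  have qm: "minimal_projection P (s, k, q)" using qs q by blast
  note q1 = minimalD[OF qm]
  have "edges P (vertex P (s, k, q)) (vertex P (s, Suc k, p)) \<noteq> 0"
    unfolding edges_nonzero_iff[OF rep_of_vertex[OF qm] rep_of_vertex[OF Suc.prems]]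
    by (intro exI[of _ "[]"]) (use q(2) in \<open>simp add: f_def null_def\<close>)
  then have "adjacent P s (vertex P (s, k, q)) (vertex P (s, Suc k, p))"
    unfolding adjacent_def vertices_iff using qm Suc.prems by blast
  then show ?case using Suc.IH[OF qm] by auto
qed

text \<open>
  Conversely, each edge of a walk adds one string: by \<open>minimal_transport\<close> the end of a walk
  of length t has a representative in the t-box space.  So the depth is the least number of strings of
  a representative.
\<close>

lemma path_from_base:
  "(adjacent P s ^^ t) (base_point P s) X \<Longrightarrow> \<exists>p. minimal_projection P (s, t, p) \<and> X = vertex P (s, t, p)"
proof (induction t arbitrary: X)
  case 0
  then show ?case using minimal_one[of s] by (auto simp: base_point_def simp del: minimal_projection.simps)
next
  case (Suc t)
  then obtain Y where Y: "(adjacent P s ^^ t) (base_point P s) Y" "adjacent P s Y X" by auto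
  then obtain p where p: "minimal_projection P (s, t, p)" "Y = vertex P (s, t, p)" using Suc.IH by blast
  obtain l q where q: "minimal_projection P (s, l, q)" "X = vertex P (s, l, q)"
    using Y(2) unfolding adjacent_def vertices_iff by blast
  obtain H where H: "tangle s (Suc t) H l" "\<not> null s (Suc t) l ([Box 0 t p] @ H @ [Box 0 l q])"
    using Y(2) edges_nonzero_iff[OF rep_of_vertex[OF p(1)] rep_of_vertex[OF q(1)]] p(2) q(2)
    unfolding adjacent_def by blast
  have "tangle s (Suc t) ([Box 0 t p] @ H) l" using H minimalD(1)[OF p(1)] by simp
  then obtain p' where "minimal_projection P (s, Suc t, p')" "iso s (Suc t) p' l q"
    using minimal_transport[OF q(1), of "Suc t" "[Box 0 t p] @ H"] H(2) by auto
  then show ?case using q vertex_eq_iff by blast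
qed

lemma depth_le:
  "minimal_projection P (s, k, p) \<Longrightarrow> depth P s (vertex P (s, k, p)) \<le> k"
  unfolding depth_def using path_to_minimal by (rule Least_le)

lemma depth_attained:
  assumes "minimal_projection P (s, k, p)"
  shows "\<exists>q. minimal_projection P (s, depth P s (vertex P (s, k, p)), q) \<and> iso s (depth P s (vertex P (s, k, p))) q k p"
proof -
  have "(adjacent P s ^^ depth P s (vertex P (s, k, p))) (base_point P s) (vertex P (s, k, p))"
    unfolding depth_def by (rule LeastI[of _ k]) (rule path_to_minimal[OF assms])
  then show ?thesis using path_from_base vertex_eq_iff assms by metis
qed

lemma depth_null:
  assumes p: "minimal_projection P (s, n, p)" "depth P s (vertex P (s, n, p)) = n"
    and w: "tangle s m w n" "m < n"
  shows "null s m n (w @ [Box 0 n p])"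
proof (rule ccontr)
  assume "\<not> ?thesis"
  then obtain q where "minimal_projection P (s, m, q)" "iso s m q n p"
    using minimal_transport[OF p(1) w(1)] by blast
  then show False using depth_le vertex_eq_iff p w(2) by (metis not_le)
qed

end

section \<open>Partial traces and duals\<close>

context shaded_planar_algebra
begin

lemma eqv_expand:
  assumes "tangle (cross i s) j w j" "tangle s m (u @ [Box i j (act P (cross i s) j w)] @ v) l"
  shows "eqv s m l (u @ [Box i j (act P (cross i s) j w)] @ v) (u @ map (shift i) w @ v)"
  by (rule eqv_replace[OF assms(2)]) (use eqv_glue_le[OF assms(1)] in auto)

lemma eqv_expand_0:
  assumes "tangle s j w j" "tangle s m (u @ [Box 0 j (act P s j w)] @ v) l"
  shows "eqv s m l (u @ [Box 0 j (act P s j w)] @ v) (u @ w @ v)"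
  using eqv_expand[of 0 s j w m u v l] assms by simp

lemma eqv_expand_1:
  assumes "tangle s j w j" "tangle (opposite s) m (u @ [Box 1 j (act P s j w)] @ v) l"
  shows "eqv (opposite s) m l (u @ [Box 1 j (act P s j w)] @ v) (u @ map (shift 1) w @ v)"
  using eqv_expand[of 1 "opposite s" j w m u v l] assms by simp

text \<open>
  The conditional expectations onto fewer strings, up to normalization: the last, respectively the
  first, string is closed.
\<close>

definition E :: "shading \<Rightarrow> nat \<Rightarrow> 'v \<Rightarrow> 'v" where
  "E s k x = act P s k [Cup k, Box 0 (Suc k) x, Cap k]"

definition El :: "shading \<Rightarrow> nat \<Rightarrow> 'v \<Rightarrow> 'v" where
  "El s k x = act P (opposite s) k [Cup 0, Box 1 (Suc k) x, Cap 0]"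

text \<open>The rotation by 180 degrees, on elements and, more generally, on diagrams.\<close>

definition dl :: "shading \<Rightarrow> nat \<Rightarrow> 'v \<Rightarrow> 'v" where
  "dl s k x = act P (cross k s) k (cups k 0 @ [Box k k x] @ caps k k)"

definition turned :: "nat \<Rightarrow> nat \<Rightarrow> 'v diagram \<Rightarrow> 'v diagram" where
  "turned k l w = cups k 0 @ map (shift k) w @ caps l k"

lemma E_in: "x \<in> V (Suc k) s \<Longrightarrow> E s k x \<in> V k s"
  unfolding E_def by (rule act_in) simp

lemma El_in: "x \<in> V (Suc k) s \<Longrightarrow> El s k x \<in> V k (opposite s)"
  unfolding El_def by (rule act_in) simp

lemma cross_twice: "cross k (cross k s) = s"
  by (simp add: cross_cross cross_even)

lemma dl_in: "x \<in> V k s \<Longrightarrow> dl s k x \<in> V k (cross k s)"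
  unfolding dl_def by (rule act_in) (simp add: cross_twice)

lemma rotation_in: "x \<in> V k s \<Longrightarrow> 1 \<le> k \<Longrightarrow> rotation P s k x \<in> V k (opposite s)"
  unfolding rotation_def by (rule act_in) simp

lemma lin_E: "lin (V (Suc k) s) (E s k)"
  using lin_val[of s k "[Cup k]" 0 "Suc k" "[Cap k]" k] by (simp add: E_def[abs_def] val_diag)

lemma lin_dl: "lin (V k s) (dl s k)"
  using lin_val[of "cross k s" k "cups k 0" k k "caps k k" k] by (simp add: dl_def[abs_def] val_diag cross_twice)

lemma lin_rotation: "1 \<le> k \<Longrightarrow> lin (V k s) (rotation P s k)"
  using lin_val[of "opposite s" k "[Cup 0]" 1 k "[Cap k]" k] by (simp add: rotation_def[abs_def] val_diag)

lemma tangle_turned: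
  assumes "tangle s k w l" shows "tangle (cross k s) l (turned k l w) k"
proof -
  have "tangle (cross k s) (k + k + l) (map (shift k) w) (k + l + l)"
    by (rule wf_shift_widen) (use assms in \<open>simp add: cross_twice\<close>)
  then show ?thesis unfolding turned_def by (simp add: wf_append) (auto simp: mult_2 add.commute add.left_commute)
qed

lemma turned_eqv:
  assumes "eqv s k l w w'" shows "eqv (cross k s) l k (turned k l w) (turned k l w')"
proof -
  have "eqv (cross k s) (k + k) (k + l) (map (shift k) w) (map (shift k) w')"
    by (rule eqv_shift) (use assms in \<open>simp add: cross_twice\<close>)
  from eqv_context[OF this, of l "cups k 0" l "caps l k" k] show ?thesis
    by (simp add: turned_def mult_2 add.commute add.left_commute)
qed

text \<open>
  Turning reverses the order of composition.  The l strings between the two turned diagrams are bent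
  back and forth; straightening this nested zigzag gives the turned composite.
\<close>

lemma turned_append:
  assumes F: "tangle s k F l" and G: "tangle s l G m"
  shows "eqv (cross k s) m k (turned l m G @ turned k l F) (turned k m (F @ G))"
proof -
  define T where "T = cross k s"
  have kl: "cross l s = T" using wf_parity[OF F] cross_cong[of l k s] by (simp add: T_def add.commute)
  have cT: "cross (2 * k) T = T" by (rule cross_even) simp
  have F': "tangle T (2 * k) (map (shift k) F) (k + l)"
    using wf_shift[of _ k T k F l] F by (simp add: T_def cross_twice mult_2)
  have G': "tangle (cross (k + 2 * l) T) (l + m) (G @ caps m 0) 0" "tangle T (k + l) (map (shift k) G) (k + m)"
  proof -
    have *: "cross (k + 2 * l) T = s" "cross k T = s" by (simp_all add: T_def cross_cross cross_even)
    show "tangle (cross (k + 2 * l) T) (l + m) (G @ caps m 0) 0"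
      unfolding * using wf_widen[OF G, of m] by (auto simp: wf_append)
    show "tangle T (k + l) (map (shift k) G) (k + m)" by (rule wf_shift) (use G * in simp)
  qed
  define TG where "TG = turned l m G"
  have TG: "tangle T m TG l" unfolding TG_def kl[symmetric] by (rule tangle_turned[OF G])
  have TG2: "tangle (cross (2 * k) T) m TG l" unfolding cT by (rule TG)
  have sTG: "map (shift (k + l)) TG = cups l (k + l) @ map (shift (k + 2 * l)) (G @ caps m 0)"
    by (simp add: TG_def turned_def mult_2 add.assoc)
  have "eqv T m (2 * k + l) (TG @ cups k 0) (cups k 0 @ map (shift (2 * k)) TG)"
    using eqv_sym[OF eqv_block[of T 0 "cups k 0" "2 * k" m TG l]] TG by simp
  then have "eqv T m k ((TG @ cups k 0) @ map (shift k) F @ caps l k) ((cups k 0 @ map (shift (2 * k)) TG) @ map (shift k) F @ caps l k)"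
    by (rule eqv_suffix) (use wf_widen[OF F', of l] in \<open>auto simp: wf_append\<close>)
  also have "(cups k 0 @ map (shift (2 * k)) TG) @ map (shift k) F @ caps l k = cups k 0 @ (map (shift (2 * k)) TG @ map (shift k) F) @ caps l k" by simp
  also have "eqv T m k \<dots> (cups k 0 @ (map (shift k) F @ map (shift (k + l)) TG) @ caps l k)"
    by (rule eqv_context[OF eqv_sym[OF eqv_block[OF F' TG2]], of _ _ 0]) simp_all
  also have "cups k 0 @ (map (shift k) F @ map (shift (k + l)) TG) @ caps l k =
      (cups k 0 @ map (shift k) F @ cups l (k + l)) @ (map (shift (k + 2 * l)) (G @ caps m 0) @ caps l k)"
    by (simp add: sTG)
  also have "eqv T m k \<dots> ((cups k 0 @ map (shift k) F @ cups l (k + l)) @ (caps l k @ map (shift k) (G @ caps m 0)))"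
  proof (rule eqv_prefix)
    show "tangle T m (cups k 0 @ map (shift k) F @ cups l (k + l)) (k + 2 * l + (l + m))"
      using wf_widen[OF F', of m] by (auto simp: wf_append add.commute)
    show "eqv T (k + 2 * l + (l + m)) k (map (shift (k + 2 * l)) (G @ caps m 0) @ caps l k) (caps l k @ map (shift k) (G @ caps m 0))"
      using eqv_sym[OF eqv_block[OF _ G'(1), of "caps l k" k]] by simp
  qed
  also have "\<dots> = (cups k 0 @ map (shift k) F) @ (cups l (k + l) @ caps l k) @ map (shift k) G @ caps m k" by simp
  also have "eqv T m k \<dots> ((cups k 0 @ map (shift k) F) @ [] @ map (shift k) G @ caps m k)"
  proof (rule eqv_context[OF eqv_nested_zigzag_left, of _ _ _ _ _ _ 0])
    show "tangle T m (cups k 0 @ map (shift k) F) (k + l + m + 0)"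
      using wf_widen[OF F', of m] by (auto simp: wf_append add.commute)
    show "tangle T (k + l + m + 0) (map (shift k) G @ caps m k) k"
      using wf_widen[OF G'(2), of m] by (auto simp: wf_append)
  qed simp
  finally show ?thesis by (simp add: turned_def TG_def T_def)
qed

text \<open>
  The added string is bent around outside all the others, and is straightened at the left of them.
\<close>

lemma turned_add_strand:
  assumes w: "tangle s k w l"
  shows "eqv (cross (Suc k) s) (Suc l) (Suc k) (turned (Suc k) (Suc l) w) (map (shift 1) (turned k l w))"
proof -
  define T where "T = cross (Suc k) s"
  define U where "U = cups k 1 @ map (shift (Suc k)) w"
  have w': "tangle T (Suc k + k) (map (shift (Suc k)) w) (Suc k + l)"
    by (rule wf_shift) (simp add: T_def w cross_twice del: funpow.simps)
  have U: "tangle T 1 U (Suc k + l)" using w' by (auto simp: U_def wf_append mult_2)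
  have "eqv T (l + 3) (Suc (k + l + l)) (U @ [Cap (Suc k + l)]) ([Cap 1] @ U)"
    using eqv_block[OF U, of "l + 2" "[Cap 0]" l] by (simp add: numeral_3_eq_3 mult_2)
  then have "eqv T (Suc l) (Suc k) ([Cup 0] @ (U @ [Cap (Suc k + l)]) @ caps l (Suc k)) ([Cup 0] @ ([Cap 1] @ U) @ caps l (Suc k))"
    by (rule eqv_context[of _ _ _ _ _ _ _ 0]) simp_all
  also have "[Cup 0] @ ([Cap 1] @ U) @ caps l (Suc k) = [] @ [Cup 0, Cap (Suc 0)] @ (U @ caps l (Suc k))" by simp
  also have "eqv T (Suc l) (Suc k) \<dots> ([] @ (U @ caps l (Suc k)))"
    by (rule eqv_zigzag_right) (use wf_widen[OF U, of l] in \<open>auto simp: wf_append\<close>)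
  finally show ?thesis
    by (simp add: turned_def T_def U_def cups_Suc caps_Suc o_def)
qed

lemma turned_Cap: "eqv s k (Suc (Suc k)) (turned (Suc (Suc k)) k [Cap k]) [Cup 0]"
proof -
  have "eqv s (Suc (Suc (Suc (Suc k)))) (Suc (Suc (3 * k))) (cups k 2 @ [Cap (2 + 2 * k)]) ([Cap 2] @ cups k 2)"
    using eqv_block[of s 2 "cups k 2" "2 + 2 * k" "k + 2" "[Cap 0]" k] by simp
  then have "eqv s k (k + 2) ([Cup 0, Cup 1] @ (cups k 2 @ [Cap (2 + 2 * k)]) @ caps k (k + 2)) ([Cup 0, Cup 1] @ ([Cap 2] @ cups k 2) @ caps k (k + 2))"
    by (rule eqv_context[of _ _ _ _ _ _ _ 0]) simp_all
  also have "[Cup 0, Cup 1] @ ([Cap 2] @ cups k 2) @ caps k (k + 2) = [Cup 0] @ [Cup 1, Cap (Suc 1)] @ (cups k 2 @ caps k (k + 2))"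
    by (simp add: numeral_2_eq_2)
  also have "eqv s k (k + 2) \<dots> ([Cup 0] @ (cups k 2 @ caps k (k + 2)))"
    by (rule eqv_zigzag_right) simp
  also have "eqv s k (k + 2) \<dots> ([Cup 0] @ [])"
    by (rule eqv_prefix[of _ _ _ "k + 2"]) (use eqv_nested_zigzag_right[of 2 k "k + 2" s] in \<open>simp_all add: add.commute\<close>)
  finally show ?thesis
    by (simp add: turned_def cups_Suc numeral_2_eq_2 mult_2)
qed

lemma turned_Cup: "eqv s (Suc (Suc k)) k (turned k (Suc (Suc k)) [Cup k]) [Cap 0]"
proof -
  have "cups k 0 @ [Cup (k + k)] @ caps (Suc (Suc k)) k = cups k 0 @ [Cup (k + k), Cap (Suc (k + k))] @ [Cap (k + k)] @ caps k k"
    by (simp add: caps_Suc)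
  also have "eqv s (Suc (Suc k)) k \<dots> (cups k 0 @ [Cap (k + k)] @ caps k k)"
    by (rule eqv_zigzag_right) simp
  also have "cups k 0 @ [Cap (k + k)] @ caps k k = (cups k 0 @ [Cap (k + k)]) @ caps k k" by simp
  also have "eqv s (Suc (Suc k)) k \<dots> (([Cap 0] @ cups k 0) @ caps k k)"
    by (rule eqv_suffix[of _ _ "k + k + k"])
      (use eqv_block[of s 0 "cups k 0" "2 * k" "k + 2" "[Cap 0]" k] in \<open>simp_all add: mult_2\<close>)
  also have "([Cap 0] @ cups k 0) @ caps k k = [Cap 0] @ (cups k 0 @ caps k k)" by simp
  also have "eqv s (Suc (Suc k)) k \<dots> ([Cap 0] @ [])"
    by (rule eqv_prefix[of _ _ _ k]) (use eqv_nested_zigzag_right[of 0 k k s] in simp_all)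
  finally show ?thesis by (simp add: turned_def)
qed

lemma eqv_Box_dl:
  assumes "x \<in> V k s" shows "eqv (cross k s) k k [Box 0 k (dl s k x)] (turned k k [Box 0 k x])"
proof -
  have "turned k k [Box 0 k x] = cups k 0 @ [Box k k x] @ caps k k" by (simp add: turned_def)
  then show ?thesis unfolding dl_def using tangle_turned[of s k "[Box 0 k x]" k] assms
    by (simp add: eqv_Box_act)
qed

lemma dl_act: "tangle s k w k \<Longrightarrow> dl s k (act P s k w) = act P (cross k s) k (turned k k w)"
proof -
  assume w: "tangle s k w k"
  have "eqv (cross k s) k k (turned k k [Box 0 k (act P s k w)]) (turned k k w)"
    by (intro turned_eqv eqv_Box_act[OF w order_refl])
  then show ?thesis by (auto dest: eqv_act simp: dl_def turned_def)
qed

lemma dl_0_box: "x \<in> V 0 s \<Longrightarrow> dl s 0 x = x"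
  by (simp add: dl_def act_identity)

lemma E_El: 
  assumes x: "x \<in> V (Suc (Suc k)) s"
  shows "E (opposite s) k (El s (Suc k) x) = El s k (E s (Suc k) x)"
proof -
  have "eqv (opposite s) k k ([Cup k] @ [Box 0 (Suc k) (El s (Suc k) x)] @ [Cap k]) ([Cup k] @ [Cup 0, Box 1 (Suc (Suc k)) x, Cap 0] @ [Cap k])"
    unfolding El_def by (rule eqv_expand_0) (use x in \<open>auto intro!: act_in\<close>)
  also have "eqv (opposite s) k k \<dots> ([Cup 0] @ map (shift 1) [Cup (Suc k), Box 0 (Suc (Suc k)) x, Cap (Suc k)] @ [Cap 0])"
    by (rule eqv_slides[where js = "[0, 3]"]) (use x in simp_all)
  also have "eqv (opposite s) k k \<dots> ([Cup 0] @ [Box 1 (Suc k) (E s (Suc k) x)] @ [Cap 0])"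
    unfolding E_def by (intro eqv_sym[OF eqv_expand_1]) (use x in \<open>auto intro!: act_in\<close>)
  finally show ?thesis unfolding El_def[of s k] E_def[of "opposite s"] by (auto dest: eqv_act)
qed

text \<open>
  The outermost of the strings that turn x around forms a zigzag with the string that is closed on
  the left.  Once straightened, this string closes x as in \<open>E\<close>, inside the other ones.
\<close>

lemma El_dl:
  assumes x: "x \<in> V (Suc k) s"
  shows "El (cross (Suc k) s) k (dl s (Suc k) x) = dl s k (E s k x)"
proof -
  define T where "T = cross (Suc k) s"
  have oT: "opposite T = cross k s" "cross k (opposite T) = s" "cross (Suc k) T = s"
    using cross_twice[of k s] cross_twice[of "Suc k" s] by (simp_all add: T_def)
  define W where "W = cups k 0 @ [Box k (Suc k) x] @ caps (Suc k) k"
  have W: "tangle (opposite T) (k + 2) W k" using x oT by (simp add: W_def)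
  have "eqv (opposite T) k k ([Cup 0] @ [Box 1 (Suc k) (act P T (Suc k) (cups (Suc k) 0 @ [Box (Suc k) (Suc k) x] @ caps (Suc k) (Suc k)))] @ [Cap 0])
      ([Cup 0] @ map (shift 1) (cups (Suc k) 0 @ [Box (Suc k) (Suc k) x] @ caps (Suc k) (Suc k)) @ [Cap 0])"
  proof (rule eqv_expand_1)
    show t: "tangle T (Suc k) (cups (Suc k) 0 @ [Box (Suc k) (Suc k) x] @ caps (Suc k) (Suc k)) (Suc k)"
      using x oT(3) by simp
    show "tangle (opposite T) k ([Cup 0] @ [Box 1 (Suc k) (act P T (Suc k) (cups (Suc k) 0 @ [Box (Suc k) (Suc k) x] @ caps (Suc k) (Suc k)))] @ [Cap 0]) k"
      using act_in[OF t] by simp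
  qed
  also have "[Cup 0] @ map (shift 1) (cups (Suc k) 0 @ [Box (Suc k) (Suc k) x] @ caps (Suc k) (Suc k)) @ [Cap 0] =
      [Cup 0, Cup 1] @ (map (shift 2) W @ [Cap 0])"
    by (simp add: W_def cups_Suc caps_Suc numeral_2_eq_2)
  also have "eqv (opposite T) k k \<dots> ([Cup 0, Cup 1] @ ([Cap 0] @ W))"
    by (rule eqv_prefix[of _ _ _ "Suc (Suc (Suc (Suc k)))"]) (use eqv_sym[OF eqv_block[of "opposite T" 2 "[Cap 0]" 0 "k + 2" W k]] W in \<open>simp_all add: numeral_2_eq_2\<close>)
  also have "[Cup 0, Cup 1] @ ([Cap 0] @ W) = [Cup 0] @ [Cup (Suc 0), Cap 0] @ W" by simp
  also have "eqv (opposite T) k k \<dots> ([Cup 0] @ W)"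
    by (rule eqv_zigzag_left) (use W in simp)
  also have "[Cup 0] @ W = ([Cup 0] @ cups k 0) @ [Box k (Suc k) x] @ caps (Suc k) k" by (simp add: W_def)
  also have "eqv (opposite T) k k \<dots> ((cups k 0 @ [Cup (2 * k)]) @ [Box k (Suc k) x] @ caps (Suc k) k)"
    by (rule eqv_suffix[of _ _ "3 * k + 2"])
      (use eqv_sym[OF eqv_block[of "opposite T" 0 "cups k 0" "2 * k" k "[Cup 0]" "k + 2"]] x oT in \<open>simp_all\<close>)
  finally have 1: "eqv (opposite T) k k ([Cup 0] @ [Box 1 (Suc k) (dl s (Suc k) x)] @ [Cap 0])
    ((cups k 0 @ [Cup (2 * k)]) @ [Box k (Suc k) x] @ caps (Suc k) k)"
    by (simp only: dl_def T_def)
  have "eqv (opposite T) k k (cups k 0 @ [Box k k (E s k x)] @ caps k k) (cups k 0 @ map (shift k) [Cup k, Box 0 (Suc k) x, Cap k] @ caps k k)"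
    using eqv_expand[of k "opposite T" k "[Cup k, Box 0 (Suc k) x, Cap k]" k "cups k 0" "caps k k" k] x oT E_in[OF x]
    by (simp add: E_def)
  then have "eqv (opposite T) k k ([Cup 0] @ [Box 1 (Suc k) (dl s (Suc k) x)] @ [Cap 0]) (cups k 0 @ [Box k k (E s k x)] @ caps k k)"
    using eqv_trans[OF 1 eqv_sym] by (simp add: caps_Suc mult_2)
  then show ?thesis unfolding El_def dl_def[of s k] T_def[symmetric] oT(1)[symmetric] by (auto dest: eqv_act)
qed

text \<open>
  Both sides are the same diagram, with n + 1 strings bent around at either end of x.
\<close>

lemma rotation_dl:
  assumes x: "x \<in> V n s" and n: "1 \<le> n"
  shows "rotation P (cross n s) n (dl s n x) = dl (opposite s) n (rotation P s n x)"
proof -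
  define T where "T = cross n s"
  have T: "cross n T = s" "cross n (opposite s) = opposite T" "cross n (opposite T) = opposite s" "cross (Suc n) (opposite T) = s"
    by (simp_all add: T_def cross_twice funpow_swap1)
  have "eqv (opposite T) n n ([Cup 0] @ [Box 1 n (act P T n (cups n 0 @ [Box n n x] @ caps n n))] @ [Cap n])
      ([Cup 0] @ map (shift 1) (cups n 0 @ [Box n n x] @ caps n n) @ [Cap n])"
    using eqv_expand[of 1 "opposite T" n "cups n 0 @ [Box n n x] @ caps n n" n "[Cup 0]" "[Cap n]" n]
      x T n dl_in[OF x] by (simp add: dl_def T_def[symmetric])
  also have "[Cup 0] @ map (shift 1) (cups n 0 @ [Box n n x] @ caps n n) @ [Cap n] = cups (Suc n) 0 @ [Box (Suc n) n x] @ caps (Suc n) n"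
    by (simp add: cups_Suc caps_Suc')
  also have "\<dots> = cups n 0 @ map (shift n) [Cup 0, Box 1 n x, Cap n] @ caps n n"
    by (simp add: cups_Suc' caps_Suc)
  finally have 1: "eqv (opposite T) n n ([Cup 0] @ [Box 1 n (dl s n x)] @ [Cap n]) (cups n 0 @ map (shift n) [Cup 0, Box 1 n x, Cap n] @ caps n n)"
    by (simp add: dl_def T_def)
  have "eqv (opposite T) n n (cups n 0 @ [Box n n (rotation P s n x)] @ caps n n) (cups n 0 @ map (shift n) [Cup 0, Box 1 n x, Cap n] @ caps n n)"
    using eqv_expand[of n "opposite T" n "[Cup 0, Box 1 n x, Cap n]" n "cups n 0" "caps n n" n] x T n rotation_in[OF x n]
    by (simp add: rotation_def)
  from eqv_act[OF eqv_trans[OF 1 eqv_sym[OF this]]] show ?thesis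
    unfolding rotation_def[of P T] dl_def[of "opposite s"] T_def[symmetric] T(2) by simp
qed

end

context subfactor_planar_algebra
begin

lemma Tr_E:
  assumes x: "x \<in> V (Suc k) s" shows "Tr P s k (E s k x) = Tr P s (Suc k) x"
proof -
  have "eqv s 0 0 (cups k 0 @ [Box 0 k (E s k x)] @ caps k 0) (cups k 0 @ [Cup k, Box 0 (Suc k) x, Cap k] @ caps k 0)"
    unfolding E_def by (rule eqv_expand_0) (use x in \<open>auto intro!: act_in\<close>)
  also have "cups k 0 @ [Cup k, Box 0 (Suc k) x, Cap k] @ caps k 0 = cups (Suc k) 0 @ [Box 0 (Suc k) x] @ caps (Suc k) 0"
    by (simp add: cups_Suc' caps_Suc)
  finally show ?thesis unfolding Tr_def by (metis eqv_act)
qed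

text \<open>
  Sphericality for boxes with several strings follows from the case of a single one, because the
  right and the left partial trace commute.
\<close>

lemma Tr_El:
  "x \<in> V (Suc k) s \<Longrightarrow> Tr P (opposite s) k (El s k x) = Tr P s (Suc k) x"
proof (induction k arbitrary: x)
  case 0
  have "El s 0 x \<in> V 0 (opposite s)" using El_in[OF 0] .
  then have "Tr P (opposite s) 0 (El s 0 x) = scalar P (opposite s) (El s 0 x)"
    by (simp add: Tr_def act_identity)
  also have "\<dots> = scalar P s (act P s 0 [Cup 0, Box 0 1 x, Cap 0])"
    using spherical[of x s] 0 by (simp add: El_def)
  also have "\<dots> = Tr P s (Suc 0) x" by (simp add: Tr_def cups_Suc caps_Suc)
  finally show ?case .
next
  case (Suc k)
  have "Tr P (opposite s) (Suc k) (El s (Suc k) x) = Tr P (opposite s) k (E (opposite s) k (El s (Suc k) x))"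
    using Tr_E El_in[OF Suc.prems] by simp
  also have "\<dots> = Tr P (opposite s) k (El s k (E s (Suc k) x))" using E_El[OF Suc.prems] by simp
  also have "\<dots> = Tr P s (Suc k) (E s (Suc k) x)" using Suc.IH E_in[OF Suc.prems] by simp
  also have "\<dots> = Tr P s (Suc (Suc k)) x" using Tr_E Suc.prems by simp
  finally show ?case .
qed

lemma Tr_dl: "x \<in> V k s \<Longrightarrow> Tr P (cross k s) k (dl s k x) = Tr P s k x"
proof (induction k arbitrary: x)
  case 0 then show ?case by (simp add: dl_0_box)
next
  case (Suc k)
  have "Tr P (cross (Suc k) s) (Suc k) (dl s (Suc k) x) = Tr P (opposite (cross (Suc k) s)) k (El (cross (Suc k) s) k (dl s (Suc k) x))"
    using Tr_El[OF dl_in[OF Suc.prems]] by simp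
  also have "\<dots> = Tr P (cross k s) k (dl s k (E s k x))" unfolding El_dl[OF Suc.prems] by simp
  also have "\<dots> = Tr P s (Suc k) x" using Suc.IH[OF E_in[OF Suc.prems]] Tr_E[OF Suc.prems] by simp
  finally show ?case .
qed

end

section \<open>Temperley-Lieb and Jones-Wenzl\<close>

text \<open>
  The quantum numbers as polynomials in the modulus; see \<open>qnum_eq_qreal\<close>.
\<close>

fun qreal :: "real \<Rightarrow> nat \<Rightarrow> real" where
  "qreal d 0 = 0"
| "qreal d (Suc 0) = 1"
| "qreal d (Suc (Suc k)) = d * qreal d (Suc k) - qreal d k"

context shaded_planar_algebra
begin

text \<open>
  The diagrams, with arbitrary labels, that have a local minimum at the top; these are the
  diagrams that are annihilated by what is uncuppable.
\<close>

definition J :: "shading \<Rightarrow> nat \<Rightarrow> 'v set" where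
  "J s k = span {act P s k (w @ [Cup j]) | w j. tangle s k w (k - 2) \<and> j + 2 \<le> k}"

lemma tangle_J: "tangle s k w (k - 2) \<Longrightarrow> j + 2 \<le> k \<Longrightarrow> tangle s k (w @ [Cup j]) k"
  by (auto simp: wf_append intro!: exI[of _ "k - 2"])

lemma J_gen_V: "{act P s k (w @ [Cup j]) | w j. tangle s k w (k - 2) \<and> j + 2 \<le> k} \<subseteq> V k s"
  using act_in tangle_J by blast

lemma J_V: "J s k \<subseteq> V k s"
  unfolding J_def by (intro span_minimal J_gen_V subspace_box_space)

lemma subspace_J: "subspace (J s k)"
  by (simp add: J_def)

lemma J_gen: "tangle s k w (k - 2) \<Longrightarrow> j + 2 \<le> k \<Longrightarrow> act P s k (w @ [Cup j]) \<in> J s k"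
  unfolding J_def by (rule span_base) blast

lemma J_induct:
  assumes "y \<in> J s k" "lin (V k s) f" "subspace T"
    and "\<And>w j. tangle s k w (k - 2) \<Longrightarrow> j + 2 \<le> k \<Longrightarrow> f (act P s k (w @ [Cup j])) \<in> T"
  shows "f y \<in> T"
  using lin_span[OF assms(2) J_gen_V assms(1)[unfolded J_def] _ assms(3)] assms(4) by blast

text \<open>
  Uncuppable elements: those that vanish when two neighbouring strings at the top, respectively at the
  bottom, are joined.
\<close>

definition topfree :: "shading \<Rightarrow> nat \<Rightarrow> 'v \<Rightarrow> bool" where
  "topfree s k x \<longleftrightarrow> x \<in> V k s \<and> (\<forall>j. j + 2 \<le> k \<longrightarrow> null s k (k - 2) [Box 0 k x, Cap j])"

definition botfree :: "shading \<Rightarrow> nat \<Rightarrow> 'v \<Rightarrow> bool" where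
  "botfree s k x \<longleftrightarrow> x \<in> V k s \<and> (\<forall>j. j + 2 \<le> k \<longrightarrow> null s (k - 2) k [Cup j, Box 0 k x])"

lemma botfree_mult_J: 
  assumes p: "botfree s k p" and y: "y \<in> J s k" shows "mul s k p y = 0"
proof -
  have pV: "p \<in> V k s" using p by (simp add: botfree_def)
  have "mul s k p y \<in> {0}"
  proof (rule J_induct[OF y lin_mult_right[OF pV]])
    show "subspace {0}" by (simp add: subspace_def)
    fix w j assume w: "tangle s k w (k - 2)" "j + 2 \<le> k"
    have "mul s k p (act P s k (w @ [Cup j])) = act P s k ((w @ [Cup j]) @ [Box 0 k p])"
      using act_append[OF tangle_J[OF w], of "[Box 0 k p]"] pV by (simp add: act_identity)
    also have "null s k k (w @ [Cup j, Box 0 k p])"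
      by (rule null_append_left[OF _ w(1)]) (use p w(2) in \<open>simp add: botfree_def\<close>)
    then have "act P s k ((w @ [Cup j]) @ [Box 0 k p]) = 0" by (simp add: null_diag)
    finally show "mul s k p (act P s k (w @ [Cup j])) \<in> {0}" by simp
  qed
  then show ?thesis by simp
qed

lemma J_widen: 
  assumes "y \<in> J s k" "k \<le> m" shows "act P s m [Box 0 k y] \<in> J s m"
proof (rule J_induct[OF assms(1) _ subspace_J])
  show "lin (V k s) (\<lambda>y. act P s m [Box 0 k y])"
    using lin_val[of s m "[]" 0 k "[]" m] assms(2) by (simp add: val_diag)
  fix w j assume w: "tangle s k w (k - 2)" "j + 2 \<le> k"
  have "act P s m [Box 0 k (act P s k (w @ [Cup j]))] = act P s m (w @ [Cup j])"
    by (rule eqv_act) (rule eqv_Box_act[OF tangle_J[OF w] assms(2)])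
  moreover have "tangle s m w (m - 2)"
    using wf_widen[OF w(1), of "m - k"] w(2) assms(2) by simp
  ultimately show "act P s m [Box 0 k (act P s k (w @ [Cup j]))] \<in> J s m"
    using J_gen[of s m w j] w(2) assms(2) by simp
qed

lemma J_shift: 
  assumes "y \<in> J s k" shows "act P (opposite s) (Suc k) [Box 1 k y] \<in> J (opposite s) (Suc k)"
proof (rule J_induct[OF assms(1) _ subspace_J])
  show "lin (V k s) (\<lambda>y. act P (opposite s) (Suc k) [Box 1 k y])"
    using lin_val[of "opposite s" "Suc k" "[]" 1 k "[]" "Suc k"] by (simp add: val_diag)
  fix w j assume w: "tangle s k w (k - 2)" "j + 2 \<le> k"
  have "act P (opposite s) (Suc k) [Box 1 k (act P s k (w @ [Cup j]))] = act P (opposite s) (Suc k) (map (shift 1) w @ [Cup (Suc j)])"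
    using eqv_act[OF eqv_glue_le[of 1 "opposite s" k "w @ [Cup j]" "Suc k"]] tangle_J[OF w] by simp
  moreover have "tangle (opposite s) (Suc k) (map (shift 1) w) (Suc k - 2)"
  proof -
    have "Suc (k - 2) = Suc k - 2" using w(2) by simp
    then show ?thesis using wf_shift[of "box_space P" 1 "opposite s" k w "k - 2"] w(1) by simp
  qed
  ultimately show "act P (opposite s) (Suc k) [Box 1 k (act P s k (w @ [Cup j]))] \<in> J (opposite s) (Suc k)"
    using J_gen[of "opposite s" "Suc k" "map (shift 1) w" "Suc j"] w(2) by simp
qed

lemma J_mult: 
  assumes "y \<in> J s k" "z \<in> V k s" shows "mul s k y z \<in> J s k"
proof (rule J_induct[OF assms(1) lin_mult_left[OF assms(2)] subspace_J])
  fix w j assume w: "tangle s k w (k - 2)" "j + 2 \<le> k"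
  have "mul s k (act P s k (w @ [Cup j])) z = act P s k (([Box 0 k z] @ w) @ [Cup j])"
    using act_append[OF _ tangle_J[OF w], of "[Box 0 k z]"] assms(2) by (simp add: act_identity)
  then show "mul s k (act P s k (w @ [Cup j])) z \<in> J s k"
    using J_gen[of s k "[Box 0 k z] @ w" j] w assms(2) by simp
qed

lemma one_widen: "k \<le> m \<Longrightarrow> act P s m [Box 0 k (one s k)] = one s m"
  using eqv_act[OF eqv_Box_act[of s k "[]" m]] by simp

lemma one_shift: "act P (opposite s) (Suc k) [Box 1 k (one s k)] = one (opposite s) (Suc k)"
  using eqv_act[OF eqv_glue_le[of 1 "opposite s" k "[]" "Suc k"]] by simp

lemma one_J_widen: "one s k \<in> J s k \<Longrightarrow> k \<le> m \<Longrightarrow> one s m \<in> J s m"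
  using J_widen one_widen by metis

lemma val_scale_context:
  assumes w: "tangle s m w l" "tangle s m w' l" "val s m l w = sm c (val s m l w')"
    and u: "tangle s k u m" and v: "tangle s l v k'"
  shows "val s k k' (u @ w @ v) = sm c (val s k k' (u @ w' @ v))"
proof -
  define M where "M = (m + l) div 2"
  define x where "x = val s m l w'"
  have x: "x \<in> V M s" unfolding x_def M_def by (rule val_in[OF w(2)])
  have dr: "u @ draw m l y @ v = (u @ cups (M - m) m) @ [Box 0 M y] @ (caps (M - l) l @ v)" for y
    by (simp add: draw_def M_def Let_def)
  have d: "eqv s k k' (u @ w @ v) (u @ draw m l (sm c x) @ v)" "eqv s k k' (u @ w' @ v) (u @ draw m l x @ v)"
    using eqv_prefix[OF u eqv_suffix[OF eqv_draw[of 0 s m w l 0, simplified, OF w(1)] v]]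
      eqv_prefix[OF u eqv_suffix[OF eqv_draw[of 0 s m w' l 0, simplified, OF w(2)] v]] w(3)
    by (simp_all add: x_def)
  have "tangle s k ((u @ cups (M - m) m) @ [Box 0 M 0] @ (caps (M - l) l @ v)) k'"
    using eqv_tangle(2)[OF d(2)] unfolding dr by (rule wf_Box_change) simp
  then have "val s k k' (u @ draw m l (sm c x) @ v) = sm c (val s k k' (u @ draw m l x @ v))"
    unfolding dr using lin_scale[OF lin_val] x by fastforce
  then show ?thesis using eqv_val[OF d(1)] eqv_val[OF d(2)] by simp
qed

lemma wf_mono:
  "wf_diagram W s m w l \<Longrightarrow> (\<And>k t. W k t \<subseteq> W' k t) \<Longrightarrow> wf_diagram W' s m w l"
proof (induction w arbitrary: m)
  case (Cons a w) then show ?case by (cases a) (auto simp: subset_iff)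
qed simp

end

context subfactor_planar_algebra
begin

lemma val_loop:
  assumes t: "tangle s m (u @ [Cup i, Cap i] @ v) l"
  shows "val s m l (u @ [Cup i, Cap i] @ v) = sm (complex_of_real d) (val s m l (u @ v))"
proof -
  define S where "S = cross i s"
  obtain a b where ab: "tangle s m u a" "tangle s a [Cup i, Cap i] b" "tangle s b v l"
    using t by (auto simp: wf_append)
  then have i: "i \<le> a" "b = a" by auto
  have uv: "tangle s m (u @ [Box i 0 x] @ v) l" if "x \<in> V 0 S" for x
    using ab i that by (auto simp: wf_append S_def)
  have "eqv s a a [Box i 0 (act P S 0 [Cup 0, Cap 0])] [Cup i, Cap i]"
    using eqv_glue_le[of i s 0 "[Cup 0, Cap 0]" a] i by (simp add: S_def)
  then have "val s m l (u @ [Cup i, Cap i] @ v) = val s m l (u @ [Box i 0 (sm (complex_of_real d) (one S 0))] @ v)"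
    using eqv_val[OF eqv_context[of s a a _ _ m u 0 v l]] ab i loop by (metis add_0_right)
  also have "\<dots> = sm (complex_of_real d) (val s m l (u @ [Box i 0 (one S 0)] @ v))"
    using lin_scale[OF lin_val[OF uv[of 0]], of "one S 0" "complex_of_real d"] by (simp add: S_def)
  also have "eqv s a a [Box i 0 (one S 0)] []"
    using eqv_glue_le[of i s 0 "[]" a] i by (simp add: S_def)
  then have "val s m l (u @ [Box i 0 (one S 0)] @ v) = val s m l (u @ [] @ v)"
    using eqv_val[OF eqv_context[of s a a _ _ m u 0 v l]] ab i by (metis add_0_right)
  finally show ?thesis by simp
qed

lemma cap_through_cups:
  "tangle s m (map Cup js @ [Cap i]) l \<Longrightarrow>
    \<exists>c ks' js'. tangle s m (map Cap ks' @ map Cup js') l \<and>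
      val s m l (map Cup js @ [Cap i]) = sm c (val s m l (map Cap ks' @ map Cup js'))"
proof (induction js arbitrary: i l rule: rev_induct)
  case Nil
  then show ?case by (intro exI[of _ 1] exI[of _ "[i]"] exI[of _ "[]"]) simp
next
  case (snoc j js)
  define w :: "'v diagram" where "w = map Cup js"
  have t: "tangle s m (w @ [Cup j, Cap i] @ []) l" using snoc.prems by (simp add: w_def)
  obtain a where a: "tangle s m w a" "tangle s a [Cup j, Cap i] l" using t by (auto simp: wf_append)
  have la: "l = a" using a(2) by simp
  consider "i = j" | "i = Suc j" | "j = Suc i" | "j + 2 \<le> i" | "i + 2 \<le> j" by linarith
  then show ?case
  proof cases
    case 1
    then show ?thesis using val_loop[of s m w i "[]" l] t a(1) la
      by (intro exI[of _ "complex_of_real d"] exI[of _ "[]"] exI[of _ js]) (simp add: w_def)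
  next
    case 2
    then show ?thesis using eqv_val[OF eqv_zigzag_right[of s m w j "[]" l]] t a(1) la
      by (intro exI[of _ 1] exI[of _ "[]"] exI[of _ js]) (simp add: w_def)
  next
    case 3
    then show ?thesis using eqv_val[OF eqv_zigzag_left[of s m w i "[]" l]] t a(1) la
      by (intro exI[of _ 1] exI[of _ "[]"] exI[of _ js]) (simp add: w_def)
  next
    case 4
    have e: "eqv s m l (w @ [Cup j, Cap i] @ []) (w @ [Cap (i - 2), Cup j] @ [])"
      using eqv_swap_right[OF t] 4 by simp
    then obtain b where b: "tangle s m (w @ [Cap (i - 2)]) b" "tangle s b [Cup j] l"
      using eqv_tangle(2)[OF e] by (auto simp: wf_append)
    obtain c ks' js' where c: "tangle s m (map Cap ks' @ map Cup js') b"
      "val s m b (w @ [Cap (i - 2)]) = sm c (val s m b (map Cap ks' @ map Cup js'))"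
      using snoc.IH[of "i - 2" b] b(1) unfolding w_def by blast
    have "val s m l (w @ [Cup j, Cap i]) = val s m l ([] @ (w @ [Cap (i - 2)]) @ [Cup j])" using eqv_val[OF e] by simp
    also have "\<dots> = sm c (val s m l ([] @ (map Cap ks' @ map Cup js') @ [Cup j]))"
      by (rule val_scale_context[OF b(1) c _ b(2)]) simp
    finally show ?thesis using c(1) b(2)
      by (intro exI[of _ c] exI[of _ ks'] exI[of _ "js' @ [j]"]) (auto simp: w_def wf_append)
  next
    case 5
    have e: "eqv s m l (w @ [Cup j, Cap i] @ []) (w @ [Cap i, Cup (j - 2)] @ [])"
      using eqv_swap_left[OF t] 5 by simp
    then obtain b where b: "tangle s m (w @ [Cap i]) b" "tangle s b [Cup (j - 2)] l"
      using eqv_tangle(2)[OF e] by (auto simp: wf_append)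
    obtain c ks' js' where c: "tangle s m (map Cap ks' @ map Cup js') b"
      "val s m b (w @ [Cap i]) = sm c (val s m b (map Cap ks' @ map Cup js'))"
      using snoc.IH[of "i" b] b(1) unfolding w_def by blast
    have "val s m l (w @ [Cup j, Cap i]) = val s m l ([] @ (w @ [Cap i]) @ [Cup (j - 2)])" using eqv_val[OF e] by simp
    also have "\<dots> = sm c (val s m l ([] @ (map Cap ks' @ map Cup js') @ [Cup (j - 2)]))"
      by (rule val_scale_context[OF b(1) c _ b(2)]) simp
    finally show ?thesis using c(1) b(2)
      by (intro exI[of _ c] exI[of _ ks'] exI[of _ "js' @ [j - 2]"]) (auto simp: w_def wf_append)
  qed
qed

text \<open>
  In diagrams without input discs all maxima can be moved below all minima, where every loop that
  comes up is replaced by the factor d.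
\<close>

lemma boxfree_normal_form:
  "wf_diagram (\<lambda>_ _. {}) s m w l \<Longrightarrow>
    \<exists>c ks js. tangle s m (map Cap ks @ map Cup js) l \<and>
      val s m l w = sm c (val s m l (map Cap ks @ map Cup js))"
proof (induction w arbitrary: l rule: rev_induct)
  case Nil
  then show ?case by (intro exI[of _ 1] exI[of _ "[]"]) simp
next
  case (snoc a w)
  obtain b where b: "wf_diagram (\<lambda>_ _. {}) s m w b" "wf_diagram (\<lambda>_ _. {}) s b [a] l"
    using snoc.prems by (auto simp: wf_append)
  have bt: "tangle s m w b" "tangle s b [a] l" using b wf_mono by blast+
  obtain c ks js where c: "tangle s m (map Cap ks @ map Cup js) b"
    "val s m b w = sm c (val s m b (map Cap ks @ map Cup js))" using snoc.IH[OF b(1)] by blast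
  have v: "val s m l (w @ [a]) = sm c (val s m l (map Cap ks @ map Cup js @ [a]))"
    using val_scale_context[OF bt(1) c, of m "[]" "[a]" l] bt(2) by simp
  show ?case
  proof (cases a)
    case (Cup j)
    then show ?thesis using v c(1) bt(2)
      by (intro exI[of _ c] exI[of _ ks] exI[of _ "js @ [j]"]) (auto simp: wf_append)
  next
    case (Cap i)
    obtain e where e: "tangle s m (map Cap ks) e" "tangle s e (map Cup js) b" using c(1) by (auto simp: wf_append)
    have te: "tangle s e (map Cup js @ [Cap i]) l" using e(2) bt(2) Cap unfolding wf_append by blast
    obtain c' ks' js' where c': "tangle s e (map Cap ks' @ map Cup js') l"
      "val s e l (map Cup js @ [Cap i]) = sm c' (val s e l (map Cap ks' @ map Cup js'))"
      using cap_through_cups[OF te] by blast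
    have "val s m l (map Cap ks @ (map Cup js @ [Cap i]) @ []) = sm c' (val s m l (map Cap ks @ (map Cap ks' @ map Cup js') @ []))"
      by (rule val_scale_context[OF te c' e(1)]) simp
    then show ?thesis using v Cap c'(1) e(1)
      by (intro exI[of _ "c * c'"] exI[of _ "ks @ ks'"] exI[of _ js']) (auto simp: wf_append)
  next
    case (Box i k x)
    then show ?thesis using b(2) by simp
  qed
qed

lemma tangle_Caps: "tangle s m (map Cap ks) l \<Longrightarrow> m = l + 2 * length ks"
  by (induction ks arbitrary: m) fastforce+

lemma subspace_one_J: "subspace {x \<in> V k s. \<exists>c. x - sm c (one s k) \<in> J s k}"
  unfolding subspace_def
proof (intro conjI ballI allI)
  show "0 \<in> {x \<in> V k s. \<exists>c. x - sm c (one s k) \<in> J s k}"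
    using subspace_0[OF subspace_J] by (auto intro!: exI[of _ 0])
  fix x y assume "x \<in> {x \<in> V k s. \<exists>c. x - sm c (one s k) \<in> J s k}"
  then obtain c where x: "x \<in> V k s" "x - sm c (one s k) \<in> J s k" by blast
  {
    fix a
    have "sm a x - sm (a * c) (one s k) \<in> J s k"
      using subspace_scale[OF subspace_J x(2), of a] by (simp add: scale_right_diff_distrib)
    then show "sm a x \<in> {x \<in> V k s. \<exists>c. x - sm c (one s k) \<in> J s k}" using x(1) by (auto simp: V_scale)
  }
  assume "y \<in> {x \<in> V k s. \<exists>c. x - sm c (one s k) \<in> J s k}"
  then obtain c' where y: "y \<in> V k s" "y - sm c' (one s k) \<in> J s k" by blast
  have "(x + y) - sm (c + c') (one s k) \<in> J s k"
    using subspace_add[OF subspace_J x(2) y(2)] by (simp add: scale_left_distrib algebra_simps)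
  then show "x + y \<in> {x \<in> V k s. \<exists>c. x - sm c (one s k) \<in> J s k}" using x(1) y(1) V_add by blast
qed

lemma TL_gen_V: "{act P s k w | w. wf_diagram (\<lambda>_ _. {}) s k w k} \<subseteq> V k s"
  using act_in wf_mono by blast

lemma TL_V: "TL P k s \<subseteq> V k s"
  unfolding TL_def by (intro span_minimal TL_gen_V subspace_box_space)

lemma TL_one_J:
  assumes "x \<in> TL P k s" shows "\<exists>c. x - sm c (one s k) \<in> J s k"
proof -
  have "TL P k s \<subseteq> {x \<in> V k s. \<exists>c. x - sm c (one s k) \<in> J s k}"
    unfolding TL_def
  proof (intro span_minimal subspace_one_J subsetI)
    fix y assume "y \<in> {act P s k w | w. wf_diagram (\<lambda>_ _. {}) s k w k}"
    then obtain w where w: "wf_diagram (\<lambda>_ _. {}) s k w k" "y = act P s k w" by blast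
    obtain c ks js where c: "tangle s k (map Cap ks @ map Cup js) k"
      "act P s k w = sm c (act P s k (map Cap ks @ map Cup js))"
      using boxfree_normal_form[OF w(1)] by (auto simp: val_diag)
    have "\<exists>c. y - sm c (one s k) \<in> J s k"
    proof (cases js rule: rev_cases)
      case Nil
      then have "ks = []" using c(1) tangle_Caps by fastforce
      then show ?thesis using Nil c(2) w(2) subspace_0[OF subspace_J] by (intro exI[of _ c]) simp
    next
      case (snoc js' j)
      then have "tangle s k ((map Cap ks @ map Cup js') @ [Cup j]) k" using c(1) by simp
      then have "tangle s k (map Cap ks @ map Cup js') (k - 2)" "j + 2 \<le> k"
        unfolding wf_append[of _ _ _ _ "[Cup j]"] by auto
      then have "sm c (act P s k ((map Cap ks @ map Cup js') @ [Cup j])) \<in> J s k"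
        by (intro subspace_scale[OF subspace_J] J_gen)
      then show ?thesis using snoc c(2) w(2) by (intro exI[of _ 0]) simp
    qed
    then show "y \<in> {x \<in> V k s. \<exists>c. x - sm c (one s k) \<in> J s k}"
      using w act_in wf_mono by blast
  qed
  then show ?thesis using assms by blast
qed

lemma rotation_act:
  assumes "tangle s k w k" "1 \<le> k"
  shows "rotation P s k (act P s k w) = act P (opposite s) k ([Cup 0] @ map (shift 1) w @ [Cap k])"
  unfolding rotation_def
  using eqv_act[OF eqv_expand_1[OF assms(1), of k "[Cup 0]" "[Cap k]" k]] act_in[OF assms(1)] assms(2) by simp

lemma rotation_TL: "x \<in> TL P k s \<Longrightarrow> 1 \<le> k \<Longrightarrow> rotation P s k x \<in> TL P k (opposite s)"
proof -
  assume x: "x \<in> TL P k s" and k: "1 \<le> k"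
  show ?thesis
  proof (rule lin_span[OF lin_rotation[OF k] TL_gen_V x[unfolded TL_def]])
    show "subspace (TL P k (opposite s))" by (simp add: TL_def)
    fix b assume "b \<in> {act P s k w | w. wf_diagram (\<lambda>_ _. {}) s k w k}"
    then obtain w where w: "wf_diagram (\<lambda>_ _. {}) s k w k" "b = act P s k w" by blast
    have "wf_diagram (\<lambda>_ _. {}) (opposite s) (1 + k + 1) (map (shift 1) w) (1 + k + 1)"
      by (rule wf_shift_widen) (use w in simp)
    then have "wf_diagram (\<lambda>_ _. {}) (opposite s) k ([Cup 0] @ map (shift 1) w @ [Cap k]) k"
      using k by (auto simp: wf_append)
    moreover have "tangle s k w k" using w(1) wf_mono by blast
    ultimately show "rotation P s k b \<in> TL P k (opposite s)"
      unfolding w(2) TL_def using rotation_act[of s k w] k by (intro span_base) auto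
  qed
qed

text \<open>
  The inverse of the rotation is the rotation in the other direction.
\<close>

lemma rotation_surj:
  assumes y: "y \<in> V k s" and k: "1 \<le> k"
  shows "\<exists>x \<in> V k (opposite s). rotation P (opposite s) k x = y"
proof
  define w where "w = [Cup k, Box 1 k y, Cap 0]"
  have w: "tangle (opposite s) k w k" using y by (simp add: w_def)
  show "act P (opposite s) k w \<in> V k (opposite s)" using act_in[OF w] .
  have "eqv s k k ([Cup 0] @ map (shift 1) w @ [Cap k]) [Box 0 k y]"
    by (rule eqv_slides[where js = "[3, 2, 1, 0, 1]"]) (use y k in \<open>simp_all add: w_def\<close>)
  then show "rotation P (opposite s) k (act P (opposite s) k w) = y"
    using rotation_act[OF w k] y by (auto simp: act_identity dest: eqv_act)
qed

text \<open>
  Supertransitivity is a condition on only one shading; the rotation carries it over to the other one.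
  A Temperley-Lieb diagram in normal form is either the identity or ends with a minimum.
\<close>

lemma supertransitive_one_J:
  assumes st: "supertransitive P m" and k: "k \<le> m" and x: "x \<in> V k s"
  shows "\<exists>c. x - sm c (one s k) \<in> J s k"
proof (cases "k = 0")
  case True
  then have "x = sm (scalar P s x) (one s k)" using V0_eq x by blast
  then show ?thesis using subspace_0[OF subspace_J] by (metis cancel_comm_monoid_add_class.diff_cancel)
next
  case False
  have TL: "V k Plus = TL P k Plus" using st k by (simp add: supertransitive_def)
  have "x \<in> TL P k s"
  proof (cases s)
    case Plus then show ?thesis using TL x by simp
  next
    case Minus
    then obtain y where "y \<in> V k Plus" "x = rotation P Plus k y"
      using rotation_surj[of x k Minus] x False by fastforce
    then show ?thesis using rotation_TL[of y k Plus] TL Minus False by simp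
  qed
  then show ?thesis by (rule TL_one_J)
qed

text \<open>
  These two properties determine the Jones-Wenzl projection f.  The minima in
  \<open>J\<close> may be attached to diagrams with arbitrary labels, not only to Temperley-Lieb diagrams.
\<close>

definition JW :: "shading \<Rightarrow> nat \<Rightarrow> 'v \<Rightarrow> bool" where
  "JW s k f \<longleftrightarrow> topfree s k f \<and> one s k - f \<in> J s k"

lemma topfree_star: "topfree s k x \<Longrightarrow> botfree s k (star P x)"
  unfolding topfree_def botfree_def using star_in null_reflect[of s k "k - 2" "[Box 0 k x, Cap _]"] by auto

lemma botfree_star: "botfree s k x \<Longrightarrow> topfree s k (star P x)"
  unfolding topfree_def botfree_def using star_in null_reflect[of s "k - 2" k "[Cup _, Box 0 k x]"] by auto

lemma topfree_V: "topfree s k x \<Longrightarrow> x \<in> V k s" and botfree_V: "botfree s k x \<Longrightarrow> x \<in> V k s"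
  by (simp_all add: topfree_def botfree_def)

lemma JW_V: "JW s k f \<Longrightarrow> f \<in> V k s"
  by (simp add: JW_def topfree_V)

lemma botfree_mult_JW:
  assumes "botfree s k p" "JW s k f" shows "mul s k p f = p"
proof -
  have "mul s k p (one s k - f) = 0" using assms by (intro botfree_mult_J) (auto simp: JW_def)
  then show ?thesis using botfree_V[OF assms(1)] JW_V[OF assms(2)] by (simp add: mult_simps mult_one)
qed

lemma JW_star: assumes "JW s k f" shows "star P f = f"
proof -
  note f = JW_V[OF assms] note fs = star_in[OF f]
  have "mul s k (star P f) f = star P f"
    by (rule botfree_mult_JW[OF topfree_star assms]) (use assms in \<open>simp add: JW_def\<close>)
  moreover from this have "star P (star P f) = mul s k (star P f) (star P (star P f))"
    using star_mult[OF fs f] by simp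
  ultimately show ?thesis using star_star[OF f] by simp
qed

lemma JW_botfree: "JW s k f \<Longrightarrow> botfree s k f"
  using topfree_star[of s k f] JW_star[of s k f] by (simp add: JW_def)

lemma JW_idem: "JW s k f \<Longrightarrow> mul s k f f = f"
  using botfree_mult_JW JW_botfree by blast

lemma JW_mult_topfree:
  assumes "topfree s k p" "JW s k f" shows "mul s k f p = p"
proof -
  have p: "p \<in> V k s" using assms(1) topfree_V by blast
  have "mul s k (star P p) f = star P p" by (rule botfree_mult_JW[OF topfree_star[OF assms(1)] assms(2)])
  then have "star P (mul s k (star P p) f) = star P (star P p)" by simp
  then show ?thesis using star_mult[OF star_in[OF p] JW_V[OF assms(2)]] star_star[OF p] JW_star[OF assms(2)] by simp
qed

lemma JW_mult_one_J:
  assumes "JW s k f" "x \<in> V k s" "x - sm c (one s k) \<in> J s k" shows "mul s k f x = sm c f"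
proof -
  note f = JW_V[OF assms(1)]
  have "mul s k f (x - sm c (one s k)) = 0" by (rule botfree_mult_J[OF JW_botfree[OF assms(1)] assms(3)])
  then show ?thesis using f assms(2) by (simp add: mult_simps V_scale mult_one)
qed

text \<open>
  The difference of the identity and f lies in \<open>J\<close>, and stays there when strings are
  added on either side; so it is annihilated by p.
\<close>

lemma botfree_absorb:
  assumes p: "botfree s m p" and f: "JW s k f" and km: "k \<le> m"
  shows "eqv s m m [Box 0 k f, Box 0 m p] [Box 0 m p]"
proof -
  note pV = botfree_V[OF p] and fV = JW_V[OF f]
  have lin: "lin (V k s) (\<lambda>x. act P s m [Box 0 k x])"
    using lin_val[of s m "[]" 0 k "[]" m] km by (simp add: val_diag)
  have "mul s m p (act P s m [Box 0 k (one s k - f)]) = 0"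
    by (rule botfree_mult_J[OF p J_widen[OF _ km]]) (use f in \<open>simp add: JW_def\<close>)
  then have "mul s m p (one s m - act P s m [Box 0 k f]) = 0"
    using lin_diff[OF lin, of "one s k" f] fV one_widen[OF km] by simp
  moreover have "act P s m [Box 0 k f] \<in> V m s" by (rule act_in) (use fV km in simp)
  ultimately have "mul s m p (act P s m [Box 0 k f]) = p" using pV by (simp add: mult_simps mult_one)
  then show ?thesis using act_append[of s m "[Box 0 k f]" "[Box 0 m p]"] pV fV km
    by (intro val_eqv) (simp_all add: act_identity val_diag)
qed

lemma botfree_absorb_shift:
  assumes p: "botfree (opposite s) (Suc k) p" and f: "JW s k f"
  shows "eqv (opposite s) (Suc k) (Suc k) [Box 1 k f, Box 0 (Suc k) p] [Box 0 (Suc k) p]"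
proof -
  note pV = botfree_V[OF p] and fV = JW_V[OF f]
  have lin: "lin (V k s) (\<lambda>x. act P (opposite s) (Suc k) [Box 1 k x])"
    using lin_val[of "opposite s" "Suc k" "[]" 1 k "[]" "Suc k"] by (simp add: val_diag)
  have "mul (opposite s) (Suc k) p (act P (opposite s) (Suc k) [Box 1 k (one s k - f)]) = 0"
    by (rule botfree_mult_J[OF p J_shift]) (use f in \<open>simp add: JW_def\<close>)
  then have "mul (opposite s) (Suc k) p (one (opposite s) (Suc k) - act P (opposite s) (Suc k) [Box 1 k f]) = 0"
    using lin_diff[OF lin, of "one s k" f] fV one_shift by simp
  moreover have "act P (opposite s) (Suc k) [Box 1 k f] \<in> V (Suc k) (opposite s)" by (rule act_in) (use fV in simp)
  ultimately have "mul (opposite s) (Suc k) p (act P (opposite s) (Suc k) [Box 1 k f]) = p" using pV by (simp add: mult_simps mult_one)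
  then show ?thesis using act_append[of "opposite s" "Suc k" "[Box 1 k f]" "[Box 0 (Suc k) p]"] pV fV
    by (intro val_eqv) (simp_all add: act_identity val_diag)
qed

lemma topfree_absorb:
  assumes p: "topfree s m p" and f: "JW s k f" and km: "k \<le> m"
  shows "eqv s m m [Box 0 m p, Box 0 k f] [Box 0 m p]"
  using eqv_reflect[OF botfree_absorb[OF topfree_star[OF p] f km]] star_star[OF topfree_V[OF p]] JW_star[OF f] by simp

text \<open>The Jones-Wenzl projections, defined by Wenzl's recursion.\<close>

primrec jw :: "shading \<Rightarrow> nat \<Rightarrow> 'v" where
  "jw s 0 = one s 0"
| "jw s (Suc k) = (if k = 0 then one s (Suc k) else act P s (Suc k) [Box 0 k (jw s k)]
     - sm (complex_of_real (qreal d k / qreal d (Suc k)))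
         (act P s (Suc k) [Box 0 k (jw s k), Cap (k - 1), Cup (k - 1), Box 0 k (jw s k)]))"

text \<open>
  Wenzl's argument, without the assumption that f is a Jones-Wenzl projection: it is applied
  to these and to the projection p at depth n.  A cap on the last two strings
  turns the second f of the correction term into its partial trace a f', which is absorbed by
  the first one.
\<close>

lemma wenzl_topfree:
  assumes f: "topfree s (Suc k) f" and f': "JW s k f'"
    and E: "E s k f = sm (complex_of_real a) f'" and a: "a \<noteq> 0"
  shows "topfree s (Suc (Suc k)) (act P s (Suc (Suc k)) [Box 0 (Suc k) f]
     - sm (complex_of_real (1 / a)) (act P s (Suc (Suc k)) [Box 0 (Suc k) f, Cap k, Cup k, Box 0 (Suc k) f]))"
    (is "topfree _ _ ?g")
proof -
  define g where "g = ?g"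
  define m where "m = Suc (Suc k)"
  define A where "A = act P s m [Box 0 (Suc k) f]"
  define B where "B = act P s m [Box 0 (Suc k) f, Cap k, Cup k, Box 0 (Suc k) f]"
  define c where "c = complex_of_real (1 / a)"
  have g: "g = A - sm c B" by (simp add: g_def A_def B_def c_def m_def)
  note fV = topfree_V[OF f] and f'V = JW_V[OF f']
  have tA: "tangle s m [Box 0 (Suc k) f] m" using fV by (simp add: m_def)
  have tB: "tangle s m [Box 0 (Suc k) f, Cap k, Cup k, Box 0 (Suc k) f] m" using fV by (simp add: m_def)
  have AV: "A \<in> V m s" and BV: "B \<in> V m s" unfolding A_def B_def using act_in tA tB by auto
  have gV: "g \<in> V m s" unfolding g using AV BV by (simp add: V_diff V_scale)
  have eA: "eqv s m m [Box 0 m A] [Box 0 (Suc k) f]" unfolding A_def by (rule eqv_Box_act[OF tA order_refl])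
  have eB: "eqv s m m [Box 0 m B] [Box 0 (Suc k) f, Cap k, Cup k, Box 0 (Suc k) f]" unfolding B_def by (rule eqv_Box_act[OF tB order_refl])
  have ftop: "null s (Suc k) (k - 1) [Box 0 (Suc k) f, Cap j]" if "j + 2 \<le> Suc k" for j
    using f that by (auto simp: topfree_def)
  have "topfree s m g"
    unfolding topfree_def
  proof (intro conjI allI impI gV)
    fix j assume j: "j + 2 \<le> m"
    have lin: "lin (V m s) (\<lambda>x. val s m k ([] @ [Box 0 m x] @ [Cap j]))"
      using lin_val[of s m "[]" 0 m "[Cap j]" k] j by (simp add: m_def)
    have tC: "tangle s m [Cap j] k" using j by (simp add: m_def)
    have vg: "val s m k [Box 0 m g, Cap j] = val s m k [Box 0 m A, Cap j] - sm c (val s m k [Box 0 m B, Cap j])"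
      using lin_diff[OF lin AV, of "sm c B"] lin_scale[OF lin BV, of c] BV by (simp add: g V_scale)
    have vA: "val s m k [Box 0 m A, Cap j] = val s m k [Box 0 (Suc k) f, Cap j]"
      using eqv_val[OF eqv_suffix[OF eA tC]] by simp
    have vB: "val s m k [Box 0 m B, Cap j] = val s m k [Box 0 (Suc k) f, Cap k, Cup k, Box 0 (Suc k) f, Cap j]"
      using eqv_val[OF eqv_suffix[OF eB tC]] by simp
    have "val s m k [Box 0 m g, Cap j] = 0"
    proof (cases "j = k")
      case False
      then have j': "j + 2 \<le> Suc k" using j by (simp add: m_def)
      have n: "null s m k [Box 0 (Suc k) f, Cap j]"
        using null_context_0[OF ftop[OF j'], of m "[]" 1 "[]" k] j' by (simp add: m_def)
      moreover have "null s m k ([Box 0 (Suc k) f, Cap k, Cup k] @ [Box 0 (Suc k) f, Cap j])"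
        by (rule null_append_left[OF n]) (use fV in \<open>simp add: m_def\<close>)
      ultimately show ?thesis using vg vA vB by (simp add: null_def)
    next
      case True
      have "eqv s m k ([Box 0 (Suc k) f, Cap k] @ [Cup k, Box 0 (Suc k) f, Cap k]) ([Box 0 (Suc k) f, Cap k] @ [Box 0 k (E s k f)])"
        by (rule eqv_prefix[of _ _ _ k]) (use eqv_sym[OF eqv_Box_act[of s k "[Cup k, Box 0 (Suc k) f, Cap k]" k]] fV in \<open>simp_all add: m_def E_def\<close>)
      then have 1: "val s m k [Box 0 m B, Cap j] = val s m k ([Box 0 (Suc k) f, Cap k] @ [Box 0 k (E s k f)] @ [])"
        using vB True by (auto dest: eqv_val)
      have lin2: "lin (V k s) (\<lambda>x. val s m k ([Box 0 (Suc k) f, Cap k] @ [Box 0 k x] @ []))"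
        using lin_val[of s m "[Box 0 (Suc k) f, Cap k]" 0 k "[]" k] fV by (simp add: m_def)
      have 2: "val s m k [Box 0 m B, Cap j] = sm (complex_of_real a) (val s m k ([Box 0 (Suc k) f] @ [Cap k, Box 0 k f'] @ []))"
        unfolding 1 E using lin_scale[OF lin2 f'V] by simp
      have "eqv s m k ([Box 0 (Suc k) f] @ [Cap k, Box 0 k f'] @ []) ([Box 0 (Suc k) f, Box 0 k f'] @ [Cap k])"
        by (rule eqv_slides[where js = "[1]"]) (use fV f'V in \<open>simp_all add: m_def\<close>)
      also have "eqv s m k \<dots> ([Box 0 (Suc k) f] @ [Cap k])"
        by (rule eqv_suffix[of _ _ m]) (use eqv_widen[OF topfree_absorb[OF f f'], of 1] in \<open>simp_all add: m_def\<close>)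
      finally have "val s m k ([Box 0 (Suc k) f] @ [Cap k, Box 0 k f'] @ []) = val s m k [Box 0 (Suc k) f, Cap k]"
        by (auto dest: eqv_val)
      then have "sm c (val s m k [Box 0 m B, Cap j]) = val s m k [Box 0 (Suc k) f, Cap k]"
        using a unfolding 2 c_def by simp
      then show ?thesis using vg vA True by simp
    qed
    moreover have "m - 2 = k" by (simp add: m_def)
    moreover have "tangle s m [Box 0 m g, Cap j] k" using gV j by (simp add: m_def)
    ultimately show "null s m (m - 2) [Box 0 m g, Cap j]" by (simp add: null_def)
  qed
  then show ?thesis by (simp add: g_def m_def)
qed

lemma JW_step:
  assumes f: "JW s (Suc k) f" and f': "JW s k f'"
    and E: "E s k f = sm (complex_of_real a) f'" and a: "a \<noteq> 0"
  defines "g \<equiv> act P s (Suc (Suc k)) [Box 0 (Suc k) f]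
     - sm (complex_of_real (1 / a)) (act P s (Suc (Suc k)) [Box 0 (Suc k) f, Cap k, Cup k, Box 0 (Suc k) f])"
  shows "JW s (Suc (Suc k)) g" "E s (Suc k) g = sm (complex_of_real (d - 1 / a)) f"
proof -
  define m where "m = Suc (Suc k)"
  define A where "A = act P s m [Box 0 (Suc k) f]"
  define B where "B = act P s m [Box 0 (Suc k) f, Cap k, Cup k, Box 0 (Suc k) f]"
  define c where "c = complex_of_real (1 / a)"
  have g: "g = A - sm c B" by (simp add: g_def A_def B_def c_def m_def)
  note fV = JW_V[OF f] and f'V = JW_V[OF f']
  have tA: "tangle s m [Box 0 (Suc k) f] m" using fV by (simp add: m_def)
  have tB: "tangle s m [Box 0 (Suc k) f, Cap k, Cup k, Box 0 (Suc k) f] m" using fV by (simp add: m_def)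
  have AV: "A \<in> V m s" and BV: "B \<in> V m s" unfolding A_def B_def using act_in tA tB by auto
  have gV: "g \<in> V m s" unfolding g using AV BV by (simp add: V_diff V_scale)
  have eA: "eqv s m m [Box 0 m A] [Box 0 (Suc k) f]" unfolding A_def by (rule eqv_Box_act[OF tA order_refl])
  have eB: "eqv s m m [Box 0 m B] [Box 0 (Suc k) f, Cap k, Cup k, Box 0 (Suc k) f]" unfolding B_def by (rule eqv_Box_act[OF tB order_refl])
  have "topfree s m g"
    unfolding g_def m_def by (rule wenzl_topfree[OF _ f' E a]) (use f in \<open>simp add: JW_def\<close>)
  moreover have "one s m - g \<in> J s m"
  proof -
    have lin: "lin (V (Suc k) s) (\<lambda>x. act P s m [Box 0 (Suc k) x])"
      using lin_val[of s m "[]" 0 "Suc k" "[]" m] by (simp add: val_diag m_def)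
    have h: "one s (Suc k) - f \<in> J s (Suc k)" using f by (simp add: JW_def)
    have hm: "act P s m [Box 0 (Suc k) (one s (Suc k) - f)] \<in> J s m"
      by (rule J_widen[OF h]) (simp add: m_def)
    have 1: "act P s m [Box 0 (Suc k) (one s (Suc k) - f)] = one s m - A"
      using lin_diff[OF lin, of "one s (Suc k)" f] fV one_widen[of "Suc k" m s] by (simp add: m_def A_def)
    define D where "D = act P s m ([Box 0 (Suc k) f, Cap k] @ [Cup k])"
    have DJ: "D \<in> J s m" unfolding D_def by (rule J_gen) (use fV in \<open>simp_all add: m_def\<close>)
    then have DV: "D \<in> V m s" using J_V by blast
    have "B = mul s m A D"
      using act_append[of s m "[Box 0 (Suc k) f, Cap k, Cup k]" "[Box 0 (Suc k) f]"] fV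
      by (simp add: A_def B_def D_def m_def)
    also have "\<dots> = D - mul s m (one s m - A) D" using AV DV by (simp add: mult_simps one_mult)
    finally have "B \<in> J s m" using J_mult[OF hm DV] DJ 1 by (metis subspace_diff subspace_J)
    then have "(one s m - A) + sm c B \<in> J s m"
      using hm 1 subspace_add[OF subspace_J] subspace_scale[OF subspace_J] by metis
    then show ?thesis by (simp add: g algebra_simps)
  qed
  ultimately show "JW s (Suc (Suc k)) g" by (simp add: JW_def m_def)
  have EA: "E s (Suc k) A = sm (complex_of_real d) f"
  proof -
    have "eqv s (Suc k) (Suc k) ([Cup (Suc k)] @ [Box 0 m A] @ [Cap (Suc k)]) ([] @ [Cup (Suc k), Box 0 (Suc k) f] @ [Cap (Suc k)])"
      using eqv_context[OF eA, of "Suc k" "[Cup (Suc k)]" "Suc 0" "[Cap (Suc k)]" "Suc k"] by (simp add: m_def)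
    also have "eqv s (Suc k) (Suc k) \<dots> ([] @ [Box 0 (Suc k) f, Cup (Suc k)] @ [Cap (Suc k)])"
      by (rule eqv_slides[where js = "[0]"]) (use fV in simp_all)
    finally have "E s (Suc k) A = val s (Suc k) (Suc k) ([Box 0 (Suc k) f] @ [Cup (Suc k), Cap (Suc k)] @ [])"
      unfolding E_def val_diag by (auto simp: m_def dest: eqv_act)
    also have "\<dots> = sm (complex_of_real d) f"
      using val_loop[of s "Suc k" "[Box 0 (Suc k) f]" "Suc k" "[]" "Suc k"] fV by (simp add: val_diag act_identity)
    finally show ?thesis .
  qed
  have EB: "E s (Suc k) B = f"
  proof -
    have "eqv s (Suc k) (Suc k) ([Cup (Suc k)] @ [Box 0 m B] @ [Cap (Suc k)]) ([] @ [Cup (Suc k), Box 0 (Suc k) f] @ [Cap k, Cup k, Box 0 (Suc k) f, Cap (Suc k)])"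
      using eqv_context[OF eB, of "Suc k" "[Cup (Suc k)]" "Suc 0" "[Cap (Suc k)]" "Suc k"] by (simp add: m_def)
    also have "eqv s (Suc k) (Suc k) \<dots> [Box 0 (Suc k) f, Box 0 (Suc k) f]"
      by (rule eqv_slides[where js = "[0, 1, 2, 1]"]) (use fV in simp_all)
    finally have "E s (Suc k) B = mul s (Suc k) f f" unfolding E_def mult_def by (auto simp: m_def dest: eqv_act)
    then show ?thesis using JW_idem[OF f] by simp
  qed
  have "E s (Suc k) g = E s (Suc k) A - sm c (E s (Suc k) B)"
    unfolding g using lin_diff[OF lin_E] lin_scale[OF lin_E] AV BV V_scale by (simp add: m_def)
  then show "E s (Suc k) g = sm (complex_of_real (d - 1 / a)) f"
    by (simp add: EA EB c_def scale_left_diff_distrib)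
qed

text \<open>
  The quantum numbers are positive since they are traces of non-zero projections: if the Jones-Wenzl
  projection on k strings were 0, the identity would lie in \<open>J\<close>, on k and
  therefore also on n strings.
\<close>

lemma jw_properties:
  assumes nz: "one s n \<notin> J s n" and k: "1 \<le> k" "k \<le> n"
  shows "0 < qreal d k \<and> JW s k (jw s k) \<and> JW s (k - 1) (jw s (k - 1)) \<and>
    E s (k - 1) (jw s k) = sm (complex_of_real (qreal d (Suc k) / qreal d k)) (jw s (k - 1)) \<and>
    Tr P s k (jw s k) = complex_of_real (qreal d (Suc k)) \<and> 0 < qreal d (Suc k)"
proof -
  have pos: "0 < qreal d (Suc k)" if "JW s k (jw s k)" "k \<le> n" "Tr P s k (jw s k) = complex_of_real (qreal d (Suc k))" for k
  proof -
    note jV = JW_V[OF that(1)]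
    have "jw s k \<noteq> 0"
    proof
      assume "jw s k = 0"
      then have "one s k \<in> J s k" using that(1) by (simp add: JW_def)
      then show False using one_J_widen that(2) nz by blast
    qed
    then obtain t where "t > 0" "Tr P s k (mul s k (star P (jw s k)) (jw s k)) = complex_of_real t"
      using positive_definite[OF jV] by blast
    then show ?thesis using JW_star[OF that(1)] JW_idem[OF that(1)] that(3) by simp
  qed
  have J00: "JW s 0 (jw s 0)" by (simp add: JW_def topfree_def subspace_0[OF subspace_J])
  show ?thesis using k
  proof (induction k rule: nat_induct_at_least)
    case base
    have j1: "JW s 1 (jw s 1)" by (simp add: JW_def topfree_def subspace_0[OF subspace_J])
    have "eqv s 0 0 ([Cup 0] @ [Box 0 (Suc 0) (one s (Suc 0))] @ [Cap 0]) ([Cup 0] @ [] @ [Cap 0])"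
      by (rule eqv_expand_0) auto
    then have E1: "E s 0 (jw s 1) = sm (complex_of_real d) (one s 0)"
      using loop[of s] by (auto simp: E_def dest: eqv_act)
    have "Tr P s 0 (one s 0) = 1" using scalar_eq[of s 1] by (simp add: Tr_def act_identity)
    then have "Tr P s 1 (jw s 1) = complex_of_real (qreal d (Suc 1))"
      using Tr_E[of "jw s 1" 0 s] E1 Tr_scale[of "one s 0" 0 s "complex_of_real d"] by simp
    moreover have "0 < qreal d (Suc 1)" using pos[OF j1 _ calculation] base by simp
    ultimately show ?case using j1 J00 E1 by simp
  next
    case (Suc k)
    then have IH: "0 < qreal d k" "JW s k (jw s k)" "JW s (k - 1) (jw s (k - 1))"
      "E s (k - 1) (jw s k) = sm (complex_of_real (qreal d (Suc k) / qreal d k)) (jw s (k - 1))"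
      "Tr P s k (jw s k) = complex_of_real (qreal d (Suc k))" "0 < qreal d (Suc k)" by auto
    obtain l where l: "k = Suc l" using Suc.hyps by (metis One_nat_def Suc_le_D)
    have jws: "jw s (Suc k) = act P s (Suc (Suc l)) [Box 0 (Suc l) (jw s (Suc l))]
      - sm (complex_of_real (1 / (qreal d (Suc k) / qreal d k))) (act P s (Suc (Suc l)) [Box 0 (Suc l) (jw s (Suc l)), Cap l, Cup l, Box 0 (Suc l) (jw s (Suc l))])"
      unfolding jw.simps(2)[of s k] l by simp
    have st: "JW s (Suc k) (jw s (Suc k))" "E s k (jw s (Suc k)) = sm (complex_of_real (d - 1 / (qreal d (Suc k) / qreal d k))) (jw s k)"
      using JW_step[of s l "jw s k" "jw s l" "qreal d (Suc k) / qreal d k"] IH unfolding jws by (simp_all add: l)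
    have "d - 1 / (qreal d (Suc k) / qreal d k) = qreal d (Suc (Suc k)) / qreal d (Suc k)"
      using IH by (simp add: field_simps)
    then have E: "E s k (jw s (Suc k)) = sm (complex_of_real (qreal d (Suc (Suc k)) / qreal d (Suc k))) (jw s k)"
      using st(2) by simp
    have "Tr P s (Suc k) (jw s (Suc k)) = Tr P s k (E s k (jw s (Suc k)))" using Tr_E[OF JW_V[OF st(1)]] by simp
    also have "\<dots> = complex_of_real (qreal d (Suc (Suc k)))"
      unfolding E using IH Tr_scale[OF JW_V[OF IH(2)]] by simp
    finally have T: "Tr P s (Suc k) (jw s (Suc k)) = complex_of_real (qreal d (Suc (Suc k)))" .
    show ?case using IH st(1) E T pos[OF st(1) Suc.prems T] by simp
  qed
qed

end

section \<open>The one-click rotation\<close>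

context subfactor_planar_algebra
begin

lemma eqv_Box_rotation:
  assumes "x \<in> V n s" "1 \<le> n" "n \<le> m"
  shows "eqv (opposite s) m m [Box 0 n (rotation P s n x)] [Cup 0, Box 1 n x, Cap n]"
  unfolding rotation_def by (rule eqv_Box_act) (use assms in auto)

text \<open>
  The rotation moves caps and cups as follows: those that meet neither of the two strings that are bent
  are shifted by one place, and the others are turned into partial traces.
\<close>

lemma rotation_cap_Suc:
  assumes x: "x \<in> V n s" and n: "null s n (n - 2) [Box 0 n x, Cap j]" and j: "j + 3 \<le> n"
  shows "null (opposite s) n (n - 2) [Box 0 n (rotation P s n x), Cap (Suc j)]"
proof -
  have nj: "Suc (n - 3) = n - 2" using j by simp
  have "eqv (opposite s) n (n - 2) ([Box 0 n (rotation P s n x)] @ [Cap (Suc j)]) ([Cup 0, Box 1 n x, Cap n] @ [Cap (Suc j)])"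
    by (rule eqv_suffix[OF eqv_Box_rotation]) (use x j in auto)
  also have "eqv (opposite s) n (n - 2) \<dots> ([Cup 0] @ map (shift 1) [Box 0 n x, Cap j] @ [Cap (n - 2)])"
    by (rule eqv_slides[where js = "[2]"]) (use x j nj in simp_all)
  finally have e: "eqv (opposite s) n (n - 2) [Box 0 n (rotation P s n x), Cap (Suc j)] ([Cup 0] @ map (shift 1) [Box 0 n x, Cap j] @ [Cap (n - 2)])"
    by simp
  show ?thesis
    unfolding null_eqv[OF e] by (rule null_context[of _ _ n "n - 2" _ _ _ 1]) (use n j in auto)
qed

lemma rotation_cap_0:
  assumes x: "x \<in> V (Suc k) s" and n: "El s k x = 0" and k: "1 \<le> k"
  shows "null (opposite s) (Suc k) (k - 1) [Box 0 (Suc k) (rotation P s (Suc k) x), Cap 0]"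
proof -
  have "eqv (opposite s) (Suc k) (k - 1) ([Box 0 (Suc k) (rotation P s (Suc k) x)] @ [Cap 0]) ([Cup 0, Box 1 (Suc k) x, Cap (Suc k)] @ [Cap 0])"
    by (rule eqv_suffix[OF eqv_Box_rotation]) (use x k in auto)
  also have "eqv (opposite s) (Suc k) (k - 1) \<dots> ([] @ [Cup 0, Box 1 (Suc k) x, Cap 0] @ [Cap (k - 1)])"
    by (rule eqv_slides[where js = "[2]"]) (use x k in simp_all)
  finally have e: "eqv (opposite s) (Suc k) (k - 1) [Box 0 (Suc k) (rotation P s (Suc k) x), Cap 0] ([] @ [Cup 0, Box 1 (Suc k) x, Cap 0] @ [Cap (k - 1)])"
    by simp
  have "null (opposite s) k k [Cup 0, Box 1 (Suc k) x, Cap 0]"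
    using n x by (simp add: null_diag El_def)
  then show ?thesis
    unfolding null_eqv[OF e] by (rule null_context_0[of _ _ _ _ _ _ 1]) (use k in auto)
qed

lemma rotation_cup:
  assumes x: "botfree s (Suc k) x" and E: "E s k x = 0" and j: "j + 2 \<le> Suc k"
  shows "null (opposite s) (k - 1) (Suc k) [Cup j, Box 0 (Suc k) (rotation P s (Suc k) x)]"
proof -
  note xV = botfree_V[OF x]
  have "eqv (opposite s) (k - 1) (Suc k) ([Cup j] @ [Box 0 (Suc k) (rotation P s (Suc k) x)]) ([Cup j] @ [Cup 0, Box 1 (Suc k) x, Cap (Suc k)])"
    by (rule eqv_prefix[OF _ eqv_Box_rotation]) (use xV j in auto)
  also have "eqv (opposite s) (k - 1) (Suc k) \<dots> [Cup 0, Cup (Suc (Suc j)), Box 1 (Suc k) x, Cap (Suc k)]"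
    by (rule eqv_slides[where js = "[0]"]) (use xV j in simp_all)
  finally have e: "eqv (opposite s) (k - 1) (Suc k) [Cup j, Box 0 (Suc k) (rotation P s (Suc k) x)] [Cup 0, Cup (Suc (Suc j)), Box 1 (Suc k) x, Cap (Suc k)]"
    by simp
  have "null (opposite s) (k - 1) (Suc k) [Cup 0, Cup (Suc (Suc j)), Box 1 (Suc k) x, Cap (Suc k)]"
  proof (cases "j = k - 1")
    case True
    have "null s k k [Cup k, Box 0 (Suc k) x, Cap k]" using E xV by (simp add: null_diag E_def)
    then have "null (opposite s) (k - 1) (Suc k) ([Cup 0] @ map (shift 1) [Cup k, Box 0 (Suc k) x, Cap k] @ [])"
      by (intro null_context[of _ _ k k _ _ _ 0]) (use j True in auto)
    then show ?thesis using True j by simp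
  next
    case False
    have "null s (k - 1) (Suc k) [Cup (Suc j), Box 0 (Suc k) x]"
      using x False j by (simp add: botfree_def)
    then have "null (opposite s) (k - 1) (Suc k) ([Cup 0] @ map (shift 1) [Cup (Suc j), Box 0 (Suc k) x] @ [Cap (Suc k)])"
      by (intro null_context[of _ _ "k - 1" "Suc k" _ _ _ 1]) (use j False in auto)
    then show ?thesis by simp
  qed
  then show ?thesis using null_eqv[OF e] by simp
qed

lemma E_rotation:
  assumes x: "topfree s (Suc k) x" and k: "1 \<le> k"
  shows "E (opposite s) k (rotation P s (Suc k) x) = 0"
proof -
  note xV = topfree_V[OF x]
  have "eqv (opposite s) k k ([Cup k] @ [Box 0 (Suc k) (rotation P s (Suc k) x)] @ [Cap k]) ([Cup k] @ [Cup 0, Box 1 (Suc k) x, Cap (Suc k)] @ [Cap k])"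
    using eqv_context[OF eqv_Box_rotation[OF xV, of "Suc k"], of k "[Cup k]" 1 "[Cap k]" k] by simp
  also have "eqv (opposite s) k k \<dots> ([Cup 0] @ map (shift 1) [Box 0 (Suc k) x, Cap (k - 1)] @ [])"
    by (rule eqv_slides[where js = "[0, 1, 2]"]) (use xV k in simp_all)
  finally have e: "eqv (opposite s) k k [Cup k, Box 0 (Suc k) (rotation P s (Suc k) x), Cap k] ([Cup 0] @ map (shift 1) [Box 0 (Suc k) x, Cap (k - 1)] @ [])"
    by simp
  have "null s (Suc k) (k - 1) [Box 0 (Suc k) x, Cap (k - 1)]" using x k by (simp add: topfree_def)
  then have "null (opposite s) k k ([Cup 0] @ map (shift 1) [Box 0 (Suc k) x, Cap (k - 1)] @ [])"
    by (intro null_context[of _ _ "Suc k" "k - 1" _ _ _ 0]) (use k in auto)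
  then have "null (opposite s) k k [Cup k, Box 0 (Suc k) (rotation P s (Suc k) x), Cap k]" unfolding null_eqv[OF e] .
  then show ?thesis by (simp add: null_diag E_def)
qed

lemma star_rotation:
  assumes "x \<in> V n s" "1 \<le> n"
  shows "star P (rotation P s n x) = act P (opposite s) n [Cup n, Box 1 n (star P x), Cap 0]"
  unfolding rotation_def by (subst star_act) (use assms in auto)

lemma rotation_mult_star:
  assumes x: "x \<in> V n s" "1 \<le> n"
  shows "mul (opposite s) n (rotation P s n x) (star P (rotation P s n x)) =
    act P (opposite s) n ([Cup n, Box 1 n (star P x), Cap 0] @ [Cup 0, Box 1 n x, Cap n])"
  unfolding star_rotation[OF x] unfolding rotation_def
  using act_append[of "opposite s" n "[Cup n, Box 1 n (star P x), Cap 0]" "[Cup 0, Box 1 n x, Cap n]"] x star_in[OF x(1)]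
  by simp

text \<open>
  The strings bent by the rotation and by its adjoint form zigzags.  Once they are straightened,
  the string closed on the left has become the one that closes x and its adjoint on the right.
\<close>

lemma El_rotation_mult_star:
  assumes x: "x \<in> V (Suc k) s"
  shows "El (opposite s) k (mul (opposite s) (Suc k) (rotation P s (Suc k) x) (star P (rotation P s (Suc k) x)))
    = E s k (mul s (Suc k) x (star P x))"
proof -
  define n where "n = Suc k"
  define y where "y = star P x"
  have x': "x \<in> V n s" "y \<in> V n s" using x star_in by (simp_all add: n_def y_def)
  define w where "w = [Cup n, Box 1 n y, Cap 0, Cup 0, Box 1 n x, Cap n]"
  have w: "tangle (opposite s) n w n" using x' by (simp add: w_def)
  have r: "mul (opposite s) n (rotation P s n x) (star P (rotation P s n x)) = act P (opposite s) n w"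
    using rotation_mult_star[OF x'(1)] by (simp add: w_def y_def n_def)
  have "eqv s k k ([Cup 0] @ [Box 1 n (act P (opposite s) n w)] @ [Cap 0]) ([Cup 0] @ map (shift 1) w @ [Cap 0])"
    using eqv_expand_1[OF w, of k "[Cup 0]" "[Cap 0]" k] act_in[OF w] by (simp add: n_def)
  also have "eqv s k k \<dots> ([Cup k] @ [Box 0 n y, Box 0 n x] @ [Cap k])"
    by (rule eqv_slides[where js = "[0, 1, 2, 4, 3, 2]"]) (use x' in \<open>simp_all add: w_def n_def\<close>)
  also have "eqv s k k \<dots> ([Cup k] @ [Box 0 n (act P s n [Box 0 n y, Box 0 n x])] @ [Cap k])"
    by (intro eqv_sym[OF eqv_expand_0]) (use x' in \<open>auto simp: n_def intro!: act_in\<close>)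
  finally show ?thesis
    unfolding n_def[symmetric] r y_def[symmetric] by (auto simp: El_def E_def mult_def n_def dest: eqv_act)
qed

lemma Tr_rotation_mult_star:
  assumes x: "x \<in> V (Suc k) s"
  shows "Tr P (opposite s) (Suc k) (mul (opposite s) (Suc k) (rotation P s (Suc k) x) (star P (rotation P s (Suc k) x)))
    = Tr P s (Suc k) (mul s (Suc k) x (star P x))"
proof -
  have r: "rotation P s (Suc k) x \<in> V (Suc k) (opposite s)" using rotation_in[OF x] by simp
  show ?thesis
    using Tr_El[OF mult_in[OF r star_in[OF r]]] Tr_E[OF mult_in[OF x star_in[OF x]]]
    unfolding El_rotation_mult_star[OF x] by simp
qed

text \<open>
  Modulo diagrams with a minimum at the top, the rotated Jones-Wenzl projection is a multiple of
  the identity; the factor comes from the second term of Wenzl's recursion, where the cup and the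
  cap of the middle part are straightened out by the rotation.
\<close>

lemma jw_rotation_jw:
  assumes JW: "\<And>i t. 1 \<le> i \<Longrightarrow> i \<le> n \<Longrightarrow> JW t i (jw t i)" and nz: "\<And>i. 1 \<le> i \<Longrightarrow> i \<le> n \<Longrightarrow> qreal d i \<noteq> 0"
    and k: "1 \<le> k" "k \<le> n"
  shows "mul (opposite s) k (jw (opposite s) k) (rotation P s k (jw s k)) =
     sm (complex_of_real ((- 1) ^ (k - 1) / qreal d k)) (jw (opposite s) k)"
  using k
proof (induction k rule: nat_induct_at_least)
  case base
  have "eqv (opposite s) 1 1 ([Cup 0] @ [Box 1 1 (act P s 1 [])] @ [Cap 1]) ([Cup 0] @ map (shift 1) [] @ [Cap 1])"
    by (rule eqv_expand_1) auto
  also have "eqv (opposite s) 1 1 \<dots> []" by (rule eqv_slides[where js = "[0]"]) simp_all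
  finally have "rotation P s 1 (one s 1) = one (opposite s) 1" by (auto simp: rotation_def dest: eqv_act)
  then show ?case by (simp add: one_mult)
next
  case (Suc k)
  define T where "T = opposite s"
  define m where "m = Suc k"
  define f where "f = jw s k"
  define f' where "f' = jw T m"
  define c where "c = complex_of_real (qreal d k / qreal d m)"
  obtain l where l: "k = Suc l" using Suc.hyps by (metis One_nat_def Suc_le_D)
  have fJ: "JW s k f" unfolding f_def by (rule JW) (use Suc in auto)
  have fkJ: "JW T k (jw T k)" by (rule JW) (use Suc in auto)
  have f'J: "JW T m f'" unfolding f'_def by (rule JW) (use Suc in \<open>auto simp: m_def\<close>)
  note fV = JW_V[OF fJ] and f'V = JW_V[OF f'J] and fkV = JW_V[OF fkJ]
  define A where "A = act P s m [Box 0 k f]"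
  define B where "B = act P s m [Box 0 k f, Cap l, Cup l, Box 0 k f]"
  have tA: "tangle s m [Box 0 k f] m" and tB: "tangle s m [Box 0 k f, Cap l, Cup l, Box 0 k f] m"
    using fV by (simp_all add: m_def l)
  have AV: "A \<in> V m s" and BV: "B \<in> V m s" unfolding A_def B_def using tA tB act_in by auto
  have jws: "jw s m = A - sm c B" using Suc.hyps by (simp add: A_def B_def c_def m_def l f_def)
  have m1: "1 \<le> m" by (simp add: m_def)
  have RA: "rotation P s m A \<in> V m T" and RB: "rotation P s m B \<in> V m T" 
    using rotation_in AV BV m1 by (simp_all add: T_def)
  (* The rotation makes the free last string of the first term into a cap and a cup.  The f above
     the cup is absorbed by f', which then annihilates the cup. *)
  have "mul T m f' (rotation P s m A) = 0"
  proof -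
    have "mul T m f' (rotation P s m A) = act P T m ([Cup 0] @ map (shift 1) [Box 0 k f] @ [Cap m] @ [Box 0 m f'])"
      using act_append[of T m "[Cup 0] @ map (shift 1) [Box 0 k f] @ [Cap m]" "[Box 0 m f']"] rotation_act[OF tA m1] fV f'V
      by (simp add: A_def T_def m_def act_identity)
    also have "\<dots> = 0"
    proof -
      have e: "eqv T m m ([Cup 0] @ map (shift 1) [Box 0 k f] @ [Cap m] @ [Box 0 m f']) ([Cap (m - 2)] @ [Cup 0, Box 1 k f, Box 0 m f'])"
        by (rule eqv_slides[where js = "[1, 0]"]) (use fV f'V in \<open>simp_all add: m_def T_def l\<close>)
      have "eqv T m m [Box 0 m f'] [Box 1 k f, Box 0 m f']"
        using eqv_sym[OF botfree_absorb_shift[OF JW_botfree[OF f'J[unfolded T_def m_def]] fJ]] by (simp add: m_def T_def)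
      then have "eqv T (m - 2) m ([Cup 0] @ [Box 0 m f']) ([Cup 0] @ [Box 1 k f, Box 0 m f'])"
        by (intro eqv_prefix[of _ _ _ m]) (simp_all add: m_def l)
      moreover have "null T (m - 2) m ([Cup 0] @ [Box 0 m f'])"
        using JW_botfree[OF f'J] by (simp add: botfree_def m_def l)
      ultimately have "null T (m - 2) m ([Cup 0] @ [Box 1 k f, Box 0 m f'])" using null_eqv by blast
      then have "null T m m ([Cap (m - 2)] @ [Cup 0, Box 1 k f, Box 0 m f'])"
        by (intro null_append_left[of _ "m - 2"]) (simp_all add: m_def l)
      then show ?thesis using eqv_act[OF e] by (simp add: null_diag)
    qed
    finally show ?thesis .
  qed
  moreover have "mul T m f' (rotation P s m B) = sm (complex_of_real ((- 1) ^ (k - 1) / qreal d k)) f'"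
  proof -
    (* In the second term the upper f may be replaced by the identity: the difference lies in J, and
       the minima at its top are annihilated by f'. *)
    define g where "g y = val T m m ([Cup 0, Box 1 k f, Cap k, Cup k] @ [Box 1 k y] @ [Cap m, Box 0 m f'])" for y
    have lin: "lin (V k s) g"
      unfolding g_def using lin_val[of T m "[Cup 0, Box 1 k f, Cap k, Cup k]" 1 k "[Cap m, Box 0 m f']" m] fV f'V
      by (simp add: m_def T_def l)
    have "mul T m f' (rotation P s m B) = act P T m (([Cup 0] @ map (shift 1) [Box 0 k f, Cap l, Cup l, Box 0 k f] @ [Cap m]) @ [Box 0 m f'])"
      using act_append[of T m "[Cup 0] @ map (shift 1) [Box 0 k f, Cap l, Cup l, Box 0 k f] @ [Cap m]" "[Box 0 m f']"] rotation_act[OF tB m1] fV f'V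
      by (simp add: B_def T_def m_def l act_identity)
    also have "\<dots> = g f" by (simp add: g_def val_diag l)
    also have "\<dots> = g (one s k) - g (one s k - f)" using lin_diff[OF lin] fV V_one by simp
    finally have M: "mul T m f' (rotation P s m B) = g (one s k) - g (one s k - f)" .
    have Z: "g (one s k - f) \<in> {0}"
    proof (rule J_induct[OF _ lin])
      show "one s k - f \<in> J s k" using fJ by (simp add: JW_def)
      show "subspace {0}" by (simp add: subspace_def)
      fix w j assume w: "tangle s k w (k - 2)" "j + 2 \<le> k"
      have k2: "Suc (Suc (k - 2)) = k" using w(2) by simp
      have ws: "tangle T (m + 2) (map (shift 1) w) m"
        using wf_shift_widen[of "box_space P" 1 T k w "k - 2" 2] w k2 by (simp add: T_def m_def)
      have "eqv T m m ([Cup 0, Box 1 k f, Cap k, Cup k] @ [Box 1 k (act P s k (w @ [Cup j]))] @ [Cap m, Box 0 m f'])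
         ([Cup 0, Box 1 k f, Cap k, Cup k] @ map (shift 1) (w @ [Cup j]) @ [Cap m, Box 0 m f'])"
        unfolding T_def
        by (rule eqv_expand_1[OF tangle_J[OF w]]) (use fV f'V act_in[OF tangle_J[OF w]] in \<open>simp add: m_def T_def l\<close>)
      also have "[Cup 0, Box 1 k f, Cap k, Cup k] @ map (shift 1) (w @ [Cup j]) @ [Cap m, Box 0 m f'] =
          ([Cup 0, Box 1 k f, Cap k, Cup k] @ map (shift 1) w) @ [Cup (Suc j), Cap m] @ [Box 0 m f']" by simp
      also have "eqv T m m \<dots> (([Cup 0, Box 1 k f, Cap k, Cup k] @ map (shift 1) w) @ [Cap (m - 2), Cup (Suc j)] @ [Box 0 m f'])"
        using eqv_swap_right[of T m "[Cup 0, Box 1 k f, Cap k, Cup k] @ map (shift 1) w" "Cup (Suc j)" "Cap m" "[Box 0 m f']" m]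
          fV f'V w ws by (auto simp: m_def T_def l wf_append)
      finally have e: "eqv T m m ([Cup 0, Box 1 k f, Cap k, Cup k] @ [Box 1 k (act P s k (w @ [Cup j]))] @ [Cap m, Box 0 m f'])
          (([Cup 0, Box 1 k f, Cap k, Cup k] @ map (shift 1) w @ [Cap (m - 2)]) @ [Cup (Suc j), Box 0 m f'])" by simp
      have "null T (m - 2) m [Cup (Suc j), Box 0 m f']"
        using JW_botfree[OF f'J] w by (simp add: botfree_def m_def)
      then have "null T m m (([Cup 0, Box 1 k f, Cap k, Cup k] @ map (shift 1) w @ [Cap (m - 2)]) @ [Cup (Suc j), Box 0 m f'])"
        by (rule null_append_left) (use fV ws in \<open>auto simp: m_def T_def l wf_append\<close>)
      then show "g (act P s k (w @ [Cup j])) \<in> {0}"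
        unfolding g_def using eqv_val[OF e] by (simp add: null_def)
    qed
    (* With the identity there, the cup of the middle part forms a zigzag with the string bent by the
       rotation.  What remains is the rotation of f, which is known by induction. *)
    have G: "g (one s k) = sm (complex_of_real ((- 1) ^ (k - 1) / qreal d k)) f'"
    proof -
      have "eqv T m m ([Cup 0, Box 1 k f, Cap k, Cup k] @ [Box 1 k (one s k)] @ [Cap m, Box 0 m f'])
         ([Cup 0, Box 1 k f, Cap k, Cup k] @ map (shift 1) [] @ [Cap m, Box 0 m f'])"
        unfolding T_def by (rule eqv_expand_1) (use fV f'V in \<open>simp_all add: m_def T_def l\<close>)
      also have "eqv T m m \<dots> ([Cup 0, Box 1 k f, Cap k] @ [Box 0 m f'])"
        by (rule eqv_slides[where js = "[3]"]) (use fV f'V in \<open>simp_all add: m_def T_def l\<close>)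
      also have "eqv T m m \<dots> ([Box 0 k (rotation P s k f)] @ [Box 0 m f'])"
        by (rule eqv_suffix[OF eqv_sym[OF eqv_Box_rotation[OF fV, folded T_def]]]) (use f'V in \<open>simp_all add: m_def l\<close>)
      also have "eqv T m m \<dots> ([Box 0 k (rotation P s k f)] @ [Box 0 k (jw T k), Box 0 m f'])"
      proof (rule eqv_prefix)
        have Rf: "rotation P s k f \<in> V k T" using rotation_in[OF fV Suc.hyps] by (simp add: T_def)
        show "tangle T m [Box 0 k (rotation P s k f)] m" using Rf by (simp add: m_def)
        show "eqv T m m [Box 0 m f'] [Box 0 k (jw T k), Box 0 m f']"
          using eqv_sym[OF botfree_absorb[OF JW_botfree[OF f'J] fkJ]] by (simp add: m_def)
      qed
      also have "[Box 0 k (rotation P s k f)] @ [Box 0 k (jw T k), Box 0 m f'] = [Box 0 k (rotation P s k f), Box 0 k (jw T k)] @ [Box 0 m f']" by simp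
      also have "eqv T m m \<dots> ([Box 0 k (mul T k (jw T k) (rotation P s k f))] @ [Box 0 m f'])"
        by (rule eqv_suffix[OF eqv_sym[OF eqv_Box_mult_0]]) (use fkV f'V rotation_in[OF fV Suc.hyps] in \<open>simp_all add: m_def T_def\<close>)
      finally have "g (one s k) = val T m m ([] @ [Box 0 k (mul T k (jw T k) (rotation P s k f))] @ [Box 0 m f'])"
        unfolding g_def by (auto dest: eqv_val)
      also have "mul T k (jw T k) (rotation P s k f) = sm (complex_of_real ((- 1) ^ (k - 1) / qreal d k)) (jw T k)"
        using Suc.IH Suc.prems by (simp add: T_def f_def)
      also have "val T m m ([] @ [Box 0 k (sm (complex_of_real ((- 1) ^ (k - 1) / qreal d k)) (jw T k))] @ [Box 0 m f'])
          = sm (complex_of_real ((- 1) ^ (k - 1) / qreal d k)) (val T m m ([] @ [Box 0 k (jw T k)] @ [Box 0 m f']))"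
        using lin_scale[OF lin_val[of T m "[]" 0 k "[Box 0 m f']" m]] fkV f'V by (simp add: m_def)
      also have "val T m m ([] @ [Box 0 k (jw T k)] @ [Box 0 m f']) = f'"
        using eqv_val[OF botfree_absorb[OF JW_botfree[OF f'J] fkJ]] f'V by (simp add: m_def val_diag act_identity)
      finally show ?thesis .
    qed
    show ?thesis using M Z G by simp
  qed
  moreover have "rotation P s m (jw s m) = rotation P s m A - sm c (rotation P s m B)"
    unfolding jws using lin_diff[OF lin_rotation[OF m1]] lin_scale[OF lin_rotation[OF m1]] AV BV V_scale by simp
  ultimately have "mul T m f' (rotation P s m (jw s m)) = - sm c (sm (complex_of_real ((- 1) ^ (k - 1) / qreal d k)) f')"
    using f'V RA RB by (simp add: mult_simps V_scale)
  also have "\<dots> = sm (complex_of_real ((- 1) ^ (m - 1) / qreal d m)) f'"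
    using nz[of k] nz[of m] Suc.hyps Suc.prems unfolding c_def 
    by (simp add: l m_def flip: scale_minus_left)
  finally show ?case by (simp add: f'_def T_def m_def)
qed

lemma dl_idem: "idem s k x \<Longrightarrow> idem (cross k s) k (dl s k x)"
proof -
  assume x: "idem s k x"
  have xV: "x \<in> V k s" using x idem_V by blast
  define t where "t = turned k k [Box 0 k x]"
  have tx: "tangle s k [Box 0 k x] k" using xV by simp
  have tt: "tangle (cross k s) k t k" unfolding t_def by (rule tangle_turned[OF tx])
  have d: "dl s k x = act P (cross k s) k t" using dl_act[OF tx] xV by (simp add: act_identity t_def)
  have "mul (cross k s) k (dl s k x) (dl s k x) = act P (cross k s) k (t @ t)"
    using act_append[OF tt tt] by (simp add: d)
  also have "\<dots> = act P (cross k s) k (turned k k ([Box 0 k x] @ [Box 0 k x]))"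
    unfolding t_def by (rule eqv_act[OF turned_append[OF tx tx]])
  also have "\<dots> = act P (cross k s) k t"
    unfolding t_def by (rule eqv_act[OF turned_eqv]) (use eqv_idem[OF x order_refl] in simp)
  finally show ?thesis using d dl_in[OF xV] by (simp add: idem_def)
qed

lemma iso_parity: "iso s k x l y \<Longrightarrow> even (k + l)"
  unfolding iso_def using wf_parity by blast

text \<open>
  The inverse isomorphisms F and G are simply turned around.
\<close>

lemma dl_iso:
  assumes x: "x \<in> V k s" and y: "y \<in> V l s" and i: "iso s k x l y"
  shows "iso (cross k s) k (dl s k x) l (dl s l y)"
proof -
  obtain F G where F: "tangle s k F l" "tangle s l G k" "eqv s k k (F @ G) [Box 0 k x]" "eqv s l l (G @ F) [Box 0 l y]"
    using i unfolding iso_def by blast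
  have kl: "cross l s = cross k s" using iso_parity[OF i] cross_cong[of l k s] by (simp add: add.commute)
  have "eqv (cross k s) k k (turned l k G @ turned k l F) [Box 0 k (dl s k x)]"
    using eqv_trans[OF turned_append[OF F(1) F(2)] eqv_trans[OF turned_eqv[OF F(3)] eqv_sym[OF eqv_Box_dl[OF x]]]] .
  moreover have "eqv (cross k s) l l (turned k l F @ turned l k G) [Box 0 l (dl s l y)]"
    using eqv_trans[OF turned_append[OF F(2) F(1)] eqv_trans[OF turned_eqv[OF F(4)] eqv_sym[OF eqv_Box_dl[OF y]]]]
    unfolding kl .
  ultimately show ?thesis
    unfolding iso_def using tangle_turned[OF F(1)] tangle_turned[OF F(2)] kl by fastforce
qed

text \<open>
  If p q is not zero, it is up to a scalar a partial isometry between q and p.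
\<close>

lemma orthogonal_if_not_iso:
  assumes p: "minimal_projection P (s, n, p)" and q: "minimal_projection P (s, n, q)" and ni: "\<not> iso s n p n q"
  shows "mul s n p q = 0"
proof (rule ccontr)
  assume pq0: "mul s n p q \<noteq> 0"
  note p1 = minimalD[OF p] and q1 = minimalD[OF q]
  define x where "x = mul s n q p"
  define y where "y = mul s n p q"
  have xy: "x \<in> V n s" "y \<in> V n s" "star P x = y" "star P y = x"
    using p1 q1 by (simp_all add: x_def y_def mult_in star_mult)
  obtain c where c: "mul s n p (mul s n q p) = sm c p" using p1(5)[OF q1(1)] by blast
  obtain e where e: "mul s n q (mul s n p q) = sm e q" using q1(5)[OF p1(1)] by blast
  have qqp: "mul s n q (mul s n q p) = mul s n q p" using mult_assoc[of q n s q p] p1 q1 by simp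
  have ppq: "mul s n p (mul s n p q) = mul s n p q" using mult_assoc[of p n s p q] p1 q1 by simp
  have yx: "mul s n y x = sm c p" using c p1 q1 qqp by (simp add: x_def y_def mult_assoc mult_in)
  have xy': "mul s n x y = sm e q" using e p1 q1 ppq by (simp add: x_def y_def mult_assoc mult_in)
  have y0: "y \<noteq> 0" using pq0 by (simp add: y_def)
  have x0: "x \<noteq> 0" using y0 xy(3) star_0 by metis
  have c0: "c \<noteq> 0" using star_mult_eq_0[OF xy(1)] xy(3) yx x0 by auto
  have e0: "e \<noteq> 0" using star_mult_eq_0[OF xy(2)] xy(4) xy' y0 by auto
  have "c = e"
  proof -
    have "sm c y = mul s n (mul s n y x) y" using yx p1 q1 by (simp add: mult_simps y_def mult_in flip: mult_assoc)
    also have "\<dots> = mul s n y (mul s n x y)" using xy by (simp add: mult_assoc)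
    also have "\<dots> = sm e y" using xy' p1 q1 by (simp add: mult_simps y_def mult_in mult_assoc)
    finally show ?thesis using y0 scale_right_imp_eq by blast
  qed
  have "iso s n p n q"
    unfolding iso_def
  proof (intro exI conjI)
    have z: "sm (1 / c) y \<in> V n s" using xy by (simp add: V_scale)
    show "tangle s n [Box 0 n x] n" "tangle s n [Box 0 n (sm (1 / c) y)] n" using xy z by simp_all
    show "eqv s n n ([Box 0 n x] @ [Box 0 n (sm (1 / c) y)]) [Box 0 n p]"
      by (rule val_eqv) (use xy z p1 c0 yx in \<open>simp_all add: val_diag act_identity mult_simps flip: mult_def\<close>)
    show "eqv s n n ([Box 0 n (sm (1 / c) y)] @ [Box 0 n x]) [Box 0 n q]"
      by (rule val_eqv) (use xy z q1 c0 xy' \<open>c = e\<close> in \<open>simp_all add: val_diag act_identity mult_simps flip: mult_def\<close>)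
  qed
  then show False using ni by simp
qed

lemma depth_botfree:
  assumes p: "minimal_projection P (s, n, p)" "depth P s (vertex P (s, n, p)) = n"
  shows "botfree s n p" "topfree s n p"
proof -
  note p1 = minimalD[OF p(1)]
  have "null s (n - 2) n ([Cup j] @ [Box 0 n p])" if "j + 2 \<le> n" for j
    by (rule depth_null[OF p]) (use that in auto)
  then show "botfree s n p" using p1 by (simp add: botfree_def)
  then show "topfree s n p" using botfree_star p1(2) by metis
qed

lemma Tr_projection_pos:
  assumes "is_projection P (s, k, p)" "p \<noteq> 0"
  shows "\<exists>t>0. Tr P s k p = complex_of_real t"
  using positive_definite[of p k s] projectionD[OF assms(1)] assms(2) by metis

end

section \<open>Quantum numbers\<close>

lemma qreal_cassini: "(qreal d (Suc n))\<^sup>2 - qreal d n * qreal d (Suc (Suc n)) = 1"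
proof (induction n)
  case (Suc n)
  then show ?case by (simp add: power2_eq_square algebra_simps)
qed simp

lemma admissible_cases:
  assumes "admissible q"
  obtains (root) "cmod q = 1" "q \<noteq> inverse q" | (real) x where "x \<ge> 1" "q = complex_of_real x"
proof -
  consider j :: nat where "j \<ge> 3" "q = exp (2 * of_real pi * \<i> / (2 * of_nat j))"
    | x where "x \<ge> 1" "q = complex_of_real x"
    using assms unfolding admissible_def by auto
  then show ?thesis
  proof cases
    case (1 j)
    have q: "q = cis (pi / j)" unfolding 1(2) cis_conv_exp by (simp add: mult.commute)
    have "0 < sin (pi / j)" using 1(1) by (intro sin_gt_zero) (auto simp: field_simps)
    then have "Im q > 0" by (simp add: q)
    moreover have "Im (inverse q) = - Im q" unfolding q cis_inverse by simp
    ultimately have "q \<noteq> inverse q" by (metis less_irrefl neg_0_less_iff_less order_less_trans)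
    then show ?thesis using that(1) q by simp
  qed (use that(2) in auto)
qed

lemma admissible_nonzero: "admissible q \<Longrightarrow> q \<noteq> 0"
  by (elim admissible_cases) auto

lemma admissible_inverse: "admissible q \<Longrightarrow> q \<noteq> 1 \<Longrightarrow> q - inverse q \<noteq> 0"
proof (elim admissible_cases)
  fix x assume x: "q \<noteq> 1" "x \<ge> 1" "q = complex_of_real x"
  then have "x \<noteq> inverse x" by (auto simp: field_simps) (smt (verit) mult_less_cancel_left2 one_power2 x(1) of_real_1)
  then show ?thesis using x(3) by (simp flip: of_real_inverse)
qed simp

text \<open>
  Both sides satisfy the same two-term recursion with coefficients d = q + 1 / q and - 1.
\<close>

lemma qnum_eq_qreal:
  assumes q: "admissible q" and d: "complex_of_real d = qnum q 2"
  shows "qnum q k = complex_of_real (qreal d k)"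
proof (cases "q = 1")
  case True
  then have d2: "d = 2" using d by (simp add: qnum_def) (metis of_real_eq_iff of_real_numeral)
  have "qreal d k = real k" unfolding d2 by (induction "2 :: real" k rule: qreal.induct) auto
  then show ?thesis using True by (simp add: qnum_def)
next
  case False
  note D = admissible_inverse[OF q False] and q0 = admissible_nonzero[OF q]
  have d': "complex_of_real d = q + inverse q"
  proof -
    have "q ^ 2 - inverse q ^ 2 = (q + inverse q) * (q - inverse q)" by (simp add: power2_eq_square algebra_simps)
    then show ?thesis using d D False by (simp add: qnum_def)
  qed
  have "q ^ k - inverse q ^ k = complex_of_real (qreal d k) * (q - inverse q) \<and>
      q ^ Suc k - inverse q ^ Suc k = complex_of_real (qreal d (Suc k)) * (q - inverse q)"
  proof (induction k)
    case (Suc k)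
    have "q ^ Suc (Suc k) - inverse q ^ Suc (Suc k) =
        (q + inverse q) * (q ^ Suc k - inverse q ^ Suc k) - (q * inverse q) * (q ^ k - inverse q ^ k)"
      by (simp add: algebra_simps)
    also have "\<dots> = (q + inverse q) * (complex_of_real (qreal d (Suc k)) * (q - inverse q)) - 1 * (complex_of_real (qreal d k) * (q - inverse q))"
      by (simp only: conjunct1[OF Suc] conjunct2[OF Suc] right_inverse[OF q0])
    also have "\<dots> = complex_of_real (qreal d (Suc (Suc k))) * (q - inverse q)"
      by (simp add: d' algebra_simps)
    finally show ?case using Suc by blast
  qed simp
  then show ?thesis using D False by (simp add: qnum_def)
qed

section \<open>The three projections of one principal graph\<close>

context subfactor_planar_algebra
begin

lemma topfree_comb: 
  assumes "topfree s n x" "topfree s n y" shows "topfree s n (sm a x + sm b y)"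
  unfolding topfree_def
proof (intro conjI allI impI)
  note xy = topfree_V[OF assms(1)] topfree_V[OF assms(2)]
  show z: "sm a x + sm b y \<in> V n s" using xy by (intro V_add V_scale)
  fix j assume j: "j + 2 \<le> n"
  have lin: "lin (V n s) (\<lambda>x. val s n (n - 2) ([] @ [Box 0 n x] @ [Cap j]))"
    using lin_val[of s n "[]" 0 n "[Cap j]" "n - 2"] j by simp
  have "val s n (n - 2) [Box 0 n (sm a x + sm b y), Cap j] = 0"
    using lin_comb[OF lin xy, of a b] assms j by (simp add: topfree_def null_def)
  then show "null s n (n - 2) [Box 0 n (sm a x + sm b y), Cap j]" using z j by (simp add: null_def)
qed

lemma lin_corner: "f \<in> V n s \<Longrightarrow> lin (V n s) (\<lambda>x. mul s n f (mul s n x f))"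
  unfolding lin_def
  by (intro conjI ballI allI subspace_box_space)
    (simp add: lin_comb[OF lin_mult_left] lin_comb[OF lin_mult_right] mult_in V_scale mult_simps V_add)

text \<open>
  Like supertransitivity, the multiplicity refers to one shading only and is carried over by the
  rotation, which is onto and preserves Temperley-Lieb.
\<close>

lemma multiplicity_2_span:
  assumes mult: "multiplicity P n = 2" and n: "1 \<le> n"
  shows "\<exists>a b. a \<in> V n s \<and> b \<in> V n s \<and> V n s \<subseteq> span (insert a (insert b (TL P n s)))"
proof -
  have plus: "\<exists>a b. a \<in> V n Plus \<and> b \<in> V n Plus \<and> V n Plus \<subseteq> span (insert a (insert b (TL P n Plus)))"
  proof -
    obtain G where G: "finite G" "V n Plus = span G" using box_space_finite .
    obtain B0 where B0: "B0 \<subseteq> TL P n Plus" "independent B0" "TL P n Plus \<subseteq> span B0" "card B0 = dim (TL P n Plus)"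
      by (rule basis_exists)
    obtain B where B: "B0 \<subseteq> B" "B \<subseteq> V n Plus" "independent B" "V n Plus \<subseteq> span B"
      by (rule maximal_independent_subset_extend[OF order_trans[OF B0(1) TL_V] B0(2)])
    have fB: "finite B" using independent_span_bound[OF G(1) B(3)] B(2) G(2) by blast
    have "card B = dim (V n Plus)" using basis_card_eq_dim[OF B(2) B(4) B(3)] .
    then have "card B - card B0 = 2" using mult B0(4) by (simp add: multiplicity_def)
    moreover have "finite B0" by (rule finite_subset[OF B(1) fB])
    ultimately have "card (B - B0) = 2" using B(1) by (simp add: card_Diff_subset)
    then obtain a b where ab: "B - B0 = {a, b}" by (auto simp: card_2_iff)
    have "B \<subseteq> insert a (insert b (TL P n Plus))" using ab B0(1) by blast
    then have "V n Plus \<subseteq> span (insert a (insert b (TL P n Plus)))" using B(4) span_mono by blast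
    then show ?thesis using ab B(2) by blast
  qed
  show ?thesis
  proof (cases s)
    case Plus then show ?thesis using plus by simp
  next
    case Minus
    obtain a b where ab: "a \<in> V n Plus" "b \<in> V n Plus" "V n Plus \<subseteq> span (insert a (insert b (TL P n Plus)))"
      using plus by blast
    let ?R = "rotation P Plus n"
    have "V n Minus \<subseteq> span (insert (?R a) (insert (?R b) (TL P n Minus)))"
    proof
      fix x assume "x \<in> V n Minus"
      then obtain y where y: "y \<in> V n Plus" "x = ?R y" using rotation_surj[of x n Minus] n by fastforce
      have "?R y \<in> span (insert (?R a) (insert (?R b) (TL P n Minus)))"
        by (rule lin_span[OF lin_rotation[OF n], of "insert a (insert b (TL P n Plus))"])
          (use ab y TL_V rotation_TL[of _ n Plus] n in \<open>auto intro: span_base\<close>)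
      then show "x \<in> span (insert (?R a) (insert (?R b) (TL P n Minus)))" using y by simp
    qed
    then show ?thesis using ab rotation_in[of _ n Plus] n Minus by (metis opposite.simps(1))
  qed
qed

end

locale quadruple_shading = subfactor_planar_algebra P d
  for P :: "'v::ab_group_add planar_data" and d :: real +
  fixes n :: nat and s :: shading and p q r :: 'v
  assumes n2: "2 \<le> n" and n_even: "even n"
    and st: "supertransitive P (n - 1)" and mult2: "multiplicity P n = 2"
    and Q_at: "Q_at P s n p q r"
begin

abbreviation "f \<equiv> jw s n"

lemma minimal: "minimal_projection P (s, n, p)" "minimal_projection P (s, n, q)" "minimal_projection P (s, n, r)"
  using Q_at unfolding Q_at_def by blast+

lemmas p1 = minimalD[OF minimal(1)] and q1 = minimalD[OF minimal(2)] and r1 = minimalD[OF minimal(3)]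

lemma depths: "depth P s (vertex P (s, n, p)) = n" "depth P s (vertex P (s, n, q)) = n" "depth P s (vertex P (s, n, r)) = n"
  using Q_at unfolding Q_at_def vertices_at_def by blast+

lemma free: "topfree s n p" "topfree s n q" "topfree s n r" "botfree s n p" "botfree s n q" "botfree s n r"
  using depth_botfree minimal depths by blast+

lemma not_iso: "\<not> iso s n p n q" "\<not> iso s n p n r" "\<not> iso s n q n r"
  using Q_at vertex_eq_iff minimal unfolding Q_at_def by fastforce+

lemma orth: "mul s n p q = 0" "mul s n p r = 0" "mul s n q r = 0" "mul s n q p = 0" "mul s n r p = 0" "mul s n r q = 0"
  using orthogonal_if_not_iso minimal not_iso iso_sym by blast+

text \<open>
  The identity is not annihilated by p, whereas everything in \<open>J\<close> is.  This makes the
  quantum numbers up to [n+1] positive.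
\<close>

lemma one_notin_J: "one s n \<notin> J s n"
proof
  assume "one s n \<in> J s n"
  then have "mul s n p (one s n) = 0" using botfree_mult_J[OF free(4)] by blast
  then show False using mult_one p1 by simp
qed

lemma jw_facts: "1 \<le> k \<Longrightarrow> k \<le> n \<Longrightarrow> JW s k (jw s k)" "1 \<le> k \<Longrightarrow> k \<le> Suc n \<Longrightarrow> 0 < qreal d k"
  "JW s (n - 1) (jw s (n - 1))" "Tr P s n f = complex_of_real (qreal d (Suc n))"
  using jw_properties[OF one_notin_J, of k] jw_properties[OF one_notin_J, of "k - 1"]  jw_properties[OF one_notin_J, of n] n2
  by (auto simp: le_Suc_eq)

lemma f_JW: "JW s n f"
  using jw_facts(1)[of n] n2 by simp

lemmas f_V = JW_V[OF f_JW]

lemma comb_mult: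
  assumes "x = sm a p + sm b q + sm c r"
  shows "mul s n p x = sm a p" "mul s n q x = sm b q" "mul s n r x = sm c r"
    "mul s n x p = sm a p" "mul s n x q = sm b q" "mul s n x r = sm c r"
  unfolding assms using p1 q1 r1 orth by (simp_all add: mult_simps V_add V_scale)

lemma span_pqr: "x \<in> span {p, q, r} \<longleftrightarrow> (\<exists>a b c. x = sm a p + sm b q + sm c r)"
proof
  assume "x \<in> span {p, q, r}"
  then obtain a b c where "x - sm a p - sm b q = sm c r"
    unfolding span_breakdown_eq[of _ p] span_breakdown_eq[of _ q] by (auto simp: span_singleton)
  then have "x = sm a p + sm b q + sm c r" by (simp add: algebra_simps)
  then show "\<exists>a b c. x = sm a p + sm b q + sm c r" by blast
next
  assume "\<exists>a b c. x = sm a p + sm b q + sm c r"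
  then obtain a b c where x: "x = sm a p + sm b q + sm c r" by blast
  show "x \<in> span {p, q, r}" unfolding x by (intro span_add span_scale span_base) simp_all
qed

lemma independent_pqr: "independent {p, q, r}" "card {p, q, r} = 3"
proof -
  have 1: "p \<notin> span {q, r}"
  proof
    assume "p \<in> span {q, r}"
    then obtain b c where "p - sm b q = sm c r" unfolding span_breakdown_eq[of _ q] by (auto simp: span_singleton)
    then have "p = sm 0 p + sm b q + sm c r" by (simp add: algebra_simps)
    from comb_mult(1)[OF this] show False using p1 by simp
  qed
  have 2: "q \<notin> span {r}"
  proof
    assume "q \<in> span {r}"
    then obtain c where "q = sm 0 p + sm 0 q + sm c r" by (auto simp: span_singleton)
    from comb_mult(2)[OF this] show False using q1 by simp
  qed
  have ne: "p \<noteq> q" "p \<noteq> r" "q \<noteq> r" using 1 2 by (auto intro: span_base)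
  show "independent {p, q, r}"
    by (intro independent_insertI 1 2 independent_empty) (use r1(4) in simp)
  show "card {p, q, r} = 3" using ne by simp
qed

text \<open>
  Compressing to the corner of f sends Temperley-Lieb to the multiples of f, so by multiplicity two
  the corner has dimension at most three; it contains the independent elements p, q and r.
\<close>

lemma corner: 
  assumes x: "x \<in> V n s" shows "\<exists>a b c. mul s n f (mul s n x f) = sm a p + sm b q + sm c r"
proof -
  define C where "C x = mul s n f (mul s n x f)" for x
  have lin: "lin (V n s) C" unfolding C_def by (rule lin_corner[OF f_V])
  obtain a b where ab: "a \<in> V n s" "b \<in> V n s" "V n s \<subseteq> span (insert a (insert b (TL P n s)))"
    using multiplicity_2_span[OF mult2] n2 by fastforce
  define T where "T = {f, C a, C b}"
  have CT: "C y \<in> span T" if y: "y \<in> V n s" for y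
  proof (rule lin_span[OF lin])
    show "insert a (insert b (TL P n s)) \<subseteq> V n s" using ab TL_V by blast
    show "y \<in> span (insert a (insert b (TL P n s)))" using ab y by blast
    fix z assume "z \<in> insert a (insert b (TL P n s))"
    then consider "z = a" | "z = b" | "z \<in> TL P n s" by blast
    then show "C z \<in> span T"
    proof cases
      case 3
      then obtain c where c: "z - sm c (one s n) \<in> J s n" using TL_one_J by blast
      have z: "z \<in> V n s" using 3 TL_V by blast
      have "C z = mul s n (mul s n f z) f" unfolding C_def using z f_V by (simp add: mult_assoc)
      also have "\<dots> = sm c f" using JW_mult_one_J[OF f_JW z c] JW_idem[OF f_JW] f_V by (simp add: mult_simps)
      finally show ?thesis by (auto simp: T_def intro: span_scale span_base)
    qed (auto simp: T_def intro: span_base)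
  qed simp
  have CC: "C y = y" if "topfree s n y" "botfree s n y" for y
    using botfree_mult_JW[OF that(2) f_JW] JW_mult_topfree[OF that(1) f_JW] by (simp add: C_def)
  have "{p, q, r} \<subseteq> span T"
    using CT[of p] CT[of q] CT[of r] CC free p1 q1 r1 by auto
  have "C x \<in> span {p, q, r}"
  proof (rule ccontr)
    assume n: "C x \<notin> span {p, q, r}"
    then have i: "independent (insert (C x) {p, q, r})" using independent_pqr(1) independent_insertI by blast
    have sub: "insert (C x) {p, q, r} \<subseteq> span T" using CT[OF x] \<open>{p, q, r} \<subseteq> span T\<close> by blast
    have fT: "finite T" by (simp add: T_def)
    have "card (insert (C x) {p, q, r}) \<le> card T"
      using independent_span_bound[OF fT i sub] by (rule conjunct2)
    moreover have "C x \<notin> {p, q, r}"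
    proof
      assume "C x \<in> {p, q, r}"
      then have "C x \<in> span {p, q, r}" by (rule span_base)
      then show False using n by contradiction
    qed
    then have "card (insert (C x) {p, q, r}) = Suc (card {p, q, r})" by (intro card_insert_disjoint finite.intros)
    then have "card (insert (C x) {p, q, r}) = 4" using independent_pqr(2) by (simp only:) 
    moreover have "card T \<le> 3" unfolding T_def by (simp add: card_insert_if)
    ultimately show False by simp
  qed
  then show ?thesis unfolding C_def span_pqr .
qed

lemma free_coeffs:
  assumes "topfree s n x" "botfree s n x" shows "\<exists>a b c. x = sm a p + sm b q + sm c r"
  using corner[OF topfree_V[OF assms(1)]] botfree_mult_JW[OF assms(2) f_JW] JW_mult_topfree[OF assms(1) f_JW] by simp

lemma sum_eq: "p + q + r = f"
proof -
  obtain a b c where abc: "f = sm a p + sm b q + sm c r"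
    using free_coeffs[of f] f_JW JW_botfree[OF f_JW] by (auto simp: JW_def)
  have "sm a p = sm 1 p" "sm b q = sm 1 q" "sm c r = sm 1 r"
    using comb_mult(1-3)[OF abc] botfree_mult_JW[OF free(4) f_JW] botfree_mult_JW[OF free(5) f_JW] botfree_mult_JW[OF free(6) f_JW]
    by simp_all
  then have "a = 1" "b = 1" "c = 1" using p1 q1 r1 scale_right_imp_eq by blast+
  then show ?thesis using abc by simp
qed

text \<open>
  The isomorphisms can be compressed to the corner of f, which is commutative by
  \<open>corner\<close>.  Therefore isomorphic minimal projections in it are equal, and duality, which is
  given only on isomorphism classes, permutes p, q and r themselves.
\<close>

lemma iso_eq:
  assumes x: "x = p \<or> x = q \<or> x = r" and y: "minimal_projection P (s, n, y)" and i: "iso s n x n y"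
  shows "y = x"
proof -
  have xm: "minimal_projection P (s, n, x)" and xd: "depth P s (vertex P (s, n, x)) = n" using x minimal depths by blast+
  have yd: "depth P s (vertex P (s, n, y)) = n" using xd vertex_eq_iff[OF xm y] i by simp
  note x1 = minimalD[OF xm] and y1 = minimalD[OF y]
  note xf = depth_botfree[OF xm xd] and yf = depth_botfree[OF y yd]
  obtain F G where F: "tangle s n F n" "tangle s n G n" "eqv s n n (F @ G) [Box 0 n x]" "eqv s n n (G @ F) [Box 0 n y]"
    using i unfolding iso_def by blast
  define u where "u = act P s n F"
  define v where "v = act P s n G"
  have uv: "u \<in> V n s" "v \<in> V n s" unfolding u_def v_def using F act_in by auto
  have vu: "mul s n v u = x" and uv': "mul s n u v = y"
    using act_append[OF F(1,2)] act_append[OF F(2,1)] eqv_act[OF F(3)] eqv_act[OF F(4)] x1 y1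
    by (simp_all add: u_def v_def act_identity)
  have commute: "mul s n x (mul s n (mul s n f (mul s n z f)) y) = sm a (mul s n x y)"
    if "mul s n f (mul s n z f) = sm a' p + sm b' q + sm c' r" "a = (if x = p then a' else if x = q then b' else c')" for z a a' b' c'
  proof -
    define w where "w = mul s n f (mul s n z f)"
    have "mul s n x w = sm a x" unfolding w_def using comb_mult(1-3)[OF that(1)] x that(2) by auto
    moreover have "w \<in> V n s" unfolding w_def that(1) using p1 q1 r1 by (intro V_add V_scale)
    ultimately show ?thesis using x1 y1 by (simp add: mult_simps w_def flip: mult_assoc)
  qed
  (* Otherwise x = x (v u) (v u) = x v y u = x (f v f) y u would have the factor x y, since x can be moved past
     f v f. *)
  have xy0: "mul s n x y \<noteq> 0"
  proof
    assume z: "mul s n x y = 0"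
    obtain a' b' c' where c: "mul s n f (mul s n v f) = sm a' p + sm b' q + sm c' r" using corner[OF uv(2)] by blast
    have "x = mul s n x (mul s n x x)" using x1 by simp
    also have "\<dots> = mul s n x (mul s n (mul s n v u) (mul s n v u))" using vu by simp
    also have "\<dots> = mul s n x (mul s n v (mul s n y u))" unfolding uv'[symmetric] using uv by (simp add: mult_assoc mult_in)
    also have "\<dots> = mul s n (mul s n x f) (mul s n v (mul s n (mul s n f y) u))"
      using botfree_mult_JW[OF xf(1) f_JW] JW_mult_topfree[OF yf(2) f_JW] by simp
    also have "\<dots> = mul s n (mul s n x (mul s n (mul s n f (mul s n v f)) y)) u"
      using x1 y1 uv f_V by (simp add: mult_assoc mult_in)
    also have "\<dots> = 0" using commute[OF c refl] z uv by simp
    finally show False using x1 by simp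
  qed
  obtain a b c where abc: "y = sm a p + sm b q + sm c r" using free_coeffs[OF yf(2,1)] by blast
  define e where "e = (if x = p then a else if x = q then b else c)"
  have xy: "mul s n x y = sm e x" "mul s n y x = sm e x"
    using comb_mult[OF abc] x by (auto simp: e_def)
  have "e \<noteq> 0" using xy0 xy by auto
  have "sm (e * e) x = sm e x"
  proof -
    have "sm (e * e) x = mul s n (mul s n x y) y" using xy x1 y1 by (simp add: mult_simps)
    also have "\<dots> = mul s n x y" using x1 y1 mult_assoc[of x n s y y] by simp
    also have "\<dots> = sm e x" by (rule xy(1))
    finally show ?thesis .
  qed
  then have "e = 1" using x1(4) \<open>e \<noteq> 0\<close> scale_right_imp_eq by fastforce
  then have xy': "mul s n x y = x" "mul s n y x = x" using xy by simp_all
  obtain g where g: "mul s n y (mul s n x y) = sm g y" using y1(5)[OF x1(1)] by blast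
  then have xg: "x = sm g y" using xy' by simp
  then have "sm (g * g) y = sm g y" using x1(3) y1 by (simp add: mult_simps V_scale)
  then have "g * g = g" using y1(4) scale_right_imp_eq by blast
  moreover have "g \<noteq> 0" using xg x1(4) by auto
  ultimately show ?thesis using xg by simp
qed

lemma dl_pqr: "dl s n p = p" "dl s n q = r" "dl s n r = q"
proof -
  have c: "cross n s = s" using n_even by (rule cross_even)
  have du: "dual P (s, n, x) = (s, n, dl s n x)" for x by (simp add: dl_def c)
  have *: "dl s n x = y" if "dual_vertex P (vertex P (s, n, x)) = vertex P (s, n, y)" "minimal_projection P (s, n, x)" "y = p \<or> y = q \<or> y = r" for x y
  proof -
    have ym: "minimal_projection P (s, n, y)" using that(3) minimal by blast
    have "dual P (s, n, x) \<in> vertex P (s, n, y)" 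
      unfolding that(1)[symmetric] dual_vertex_def by (rule imageI[OF vertex_self[OF that(2)]])
    then have "minimal_projection P (s, n, dl s n x)" "iso s n y n (dl s n x)"
      using vertex_iff[OF ym] unfolding du by blast+
    then show ?thesis using iso_eq that(3) by blast
  qed
  have "dual_vertex P (vertex P (s, n, p)) = vertex P (s, n, p)"
    "dual_vertex P (vertex P (s, n, q)) = vertex P (s, n, r)"
    "dual_vertex P (vertex P (s, n, r)) = vertex P (s, n, q)"
    using Q_at unfolding Q_at_def by blast+
  then show "dl s n p = p" "dl s n q = r" "dl s n r = q"
    using *[of p p] *[of q r] *[of r q] minimal by simp_all
qed

text \<open>
  The partial trace of an uncuppable element is uncuppable as well, hence by supertransitivity a multiple
  of the Jones-Wenzl projection.  The multiple is found by taking traces.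
\<close>

lemma E_topfree: 
  assumes x: "topfree s n x"
  shows "E s (n - 1) x = sm (Tr P s n x / complex_of_real (qreal d n)) (jw s (n - 1))"
proof -
  obtain m where m: "n = Suc m" using n2 by (metis Suc_le_D numeral_2_eq_2)
  have xV: "x \<in> V (Suc m) s" using topfree_V[OF x] m by simp
  have Ex: "E s m x \<in> V m s" using E_in[OF xV] .
  have JWm: "JW s m (jw s m)" using jw_facts(3) m by simp
  have "topfree s m (E s m x)"
    unfolding topfree_def
  proof (intro conjI Ex allI impI)
    fix j assume j: "j + 2 \<le> m"
    have "eqv s m (m - 2) ([] @ [Box 0 m (E s m x)] @ [Cap j]) ([] @ [Cup m, Box 0 (Suc m) x, Cap m] @ [Cap j])"
      unfolding E_def by (rule eqv_expand_0) (use xV j in \<open>auto intro!: act_in\<close>)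
    also have "eqv s m (m - 2) \<dots> ([Cup m] @ [Box 0 (Suc m) x, Cap j] @ [Cap (m - 2)])"
      by (rule eqv_slides[where js = "[2]"]) (use xV j in \<open>simp_all add: numeral_2_eq_2\<close>)
    finally have e: "eqv s m (m - 2) [Box 0 m (E s m x), Cap j] ([Cup m] @ [Box 0 (Suc m) x, Cap j] @ [Cap (m - 2)])" by simp
    have "null s (Suc m) (Suc m - 2) [Box 0 (Suc m) x, Cap j]" using x j by (simp add: topfree_def m)
    then have "null s m (m - 2) ([Cup m] @ [Box 0 (Suc m) x, Cap j] @ [Cap (m - 2)])"
      by (rule null_context_0[of _ _ _ _ _ _ 1]) (use j in auto)
    then show "null s m (m - 2) [Box 0 m (E s m x), Cap j]" using null_eqv[OF e] by simp
  qed
  then have "mul s m (jw s m) (E s m x) = E s m x" by (rule JW_mult_topfree[OF _ JWm])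
  moreover obtain c where "E s m x - sm c (one s m) \<in> J s m"
    using supertransitive_one_J[OF st _ Ex] m by auto
  ultimately have c: "E s m x = sm c (jw s m)" using JW_mult_one_J[OF JWm Ex] by simp
  have "Tr P s m (jw s m) = complex_of_real (qreal d (Suc m))"
    using jw_properties[OF one_notin_J, of m] n2 m by simp
  then have "Tr P s n x = c * complex_of_real (qreal d n)"
    using Tr_E[OF xV] c Tr_scale[OF JW_V[OF JWm]] m by simp
  moreover have "qreal d n \<noteq> 0" using jw_facts(2)[of n] n2 by simp
  ultimately show ?thesis using c m by simp
qed

definition t :: real where "t = Re (Tr P s n p)"
definition ratio :: real where "ratio = 2 * Re (Tr P s n q) / Re (Tr P s n p)"
definition A :: 'v where "A = sm (complex_of_real ratio) p - (q + r)"

lemma Tr_p: "Tr P s n p = complex_of_real t" "t > 0"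
  using Tr_projection_pos[of s n p] minimal(1) by (auto simp: t_def)

lemma Tr_r_eq: "Tr P s n r = Tr P s n q"
  using Tr_dl[of q n s] q1 dl_pqr n_even by (simp add: cross_even)

lemma Tr_q: "Tr P s n q = complex_of_real (ratio * t / 2)" "ratio > 0"
proof -
  obtain u where u: "u > 0" "Tr P s n q = complex_of_real u" using Tr_projection_pos[of s n q] minimal(2) by auto
  then have "ratio = 2 * u / t" by (simp add: ratio_def t_def)
  then show "Tr P s n q = complex_of_real (ratio * t / 2)" "ratio > 0" using u Tr_p(2) by simp_all
qed

text \<open>
  The trace of p + q + r = f is [n+1].
\<close>

lemma t_ratio: "t * (1 + ratio) = qreal d (Suc n)"
proof -
  have "complex_of_real (qreal d (Suc n)) = Tr P s n p + Tr P s n q + Tr P s n r"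
    using jw_facts(4) p1 q1 r1 unfolding sum_eq[symmetric] by (simp add: Tr_add V_add)
  also have "\<dots> = complex_of_real (t * (1 + ratio))"
    using Tr_p Tr_q Tr_r_eq by (simp add: algebra_simps)
  finally show ?thesis by (simp only: of_real_eq_iff)
qed

lemma A_comb: "A = sm (complex_of_real ratio) p + sm (- 1) q + sm (- 1) r"
  by (simp add: A_def)

lemma A_V: "A \<in> V n s"
  unfolding A_comb using p1 q1 r1 by (intro V_add V_scale)

lemma A_star: "star P A = A"
  unfolding A_comb using p1 q1 r1 by (simp add: star_add[of _ n s] star_diff[of _ n s] star_scale[of _ n s] V_add V_scale V_diff flip: scale_minus_left)

lemma A_topfree: "topfree s n A"
  using topfree_comb[OF topfree_comb[OF free(1,2)] free(3), of 1 "complex_of_real ratio" "- 1" "- 1"] by (simp add: A_comb)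

lemma A_botfree: "botfree s n A"
  using topfree_star[OF A_topfree] A_star by simp

lemma A_dl: "dl s n A = A"
proof -
  have "dl s n (sm (complex_of_real ratio) p - (q + r)) = sm (complex_of_real ratio) p - (r + q)"
    using p1 q1 r1 dl_pqr by (simp add: lin_diff[OF lin_dl] lin_add[OF lin_dl] lin_scale[OF lin_dl] V_add V_scale)
  then show ?thesis by (simp add: A_def add.commute)
qed

lemma A_E: "E s (n - 1) A = 0"
proof -
  have "Tr P s n A = 0" unfolding A_def using p1 q1 r1
    by (simp add: Tr_diff Tr_add Tr_scale V_add V_scale Tr_p(1) Tr_q(1) Tr_r_eq)
  then show ?thesis using E_topfree[OF A_topfree] by simp
qed

lemma A_El: "El s (n - 1) A = 0"
proof -
  obtain m where m: "n = Suc m" using n2 by (metis Suc_le_D numeral_2_eq_2)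
  have c: "cross (Suc m) s = s" using n_even m by (metis cross_even)
  have AV: "A \<in> V (Suc m) s" using A_V m by simp
  have "El s m A = El (cross (Suc m) s) m (dl s (Suc m) A)" using A_dl m c by simp
  also have "\<dots> = dl s m (E s m A)" by (rule El_dl[OF AV])
  also have "\<dots> = 0" using A_E m lin_0[OF lin_dl] by simp
  finally show ?thesis using m by simp
qed

lemma A_mult: "mul s n q A = - q" "mul s n A q = - q" "mul s n p A = sm (complex_of_real ratio) p"
  using comb_mult[OF A_comb] by simp_all

lemma A_nonzero: "A \<noteq> 0"
  using A_mult(1) q1 by auto

lemma p_eq: "sm (complex_of_real (1 + ratio)) p = A + f"
  unfolding A_def sum_eq[symmetric] by (simp add: scale_left_distrib algebra_simps)

lemma Tr_AA: "Tr P s n (mul s n A A) = complex_of_real (ratio * qreal d (Suc n))"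
proof -
  have "mul s n A A = sm (complex_of_real ratio) (sm (complex_of_real ratio) p) + q + r"
    using comb_mult(4-6)[OF A_comb] A_V p1 q1 r1 by (subst (2) A_comb) (simp add: mult_simps V_add V_scale V_diff)
  then have "Tr P s n (mul s n A A) = complex_of_real (ratio * (t * (1 + ratio)))"
    using p1 q1 r1 by (simp add: Tr_add Tr_scale V_add V_scale Tr_p(1) Tr_q(1) Tr_r_eq algebra_simps)
  then show ?thesis by (simp only: t_ratio)
qed

text \<open>
  By Wenzl's formula Y is the part of p with an added string that is orthogonal to everything with
  at most n - 1 strings in the middle.  \<open>B1 / kap\<close> is the part isomorphic to the
  Jones-Wenzl projection on n - 1 strings.
\<close>

definition kap :: real where "kap = t / qreal d n"
definition A1 :: 'v where "A1 = act P s (Suc n) [Box 0 n p]"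
definition B1 :: 'v where "B1 = act P s (Suc n) [Box 0 n p, Cap (n - 1), Cup (n - 1), Box 0 n p]"
definition Y :: 'v where "Y = A1 - sm (complex_of_real (1 / kap)) B1"

lemma kap_pos: "kap > 0"
  unfolding kap_def using Tr_p jw_facts(2)[of n] n2 by simp

lemma E_p: "E s (n - 1) p = sm (complex_of_real kap) (jw s (n - 1))"
  using E_topfree[OF free(1)] Tr_p by (simp add: kap_def)

lemma tangle_A1: "tangle s (Suc n) [Box 0 n p] (Suc n)"
  and tangle_B1: "tangle s (Suc n) [Box 0 n p, Cap (n - 1), Cup (n - 1), Box 0 n p] (Suc n)"
  using p1 n2 by auto

lemma A1_V: "A1 \<in> V (Suc n) s"
  unfolding A1_def by (rule act_in[OF tangle_A1])

lemma B1_V: "B1 \<in> V (Suc n) s"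
  unfolding B1_def by (rule act_in[OF tangle_B1])

lemma Y_V: "Y \<in> V (Suc n) s"
  unfolding Y_def using A1_V B1_V by (intro V_diff V_scale)

lemma Y_star: "star P Y = Y"
proof -
  have "star P A1 = A1" "star P B1 = B1"
    unfolding A1_def B1_def star_act[OF tangle_A1] star_act[OF tangle_B1] using p1 by simp_all
  then show ?thesis unfolding Y_def
    using A1_V B1_V by (simp add: star_diff[of _ "Suc n" s] star_scale[of _ "Suc n" s] V_scale)
qed

lemma Y_topfree: "topfree s (Suc n) Y"
proof -
  obtain m where m: "n = Suc m" using n2 by (metis Suc_le_D numeral_2_eq_2)
  then have nm: "n - 1 = m" by simp
  define kp where "kp = kap"
  have Y_eq: "Y = act P s (Suc n) [Box 0 n p] - sm (complex_of_real (1 / kp)) (act P s (Suc n) [Box 0 n p, Cap (n - 1), Cup (n - 1), Box 0 n p])"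
    unfolding Y_def A1_def B1_def kp_def by (rule refl)
  have E: "E s m p = sm (complex_of_real kp) (jw s m)" and JWm: "JW s m (jw s m)" and kp: "kp \<noteq> 0"
    using E_p jw_facts(3) kap_pos unfolding kp_def nm by simp_all
  show ?thesis
    unfolding Y_eq nm unfolding m by (rule wenzl_topfree[OF _ JWm E kp]) (use free(1) m in simp)
qed

lemma Y_botfree: "botfree s (Suc n) Y"
  using topfree_star[OF Y_topfree] Y_star by simp

lemma Y_A1: "mul s (Suc n) Y A1 = Y"
proof -
  have pp: "eqv s (Suc n) (Suc n) ([Box 0 n p] @ [Box 0 n p]) [Box 0 n p]"
    using eqv_idem[OF minimal_idem[OF minimal(1)], of "Suc n"] by simp
  have "mul s (Suc n) A1 A1 = act P s (Suc n) ([Box 0 n p] @ [Box 0 n p])"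
    unfolding A1_def using act_append[OF tangle_A1 tangle_A1] by simp
  also have "\<dots> = A1" unfolding A1_def by (rule eqv_act[OF pp])
  finally have 1: "mul s (Suc n) A1 A1 = A1" .
  have "mul s (Suc n) B1 A1 = act P s (Suc n) (([Box 0 n p] @ [Box 0 n p]) @ [Cap (n - 1), Cup (n - 1), Box 0 n p])"
    unfolding A1_def B1_def using act_append[OF tangle_A1 tangle_B1] by simp
  also have "\<dots> = act P s (Suc n) ([Box 0 n p] @ [Cap (n - 1), Cup (n - 1), Box 0 n p])"
    by (rule eqv_act[OF eqv_suffix[OF pp]]) (use p1 n2 in auto)
  finally have 2: "mul s (Suc n) B1 A1 = B1" by (simp add: B1_def)
  show ?thesis unfolding Y_def using A1_V B1_V 1 2 by (simp add: mult_simps V_scale)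
qed

lemma eqv_pY: "eqv s (Suc n) (Suc n) [Box 0 n p, Box 0 (Suc n) Y] [Box 0 (Suc n) Y]"
proof -
  have "eqv s (Suc n) (Suc n) ([Box 0 n p] @ [Box 0 (Suc n) Y]) ([Box 0 (Suc n) A1] @ [Box 0 (Suc n) Y])"
    unfolding A1_def by (rule eqv_suffix[OF eqv_sym[OF eqv_Box_act[OF tangle_A1 order_refl]]]) (use Y_V in simp)
  also have "eqv s (Suc n) (Suc n) \<dots> [Box 0 (Suc n) (mul s (Suc n) Y A1)]"
    using eqv_sym[OF eqv_Box_mult_0[OF Y_V A1_V order_refl]] by simp
  finally show ?thesis using Y_A1 by simp
qed

lemma Y_projection: "is_projection P (s, Suc n, Y)"
proof -
  have "eqv s (Suc n) (Suc n) ([Box 0 n p, Cap (n - 1), Cup (n - 1)] @ [Box 0 n p, Box 0 (Suc n) Y]) ([Box 0 n p, Cap (n - 1), Cup (n - 1)] @ [Box 0 (Suc n) Y])"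
    by (rule eqv_prefix[OF _ eqv_pY]) (use p1 n2 in auto)
  moreover have "null s (Suc n) (Suc n) ([Box 0 n p, Cap (n - 1)] @ [Cup (n - 1), Box 0 (Suc n) Y])"
    by (rule null_append_left[of _ "Suc n - 2"]) (use Y_botfree p1 n2 in \<open>auto simp: botfree_def\<close>)
  ultimately have "act P s (Suc n) ([Box 0 n p, Cap (n - 1), Cup (n - 1), Box 0 n p] @ [Box 0 (Suc n) Y]) = 0"
    by (auto simp: null_diag dest: eqv_act)
  then have "mul s (Suc n) Y B1 = 0"
    using act_append[OF tangle_B1, of "[Box 0 (Suc n) Y]"] Y_V by (simp add: B1_def act_identity)
  then have "mul s (Suc n) Y (A1 - sm (complex_of_real (1 / kap)) B1) = Y"
    using Y_A1 Y_V A1_V B1_V by (simp add: mult_simps V_scale)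
  moreover have "mul s (Suc n) Y Y = mul s (Suc n) Y (A1 - sm (complex_of_real (1 / kap)) B1)"
    by (subst (2) Y_def) (rule refl)
  ultimately show ?thesis using Y_V Y_star by simp
qed

text \<open>
  The product of p and g again annihilates cups, by \<open>depth_null\<close>; so it lies in the
  corner of f.
\<close>

lemma p_mult: assumes g: "g \<in> V n s" shows "\<exists>c. mul s n p g = sm c p"
proof -
  have pg: "mul s n p g \<in> V n s" using p1 g by (simp add: mult_in)
  have "botfree s n (mul s n p g)"
    unfolding botfree_def
  proof (intro conjI pg allI impI)
    fix j assume j: "j + 2 \<le> n"
    have "eqv s (n - 2) n ([Cup j] @ [Box 0 n (mul s n p g)]) ([Cup j] @ [Box 0 n g, Box 0 n p])"
      by (rule eqv_prefix[OF _ eqv_Box_mult_0]) (use j p1 g in auto)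
    moreover have "null s (n - 2) n ([Cup j, Box 0 n g] @ [Box 0 n p])"
      by (rule depth_null[OF minimal(1) depths(1)]) (use j g n2 in auto)
    ultimately show "null s (n - 2) n [Cup j, Box 0 n (mul s n p g)]" using null_eqv by fastforce
  qed
  then have "mul s n p g = mul s n (mul s n p g) f" using botfree_mult_JW f_JW by simp
  also have "\<dots> = mul s n (mul s n (mul s n p f) g) f" using botfree_mult_JW[OF free(4) f_JW] by simp
  also have "\<dots> = mul s n p (mul s n f (mul s n g f))" using p1 g f_V by (simp add: mult_assoc mult_in)
  finally show ?thesis using corner[OF g] comb_mult(1) by metis
qed

text \<open>
  This says that Y annihilates every diagram that comes from fewer than n + 1 strings, since
  such a diagram consists of some cups, the last of which is kept here, and one box on at most n strings.
\<close>

lemma Y_kills: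
  assumes g: "g \<in> V m s" and m: "1 \<le> m" "m \<le> n"
  shows "null s (n - 1) (Suc n) [Cup (m - 1), Box 0 m g, Box 0 (Suc n) Y]"
proof -
  have "eqv s (n - 1) (Suc n) ([Cup (m - 1), Box 0 m g] @ [Box 0 n p, Box 0 (Suc n) Y]) ([Cup (m - 1), Box 0 m g] @ [Box 0 (Suc n) Y])"
    by (rule eqv_prefix[OF _ eqv_pY]) (use g m n2 in auto)
  then have e: "eqv s (n - 1) (Suc n) [Cup (m - 1), Box 0 m g, Box 0 n p, Box 0 (Suc n) Y] [Cup (m - 1), Box 0 m g, Box 0 (Suc n) Y]" by simp
  have "null s (n - 1) (Suc n) [Cup (m - 1), Box 0 m g, Box 0 n p, Box 0 (Suc n) Y]"
  proof (cases "m < n")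
    case True
    have "null s (n - 2) n ([Cup (m - 1), Box 0 m g] @ [Box 0 n p])"
      by (rule depth_null[OF minimal(1) depths(1)]) (use m g n2 True in auto)
    then have "null s (n - 1) (Suc n) ([] @ ([Cup (m - 1), Box 0 m g] @ [Box 0 n p]) @ [Box 0 (Suc n) Y])"
      by (rule null_context_0[of _ _ _ _ _ _ 1]) (use n2 Y_V in auto)
    then show ?thesis by simp
  next
    case False
    then have mn: "m = n" using m by simp
    obtain c where c: "mul s n p g = sm c p" using p_mult g mn by blast
    have "eqv s (Suc n) (Suc n) ([Box 0 n (mul s n p g)] @ [Box 0 (Suc n) Y]) ([Box 0 n g, Box 0 n p] @ [Box 0 (Suc n) Y])"
      by (rule eqv_suffix[OF eqv_Box_mult_0]) (use p1 g mn Y_V in auto)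
    then have "eqv s (n - 1) (Suc n) ([Cup (n - 1)] @ [Box 0 n (sm c p), Box 0 (Suc n) Y]) ([Cup (n - 1)] @ [Box 0 n g, Box 0 n p, Box 0 (Suc n) Y])"
      unfolding c by (intro eqv_prefix[of _ _ _ "Suc n"]) (use n2 in auto)
    then have v1: "val s (n - 1) (Suc n) [Cup (m - 1), Box 0 m g, Box 0 n p, Box 0 (Suc n) Y] = val s (n - 1) (Suc n) ([Cup (n - 1)] @ [Box 0 n (sm c p)] @ [Box 0 (Suc n) Y])"
      using mn by (auto dest: eqv_val)
    have "eqv s (n - 1) (Suc n) ([Cup (n - 1)] @ [Box 0 n p, Box 0 (Suc n) Y]) ([Cup (n - 1)] @ [Box 0 (Suc n) Y])"
      by (rule eqv_prefix[OF _ eqv_pY]) (use n2 in auto)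
    moreover have "null s (n - 1) (Suc n) ([Cup (n - 1)] @ [Box 0 (Suc n) Y])"
      using Y_botfree n2 by (simp add: botfree_def numeral_2_eq_2)
    ultimately have "val s (n - 1) (Suc n) ([Cup (n - 1)] @ [Box 0 n p] @ [Box 0 (Suc n) Y]) = 0"
      using null_eqv unfolding null_def by fastforce
    then have "val s (n - 1) (Suc n) ([Cup (n - 1)] @ [Box 0 n (sm c p)] @ [Box 0 (Suc n) Y]) = 0"
      using lin_scale[OF lin_val[of s "n - 1" "[Cup (n - 1)]" 0 n "[Box 0 (Suc n) Y]" "Suc n"], of p c] p1 Y_V n2 by simp
    then show ?thesis using v1 g p1 Y_V n2 mn by (simp add: null_def)
  qed
  then show ?thesis using null_eqv[OF e] by simp
qed

text \<open>
  Otherwise S would have a representative on fewer strings, and S would factor through a diagram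
  annihilated by Y.
\<close>

lemma below_Y_depth:
  assumes S: "minimal_projection P (s, Suc n, S)" "mul s (Suc n) Y S = S"
  shows "depth P s (vertex P (s, Suc n, S)) = Suc n"
proof (rule ccontr)
  assume ne: "depth P s (vertex P (s, Suc n, S)) \<noteq> Suc n"
  define t where "t = depth P s (vertex P (s, Suc n, S))"
  have tn: "t < Suc n" using ne depth_le[OF S(1)] by (simp add: t_def)
  note S1 = minimalD[OF S(1)]
  obtain u where u: "iso s t u (Suc n) S" using depth_attained[OF S(1)] unfolding t_def by blast
  then obtain F G where F: "tangle s t F (Suc n)" "tangle s (Suc n) G t" "eqv s (Suc n) (Suc n) (G @ F) [Box 0 (Suc n) S]"
    unfolding iso_def by blast
  define m where "m = (t + Suc n) div 2"
  have m2: "2 * m = t + Suc n" using wf_parity[OF F(1)] by (simp add: m_def)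
  define g where "g = val s t (Suc n) F"
  have gV: "g \<in> V m s" unfolding g_def m_def by (rule val_in[OF F(1)])
  have m: "1 \<le> m" "m \<le> n" "m - t = Suc (m - t - 1)" "m - Suc n = 0" "t + (m - t - 1) = m - 1" "t + 2 * (m - t - 1) = n - 1"
    using tn m2 by auto
  have dr: "draw t (Suc n) g = cups (m - t - 1) t @ [Cup (m - 1), Box 0 m g]"
    unfolding draw_def m_def[symmetric] Let_def m(4) using cups_Suc'[of "m - t - 1" t] m(3,5) by simp
  have "null s t (Suc n) (cups (m - t - 1) t @ [Cup (m - 1), Box 0 m g, Box 0 (Suc n) Y])"
    by (rule null_append_left[OF Y_kills[OF gV m(1,2)]]) (use m(6) in simp)
  then have "null s t (Suc n) (draw t (Suc n) g @ [Box 0 (Suc n) Y])" by (simp add: dr)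
  moreover have "eqv s t (Suc n) (draw t (Suc n) g @ [Box 0 (Suc n) Y]) (F @ [Box 0 (Suc n) Y])"
    unfolding g_def by (rule eqv_suffix[OF eqv_conjugate_draw[OF F(1)]]) (use Y_V in simp)
  ultimately have "null s t (Suc n) (F @ [Box 0 (Suc n) Y])" using null_eqv by blast
  then have "null s (Suc n) (Suc n) (G @ F @ [Box 0 (Suc n) Y])" by (rule null_append_left[OF _ F(2)])
  moreover have "eqv s (Suc n) (Suc n) ((G @ F) @ [Box 0 (Suc n) Y]) ([Box 0 (Suc n) S] @ [Box 0 (Suc n) Y])"
    by (rule eqv_suffix[OF F(3)]) (use Y_V in simp)
  ultimately have "null s (Suc n) (Suc n) ([Box 0 (Suc n) S] @ [Box 0 (Suc n) Y])" using null_eqv by (metis append.assoc)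
  then have "mul s (Suc n) Y S = 0" by (simp add: null_diag mult_def)
  then show False using S S1 by simp
qed

lemma below_Y_edge:
  assumes S: "minimal_projection P (s, Suc n, S)" "mul s (Suc n) Y S = S"
  shows "edges P (vertex P (s, n, p)) (vertex P (s, Suc n, S)) \<noteq> 0"
proof -
  note S1 = minimalD[OF S(1)]
  have "mul s (Suc n) S Y = S" using star_mult[OF Y_V S1(1)] S1 S(2) Y_star by simp
  then have SA: "mul s (Suc n) S A1 = S" using Y_A1 S1 A1_V Y_V by (metis mult_assoc)
  have "eqv s (Suc n) (Suc n) ([Box 0 n p] @ [Box 0 (Suc n) S]) ([Box 0 (Suc n) A1] @ [Box 0 (Suc n) S])"
    unfolding A1_def by (rule eqv_suffix[OF eqv_sym[OF eqv_Box_act[OF tangle_A1 order_refl]]]) (use S1 in simp)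
  then have "act P s (Suc n) ([Box 0 n p] @ [Box 0 (Suc n) S]) = S"
    using SA by (auto simp: mult_def dest: eqv_act)
  then have "\<not> null s (Suc n) (Suc n) ([Box 0 n p] @ [] @ [Box 0 (Suc n) S])"
    using S1 by (simp add: null_diag)
  then show ?thesis
    unfolding edges_nonzero_iff[OF rep_of_vertex[OF minimal(1)] rep_of_vertex[OF S(1)]]
    by (intro exI[of _ "[]"]) simp
qed

end

section \<open>Comparing the two principal graphs\<close>

locale quadruple_point = subfactor_planar_algebra P d +
  plus: quadruple_shading P d n Plus p q r + minus: quadruple_shading P d n Minus p' q' r'
  for P :: "'v::ab_group_add planar_data" and d :: real and n :: nat and p q r p' q' r' :: 'v
begin

lemma n_Suc: obtains m where "n = Suc m" "1 \<le> m" "n - 1 = m" "n - 2 = m - 1"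
  using plus.n2 that[of "n - 1"] by fastforce

lemma n1: "1 \<le> n"
  using plus.n2 by simp

lemma cross_n: "cross n s = s" and cross_Suc_n: "cross (Suc n) s = opposite s"
  using plus.n_even by (simp_all add: cross_even)

text \<open>
  The rotated A is uncuppable, because A is and has vanishing partial traces on both sides.  So it is a
  combination of p', q' and r'; being fixed by duality and of trace zero it is a multiple of A'.
\<close>

lemma rotation_A: "\<exists>z. rotation P Plus n plus.A = sm z minus.A"
proof -
  obtain m where m: "n = Suc m" "1 \<le> m" "n - 1 = m" "n - 2 = m - 1" using n_Suc .
  define B where "B = rotation P Plus n plus.A"
  have AV: "plus.A \<in> V (Suc m) Plus" using plus.A_V m by simp
  have BV: "B \<in> V n Minus" unfolding B_def using rotation_in[OF plus.A_V n1] by simp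
  have top: "topfree Minus n B"
    unfolding topfree_def
  proof (intro conjI BV allI impI)
    fix j assume j: "j + 2 \<le> n"
    show "null Minus n (n - 2) [Box 0 n B, Cap j]"
    proof (cases j)
      case 0
      have "El Plus m plus.A = 0" using plus.A_El m(3) by simp
      then show ?thesis using rotation_cap_0[OF AV _ m(2)] 0 by (simp add: B_def m(1))
    next
      case (Suc i)
      have "null Plus n (n - 2) [Box 0 n plus.A, Cap i]" using plus.A_topfree Suc j by (simp add: topfree_def)
      then show ?thesis using rotation_cap_Suc[OF plus.A_V, of i] Suc j by (simp add: B_def)
    qed
  qed
  have bot: "botfree Minus n B"
    unfolding botfree_def
  proof (intro conjI BV allI impI)
    fix j assume j: "j + 2 \<le> n"
    have "E Plus m plus.A = 0" using plus.A_E m(3) by simp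
    then show "null Minus (n - 2) n [Cup j, Box 0 n B]"
      using rotation_cup[of Plus m plus.A j] plus.A_botfree j by (simp add: B_def m(1))
  qed
  obtain a b c where abc: "B = sm a p' + sm b q' + sm c r'" using minus.free_coeffs[OF top bot] by blast
  have "dl Minus n B = B"
    using rotation_dl[OF plus.A_V n1] plus.A_dl by (simp add: cross_n B_def)
  moreover have "dl Minus n B = sm a p' + sm c q' + sm b r'"
    unfolding abc using minus.p1 minus.q1 minus.r1 minus.dl_pqr
    by (simp add: lin_add[OF lin_dl] lin_scale[OF lin_dl] V_add V_scale add.commute add.left_commute)
  ultimately have B2: "B = sm a p' + sm c q' + sm b r'" by metis
  have "sm b q' = sm c q'"
    using minus.comb_mult(2)[OF abc] minus.comb_mult(2)[OF B2] by metis
  then have cb: "c = b" using minus.q1(4) scale_right_imp_eq by metis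
  have "E Minus m B = 0" using E_rotation[of Plus m plus.A] plus.A_topfree m by (simp add: B_def)
  then have "Tr P Minus n B = 0" using Tr_E[of B m Minus] BV m by simp
  then have "a * complex_of_real minus.t + b * complex_of_real (minus.ratio * minus.t) = 0"
    unfolding abc cb using minus.p1 minus.q1 minus.r1
    by (simp add: Tr_add Tr_scale V_add V_scale minus.Tr_p(1) minus.Tr_q(1) minus.Tr_r_eq ac_simps)
  then have "complex_of_real minus.t * (a + b * complex_of_real minus.ratio) = 0" by (simp add: algebra_simps)
  then have "a + b * complex_of_real minus.ratio = 0" using minus.Tr_p(2) by simp
  then have a: "a = - (b * complex_of_real minus.ratio)" by (simp add: eq_neg_iff_add_eq_0)
  have "B = sm (- b) minus.A"
    unfolding abc a cb minus.A_def by (simp add: scale_right_diff_distrib scale_right_distrib)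
  then show ?thesis unfolding B_def by blast
qed

lemma rotation_A_norm:
  assumes z: "rotation P Plus n plus.A = sm z minus.A" and eq: "plus.ratio = minus.ratio"
  shows "z * cnj z = 1"
proof -
  obtain m where m: "n = Suc m" using n_Suc by metis
  define B where "B = rotation P Plus n plus.A"
  have "mul Minus n B (star P B) = sm (z * cnj z) (mul Minus n minus.A minus.A)"
    unfolding B_def z using minus.A_V minus.A_star by (simp add: star_scale mult_simps V_scale)
  then have "Tr P Minus n (mul Minus n B (star P B)) = z * cnj z * complex_of_real (minus.ratio * qreal d (Suc n))"
    using minus.A_V minus.Tr_AA by (simp add: Tr_scale mult_in)
  moreover have "Tr P Minus n (mul Minus n B (star P B)) = complex_of_real (plus.ratio * qreal d (Suc n))"
    using Tr_rotation_mult_star[of plus.A m Plus] plus.A_V plus.A_star plus.Tr_AA by (simp add: B_def m)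
  moreover have "minus.ratio * qreal d (Suc n) \<noteq> 0" using minus.Tr_q(2) minus.jw_facts(2)[of "Suc n"] by simp
  ultimately show ?thesis using eq by simp
qed

text \<open>
  From (ratio + 1) p = A + f and q' A' = - q'; the rotation of f acts on q' = q' f' by the
  scalar in \<open>jw_rotation_jw\<close>, whose sign is negative because n - 1 is odd.
\<close>

lemma qprime_rotation_p:
  assumes z: "rotation P Plus n plus.A = sm z minus.A"
  defines "\<gamma> \<equiv> (complex_of_real (- 1 / qreal d n) - z) / complex_of_real (1 + plus.ratio)"
  shows "mul Minus n q' (rotation P Plus n p) = sm \<gamma> q'"
proof -
  define c where "c = complex_of_real (- 1 / qreal d n)"
  note lin = lin_rotation[OF n1, of Plus]
  note q' = minus.q1
  have Rf: "rotation P Plus n plus.f \<in> V n Minus" and Rp: "rotation P Plus n p \<in> V n Minus"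
    using rotation_in[OF plus.f_V n1] rotation_in[OF plus.p1(1) n1] by simp_all
  have "JW t i (jw t i)" if "1 \<le> i" "i \<le> n" for i t
    using plus.jw_facts(1)[OF that] minus.jw_facts(1)[OF that] by (cases t) auto
  moreover have "qreal d i \<noteq> 0" if "1 \<le> i" "i \<le> n" for i
    using plus.jw_facts(2)[of i] that by simp
  ultimately have "mul Minus n minus.f (rotation P Plus n plus.f) = sm (complex_of_real ((- 1) ^ (n - 1) / qreal d n)) minus.f"
    using jw_rotation_jw[of n n Plus] n1 by simp
  moreover have "odd (n - 1)" using plus.n_even n1 by simp
  ultimately have fc: "mul Minus n minus.f (rotation P Plus n plus.f) = sm c minus.f" by (simp add: c_def)
  have qf: "mul Minus n q' minus.f = q'" by (rule botfree_mult_JW[OF minus.free(5) minus.f_JW])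
  have "mul Minus n q' (rotation P Plus n plus.f) = mul Minus n (mul Minus n q' minus.f) (rotation P Plus n plus.f)"
    by (simp add: qf)
  also have "\<dots> = mul Minus n q' (sm c minus.f)" using q' Rf minus.f_V fc by (simp add: mult_assoc)
  also have "\<dots> = sm c q'" using q' minus.f_V qf by (simp add: mult_simps)
  finally have qRf: "mul Minus n q' (rotation P Plus n plus.f) = sm c q'" .
  have "sm (complex_of_real (1 + plus.ratio)) (rotation P Plus n p) = sm z minus.A + rotation P Plus n plus.f"
    using lin_scale[OF lin plus.p1(1)] lin_add[OF lin plus.A_V plus.f_V] plus.p_eq z by metis
  then have "mul Minus n q' (sm (complex_of_real (1 + plus.ratio)) (rotation P Plus n p)) = mul Minus n q' (sm z minus.A + rotation P Plus n plus.f)"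
    by simp
  then have "sm (complex_of_real (1 + plus.ratio)) (mul Minus n q' (rotation P Plus n p)) = sm (c - z) q'"
    using q' Rp Rf minus.A_V qRf minus.A_mult(1) by (simp add: mult_simps V_scale scale_left_diff_distrib)
  then have "sm (1 / complex_of_real (1 + plus.ratio)) (sm (complex_of_real (1 + plus.ratio)) (mul Minus n q' (rotation P Plus n p))) = sm (1 / complex_of_real (1 + plus.ratio)) (sm (c - z) q')"
    by simp
  moreover have "complex_of_real (1 + plus.ratio) \<noteq> 0" using plus.Tr_q(2) by (metis add_pos_pos less_irrefl of_real_eq_0_iff zero_less_one)
  ultimately show ?thesis by (simp add: \<gamma>_def c_def)
qed

text \<open>
  This is where the hypothesis on the graphs enters: the duals of the projections below Y are
  orthogonal to q' with one more string.
\<close>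

lemma qprime_dl_Y:
  assumes hyp: "\<forall>S \<in> vertices_at P Plus (n + 1). edges P (vertex P (Plus, n, p)) S \<noteq> 0 \<longrightarrow>
           {T \<in> vertices_at P Minus n. edges P T (dual_vertex P S) \<noteq> 0} = {vertex P (Minus, n, p')}"
  shows "null Minus (Suc n) (Suc n) [Box 0 n q', Box 0 (Suc n) (dl Plus (Suc n) plus.Y)]"
proof -
  obtain Ss where Ss: "\<forall>S\<in>set Ss. minimal_projection P (Plus, Suc n, S) \<and> mul Plus (Suc n) plus.Y S = S"
    "sum_list Ss = plus.Y" using projection_sum_minimal[OF plus.Y_projection] by blast
  define h where "h x = val Minus (Suc n) (Suc n) ([Box 0 n q'] @ [Box 0 (Suc n) x] @ [])" for x
  have q'V: "q' \<in> V n Minus" using minus.q1 by simp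
  have linh: "lin (V (Suc n) Minus) h"
    unfolding h_def using lin_val[of Minus "Suc n" "[Box 0 n q']" 0 "Suc n" "[]" "Suc n"] q'V by simp
  have dlV: "dl Plus (Suc n) x \<in> V (Suc n) Minus" if "x \<in> V (Suc n) Plus" for x
    using dl_in[OF that] unfolding cross_Suc_n by simp
  have kill: "h (dl Plus (Suc n) S) = 0" if S: "S \<in> set Ss" for S
  proof -
    have Sm: "minimal_projection P (Plus, Suc n, S)" and SY: "mul Plus (Suc n) plus.Y S = S" using Ss(1) S by blast+
    have SV: "S \<in> V (Suc n) Plus" using minimalD(1)[OF Sm] .
    define X where "X = vertex P (Plus, Suc n, S)"
    have "X \<in> vertices_at P Plus (n + 1)"
      unfolding vertices_at_def vertices_iff X_def using Sm plus.below_Y_depth[OF Sm SY] by auto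
    moreover have "edges P (vertex P (Plus, n, p)) X \<noteq> 0" unfolding X_def by (rule plus.below_Y_edge[OF Sm SY])
    ultimately have eq: "{T \<in> vertices_at P Minus n. edges P T (dual_vertex P X) \<noteq> 0} = {vertex P (Minus, n, p')}"
      using hyp by blast
    have "vertex P (Minus, n, q') \<in> vertices_at P Minus n" "vertex P (Minus, n, q') \<noteq> vertex P (Minus, n, p')"
      using minus.Q_at unfolding Q_at_def by auto
    then have e0: "edges P (vertex P (Minus, n, q')) (dual_vertex P X) = 0" using eq by blast
    have rep: "rep_of Minus (Suc n) (dl Plus (Suc n) S) (dual_vertex P X)"
      unfolding rep_of_def
    proof (intro conjI ballI)
      show "idem Minus (Suc n) (dl Plus (Suc n) S)"
        using dl_idem[OF minimal_idem[OF Sm]] unfolding cross_Suc_n by simp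
      show "dual_vertex P X \<noteq> {}" using vertex_self[OF Sm] by (auto simp: dual_vertex_def X_def)
      fix x assume "x \<in> dual_vertex P X"
      then obtain y where y: "y \<in> X" "x = dual P y" unfolding dual_vertex_def by blast
      obtain t k u where tku: "y = (t, k, u)" by (cases y)
      have t: "t = Plus" and um: "minimal_projection P (Plus, k, u)" and i: "iso Plus (Suc n) S k u"
        using y(1) vertex_iff[OF Sm, of t k u] unfolding tku X_def by blast+
      have ck: "cross k Plus = Minus"
        using cross_cong[of k "Suc n" Plus] iso_parity[OF i] cross_Suc_n[of Plus] by (simp add: add.commute)
      have "x = (Minus, k, dl Plus k u)" using y(2) by (simp add: tku t ck dl_def)
      moreover have "idem Minus k (dl Plus k u)" using dl_idem[OF minimal_idem[OF um]] unfolding ck .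
      moreover have "iso Minus (Suc n) (dl Plus (Suc n) S) k (dl Plus k u)"
        using dl_iso[OF SV minimalD(1)[OF um] i] unfolding cross_Suc_n by simp
      ultimately show "\<exists>l q. x = (Minus, l, q) \<and> idem Minus l q \<and> iso Minus (Suc n) (dl Plus (Suc n) S) l q" by blast
    qed
    have t: "tangle Minus (Suc n) [] (Suc n)" by simp
    have "null Minus (Suc n) (Suc n) ([Box 0 n q'] @ [] @ [Box 0 (Suc n) (dl Plus (Suc n) S)])"
      using e0 edges_nonzero_iff[OF rep_of_vertex[OF minus.minimal(2)] rep] t by blast
    then show ?thesis by (simp add: null_def h_def)
  qed
  have SsV: "set Ss \<subseteq> V (Suc n) Plus" using Ss(1) minimalD(1) by blast
  have "dl Plus (Suc n) plus.Y = sum_list (map (dl Plus (Suc n)) Ss)"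
    using lin_sum_list[OF lin_dl SsV] Ss(2) by simp
  moreover have "h (sum_list (map (dl Plus (Suc n)) Ss)) = sum_list (map h (map (dl Plus (Suc n)) Ss))"
    using lin_sum_list[OF linh, of "map (dl Plus (Suc n)) Ss"] SsV dlV by auto
  moreover have "sum_list (map h (map (dl Plus (Suc n)) Ss)) = 0"
    using kill by (induction Ss) auto
  ultimately have "h (dl Plus (Suc n) plus.Y) = 0" by simp
  then show ?thesis using q'V dlV[OF plus.Y_V] by (simp add: null_def h_def)
qed

text \<open>
  Turning p with the added string gives the dual of p, which is p, with a string on the left.
\<close>

lemma turned_p: "eqv Minus (Suc n) (Suc n) (turned (Suc n) (Suc n) [Box 0 n p]) [Box 1 n p]"
proof -
  have pV: "p \<in> V n Plus" using plus.p1 by simp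
  have "eqv Minus (Suc n) (Suc n) (turned (Suc n) (Suc n) [Box 0 n p]) (map (shift 1) (turned n n [Box 0 n p]))"
    using turned_add_strand[of Plus n "[Box 0 n p]" n] pV unfolding cross_Suc_n by simp
  also have "eqv Minus (Suc n) (Suc n) \<dots> (map (shift 1) [Box 0 n p])"
    using eqv_shift[of 1 Minus n n "turned n n [Box 0 n p]" "[Box 0 n p]"] eqv_sym[OF eqv_Box_dl[OF pV]] plus.dl_pqr(1)
    by (simp add: cross_n)
  finally show ?thesis by simp
qed

lemma dl_Y:
  "dl Plus (Suc n) plus.Y = act P Minus (Suc n) [Box 1 n p]
    - sm (complex_of_real (1 / plus.kap)) (act P Minus (Suc n) [Box 1 n p, Cap 0, Cup 0, Box 1 n p])"
proof -
  obtain m where m: "n = Suc m" "n - 1 = m" using n_Suc by metis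
  have pV: "p \<in> V n Plus" using plus.p1 by simp
  have tp: "tangle Plus (Suc n) [Box 0 n p] (Suc n)" using pV by simp
  have tcap: "tangle Plus (Suc n) [Cap m] m" and tcup: "tangle Plus m [Cup m] (Suc n)" by (simp_all add: m)
  have A1: "dl Plus (Suc n) plus.A1 = act P Minus (Suc n) [Box 1 n p]"
    unfolding plus.A1_def using dl_act[OF tp] eqv_act[OF turned_p] unfolding cross_Suc_n by simp
  have cm: "cross m Plus = Minus"
    using cross_cong[of m "Suc n" Plus] cross_Suc_n[of Plus] by (simp add: m)
  have t1: "tangle Plus m ([Cup m] @ [Box 0 n p]) (Suc n)" and t2: "tangle Plus (Suc n) ([Cap m] @ ([Cup m] @ [Box 0 n p])) (Suc n)"
    using tcup tcap tp unfolding wf_append by blast+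
  have e1: "eqv Minus (Suc n) (Suc n) (turned m (Suc n) ([Cup m] @ [Box 0 n p]) @ turned (Suc n) m [Cap m])
      (turned (Suc n) (Suc n) ([Cap m] @ ([Cup m] @ [Box 0 n p])))"
    using turned_append[OF tcap t1] unfolding cross_Suc_n by simp
  have e2: "eqv Minus (Suc n) m (turned (Suc n) (Suc n) [Box 0 n p] @ turned m (Suc n) [Cup m]) (turned m (Suc n) ([Cup m] @ [Box 0 n p]))"
    using turned_append[OF tcup tp] unfolding cm by simp
  have e3: "eqv Minus (Suc n) (Suc n) (turned (Suc n) (Suc n) ([Cap m] @ ([Cup m] @ [Box 0 n p])) @ turned (Suc n) (Suc n) [Box 0 n p])
      (turned (Suc n) (Suc n) ([Box 0 n p] @ ([Cap m] @ ([Cup m] @ [Box 0 n p]))))"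
    using turned_append[OF tp t2] unfolding cross_Suc_n by simp
  have cap: "eqv Minus m (Suc n) (turned (Suc n) m [Cap m]) [Cup 0]" and cup: "eqv Minus (Suc n) m (turned m (Suc n) [Cup m]) [Cap 0]"
    using turned_Cap[of Minus m] turned_Cup[of Minus m] by (simp_all add: m)
  have "eqv Minus (Suc n) (Suc n) (turned (Suc n) (Suc n) ([Box 0 n p] @ ([Cap m] @ ([Cup m] @ [Box 0 n p]))))
      ((([Box 1 n p] @ [Cap 0]) @ [Cup 0]) @ [Box 1 n p])"
    by (rule eqv_trans[OF eqv_sym[OF e3]], rule eqv_append[OF eqv_trans[OF eqv_sym[OF e1] eqv_append[OF eqv_trans[OF eqv_sym[OF e2] eqv_append[OF turned_p cup]] cap]] turned_p])
  then have B1: "dl Plus (Suc n) plus.B1 = act P Minus (Suc n) [Box 1 n p, Cap 0, Cup 0, Box 1 n p]"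
    unfolding plus.B1_def m(2) using dl_act[OF plus.tangle_B1[unfolded m(2)]] unfolding cross_Suc_n by (auto dest: eqv_act)
  show ?thesis
    unfolding plus.Y_def using lin_diff[OF lin_dl] lin_scale[OF lin_dl] plus.A1_V plus.B1_V V_scale
    by (simp add: A1 B1)
qed

text \<open>
  Multiply the dual of Y by q' on both sides and close the last string, which is the map T
  below.  On the first term of \<open>dl_Y\<close> the string closes p, and gives kappa times a
  Jones-Wenzl projection on fewer strings that q' absorbs.  On the second term it turns the
  two copies of p, joined by a cap and a cup on the left, into the rotated p and its adjoint.
\<close>

lemma kap_square:
  assumes hyp: "\<forall>S \<in> vertices_at P Plus (n + 1). edges P (vertex P (Plus, n, p)) S \<noteq> 0 \<longrightarrow>
           {T \<in> vertices_at P Minus n. edges P T (dual_vertex P S) \<noteq> 0} = {vertex P (Minus, n, p')}"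
    and \<gamma>: "mul Minus n q' (rotation P Plus n p) = sm \<gamma> q'"
  shows "complex_of_real (plus.kap ^ 2) = \<gamma> * cnj \<gamma>"
proof -
  obtain m where m: "n = Suc m" "n - 1 = m" using n_Suc by metis
  note q' = minus.q1 and pp = plus.p1
  define T where "T x = val Minus n n ([Cup n, Box 0 n q'] @ [Box 0 (Suc n) x] @ [Box 0 n q', Cap n])" for x
  have linT: "lin (V (Suc n) Minus) T"
    unfolding T_def using lin_val[of Minus n "[Cup n, Box 0 n q']" 0 "Suc n" "[Box 0 n q', Cap n]" n] q' by simp
  have slide: "T (act P Minus (Suc n) w) = val Minus n n ([Box 0 n q'] @ ([Cup n] @ w @ [Cap n]) @ [Box 0 n q'])"
    if w: "tangle Minus (Suc n) w (Suc n)" for w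
  proof -
    have w2: "tangle Minus (Suc (Suc n)) w (Suc (Suc n))" using wf_widen[OF w, of 1] by simp
    have "eqv Minus n n ([Cup n, Box 0 n q'] @ [Box 0 (Suc n) (act P Minus (Suc n) w)] @ [Box 0 n q', Cap n])
        ([Cup n, Box 0 n q'] @ w @ [Box 0 n q', Cap n])"
      by (rule eqv_expand_0[OF w]) (use q' act_in[OF w] in simp)
    also have "[Cup n, Box 0 n q'] @ w @ [Box 0 n q', Cap n] = [] @ [Cup n, Box 0 n q'] @ (w @ [Box 0 n q', Cap n])" by simp
    also have "eqv Minus n n \<dots> ([] @ [Box 0 n q', Cup n] @ (w @ [Box 0 n q', Cap n]))"
    proof -
      have "tangle Minus n ([] @ [Cup n, Box 0 n q'] @ (w @ [Box 0 n q', Cap n])) n"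
        using q' w2 by (auto simp: wf_append intro!: exI[of _ "Suc (Suc n)"])
      then show ?thesis using eqv_swap_left[of Minus n "[]" "Cup n" "Box 0 n q'" "w @ [Box 0 n q', Cap n]" n] by simp
    qed
    also have "[] @ [Box 0 n q', Cup n] @ (w @ [Box 0 n q', Cap n]) = ([Box 0 n q', Cup n] @ w) @ [Box 0 n q', Cap n] @ []" by simp
    also have "eqv Minus n n \<dots> (([Box 0 n q', Cup n] @ w) @ [Cap n, Box 0 n q'] @ [])"
    proof -
      have "tangle Minus n (([Box 0 n q', Cup n] @ w) @ [Box 0 n q', Cap n] @ []) n"
        using q' w2 by (auto simp: wf_append intro!: exI[of _ "Suc (Suc n)"])
      then show ?thesis using eqv_swap_right[of Minus n "[Box 0 n q', Cup n] @ w" "Box 0 n q'" "Cap n" "[]" n] by simp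
    qed
    finally show ?thesis unfolding T_def by (auto dest: eqv_val)
  qed
  define X1 where "X1 = act P Minus (Suc n) [Box 1 n p]"
  define X2 where "X2 = act P Minus (Suc n) [Box 1 n p, Cap 0, Cup 0, Box 1 n p]"
  have t1: "tangle Minus (Suc n) [Box 1 n p] (Suc n)" and t2: "tangle Minus (Suc n) [Box 1 n p, Cap 0, Cup 0, Box 1 n p] (Suc n)"
    using pp by (simp_all add: m)
  have XV: "X1 \<in> V (Suc n) Minus" "X2 \<in> V (Suc n) Minus" unfolding X1_def X2_def using t1 t2 act_in by blast+
  have T1: "T X1 = sm (complex_of_real plus.kap) q'"
  proof -
    have JWm: "JW Plus m (jw Plus m)" using plus.jw_facts(3) m by simp
    have "eqv Minus n n [Box 1 m (E Plus m p)] (map (shift 1) [Cup m, Box 0 (Suc m) p, Cap m])"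
      unfolding E_def using eqv_glue_le[of 1 Minus m "[Cup m, Box 0 (Suc m) p, Cap m]" n] pp by (simp add: m)
    then have e: "eqv Minus n n ([Cup n] @ [Box 1 n p] @ [Cap n]) [Box 1 m (E Plus m p)]"
      using eqv_sym by (simp add: m)
    have tq: "tangle Minus n [Box 0 n q'] n" using q' by simp
    have "eqv Minus n n ([Box 0 n q'] @ ([Cup n] @ [Box 1 n p] @ [Cap n]) @ [Box 0 n q']) ([Box 0 n q'] @ [Box 1 m (E Plus m p)] @ [Box 0 n q'])"
      by (rule eqv_prefix[OF tq eqv_suffix[OF e tq]])
    then have "T X1 = val Minus n n ([Box 0 n q'] @ [Box 1 m (E Plus m p)] @ [Box 0 n q'])"
      unfolding X1_def slide[OF t1] by (rule eqv_val)
    also have "E Plus m p = sm (complex_of_real plus.kap) (jw Plus m)" using plus.E_p m by simp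
    also have "val Minus n n ([Box 0 n q'] @ [Box 1 m (sm (complex_of_real plus.kap) (jw Plus m))] @ [Box 0 n q'])
       = sm (complex_of_real plus.kap) (val Minus n n ([Box 0 n q'] @ [Box 1 m (jw Plus m), Box 0 n q']))"
      using lin_scale[OF lin_val[of Minus n "[Box 0 n q']" 1 m "[Box 0 n q']" n], of "jw Plus m"] q' JW_V[OF JWm] by (simp add: m)
    also have "eqv Minus n n [Box 0 n q'] [Box 1 m (jw Plus m), Box 0 n q']"
      using eqv_sym[OF botfree_absorb_shift[of Plus m q' "jw Plus m"]] minus.free(5) JWm by (simp add: m)
    then have "eqv Minus n n ([Box 0 n q'] @ [Box 0 n q']) ([Box 0 n q'] @ [Box 1 m (jw Plus m), Box 0 n q'])"
      by (intro eqv_prefix) (use q' in auto)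
    then have "val Minus n n ([Box 0 n q'] @ [Box 1 m (jw Plus m), Box 0 n q']) = mul Minus n q' q'"
      by (auto simp: val_diag mult_def dest: eqv_val)
    finally show ?thesis using q' by simp
  qed
  have T2: "T X2 = sm (\<gamma> * cnj \<gamma>) q'"
  proof -
    define R where "R = rotation P Plus n p"
    have R: "R \<in> V n Minus" unfolding R_def using rotation_in[OF pp(1) n1] by simp
    have Rs: "star P R \<in> V n Minus" using star_in[OF R] .
    have RR: "mul Minus n R (star P R) = act P Minus n ([Cup n, Box 1 n p, Cap 0] @ [Cup 0, Box 1 n p, Cap n])"
      using rotation_mult_star[OF pp(1) n1] pp(2) by (simp add: R_def)
    have tw: "tangle Minus n ([Cup n, Box 1 n p, Cap 0] @ [Cup 0, Box 1 n p, Cap n]) n" using pp by (simp add: m)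
    have tq: "tangle Minus n [Box 0 n q'] n" using q' by simp
    have "T X2 = act P Minus n ([Box 0 n q'] @ (([Cup n, Box 1 n p, Cap 0] @ [Cup 0, Box 1 n p, Cap n]) @ [Box 0 n q']))"
      unfolding X2_def slide[OF t2] by (simp add: val_diag)
    also have "\<dots> = mul Minus n (mul Minus n q' (mul Minus n R (star P R))) q'"
      using act_append[OF tq, of "([Cup n, Box 1 n p, Cap 0] @ [Cup 0, Box 1 n p, Cap n]) @ [Box 0 n q']"]
        act_append[OF tw tq] tw tq q' RR unfolding wf_append[of _ _ _ _ "[Box 0 n q']"] by (auto simp: act_identity)
    also have "\<dots> = mul Minus n (mul Minus n q' R) (mul Minus n (star P R) q')"
      using q' R Rs by (simp add: mult_assoc mult_in)
    also have "mul Minus n (star P R) q' = star P (mul Minus n q' R)" using star_mult[OF q'(1) R] q' by simp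
    also have "mul Minus n (mul Minus n q' R) (star P (mul Minus n q' R)) = sm (\<gamma> * cnj \<gamma>) q'"
      using \<gamma> q' by (simp add: R_def star_scale mult_simps V_scale)
    finally show ?thesis .
  qed
  have dlY: "dl Plus (Suc n) plus.Y = X1 - sm (complex_of_real (1 / plus.kap)) X2"
    unfolding X1_def X2_def by (rule dl_Y)
  have "null Minus n n ([Cup n] @ [Box 0 n q', Box 0 (Suc n) (dl Plus (Suc n) plus.Y)] @ [Box 0 n q', Cap n])"
    by (rule null_context_0[OF qprime_dl_Y[OF hyp], of _ _ 1]) (use q' in auto)
  then have "T (dl Plus (Suc n) plus.Y) = 0" by (simp add: T_def null_def)
  then have "sm (complex_of_real plus.kap) q' - sm (complex_of_real (1 / plus.kap)) (sm (\<gamma> * cnj \<gamma>) q') = 0"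
    unfolding dlY using lin_diff[OF linT] lin_scale[OF linT] XV V_scale T1 T2 by simp
  then have "sm (complex_of_real plus.kap) q' = sm (complex_of_real (1 / plus.kap) * (\<gamma> * cnj \<gamma>)) q'" by simp
  then have "complex_of_real plus.kap = complex_of_real (1 / plus.kap) * (\<gamma> * cnj \<gamma>)"
    using q'(4) scale_right_imp_eq by blast
  then show ?thesis using plus.kap_pos by (simp add: power2_eq_square field_simps)
qed

text \<open>
  Elimination of kappa, gamma and the traces from \<open>kap_square\<close> by means of
  Tr(p) (ratio + 1) = [n+1] and \<open>qreal_cassini\<close>; below, a, b, c stand for
  [n], [n+1], [n+2].
\<close>

lemma chirality_equation:
  assumes eq: "plus.ratio = minus.ratio"
    and hyp: "\<forall>S \<in> vertices_at P Plus (n + 1). edges P (vertex P (Plus, n, p)) S \<noteq> 0 \<longrightarrow>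
           {T \<in> vertices_at P Minus n. edges P T (dual_vertex P S) \<noteq> 0} = {vertex P (Minus, n, p')}"
  shows "\<exists>z. rotation P Plus n plus.A = sm z minus.A \<and> z * cnj z = 1 \<and>
    complex_of_real (qreal d (Suc (Suc n)) - qreal d n) = z + cnj z"
proof -
  obtain z where z: "rotation P Plus n plus.A = sm z minus.A" using rotation_A by blast
  have zz: "z * cnj z = 1" by (rule rotation_A_norm[OF z eq])
  define a b c where "a = complex_of_real (qreal d n)" and "b = complex_of_real (qreal d (Suc n))"
    and "c = complex_of_real (qreal d (Suc (Suc n)))"
  define \<rho> where "\<rho> = complex_of_real (1 + plus.ratio)"
  have a0: "a \<noteq> 0" using plus.jw_facts(2)[of n] n1 by (simp add: a_def)
  have r0: "\<rho> \<noteq> 0" using plus.Tr_q(2) unfolding \<rho>_def by (metis add_pos_pos less_irrefl of_real_eq_0_iff zero_less_one)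
  define \<gamma> where "\<gamma> = (- 1 / a - z) / \<rho>"
  have "mul Minus n q' (rotation P Plus n p) = sm \<gamma> q'"
    using qprime_rotation_p[OF z] by (simp add: \<gamma>_def a_def \<rho>_def)
  then have k: "complex_of_real (plus.kap ^ 2) = \<gamma> * cnj \<gamma>" by (rule kap_square[OF hyp])
  have "1 + plus.ratio \<noteq> 0" using plus.Tr_q(2) by simp
  then have "plus.kap = qreal d (Suc n) / ((1 + plus.ratio) * qreal d n)"
    unfolding plus.kap_def plus.t_ratio[symmetric] by simp
  then have "complex_of_real plus.kap = b / (\<rho> * a)"
    by (simp add: a_def b_def \<rho>_def)
  then have "(b / (\<rho> * a)) ^ 2 = \<gamma> * cnj \<gamma>" using k by simp
  moreover have cnj: "cnj a = a" "cnj \<rho> = \<rho>" by (simp_all add: a_def \<rho>_def)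
  then have "\<gamma> * cnj \<gamma> = (- 1 / a - z) * (- 1 / a - cnj z) / \<rho> ^ 2"
    by (simp add: \<gamma>_def power2_eq_square)
  ultimately have "b ^ 2 / (\<rho> * a) ^ 2 = (- 1 / a - z) * (- 1 / a - cnj z) / \<rho> ^ 2"
    by (simp only: power_divide)
  then have "b ^ 2 = (- 1 / a - z) * (- 1 / a - cnj z) * a ^ 2"
    using r0 a0 by (simp add: field_simps power_mult_distrib)
  also have "\<dots> = 1 + a * (z + cnj z) + a ^ 2 * (z * cnj z)"
    using a0 by (simp add: field_simps power2_eq_square)
  finally have "b ^ 2 = 1 + a * (z + cnj z) + a ^ 2" using zz by simp
  moreover have "b ^ 2 - a * c = 1"
    using arg_cong[OF qreal_cassini[of d n], of complex_of_real] by (simp add: a_def b_def c_def)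
  ultimately have "a * (c - a) = a * (z + cnj z)" by (simp add: algebra_simps power2_eq_square)
  then have "c - a = z + cnj z" using a0 by simp
  then show ?thesis using z zz by (auto simp: a_def c_def)
qed

end

lemma qnum_difference:
  assumes "admissible q" shows "qnum q (n + 2) - qnum q n = q ^ (n + 1) + inverse q ^ (n + 1)"
proof (cases "q = 1")
  case False
  note D = admissible_inverse[OF assms False] and q0 = admissible_nonzero[OF assms]
  have "(q ^ (n + 1) + inverse q ^ (n + 1)) * (q - inverse q) =
      (q ^ (n + 2) - inverse q ^ (n + 2)) - (q * inverse q) * (q ^ n - inverse q ^ n)"
    by (simp add: algebra_simps)
  then have "q ^ (n + 1) + inverse q ^ (n + 1) =
      ((q ^ (n + 2) - inverse q ^ (n + 2)) - (q ^ n - inverse q ^ n)) / (q - inverse q)"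
    using D q0 by (simp add: field_simps)
  then show ?thesis using False by (simp add: qnum_def diff_divide_distrib)
qed (simp add: qnum_def)

text \<open>
  The right side of the equation is 2 Re z, so at most 2.  For q > 1 the left side would be greater.
\<close>

lemma modulus_le_2:
  assumes q: "admissible q" and d: "complex_of_real d = qnum q 2"
    and z: "z * cnj z = 1" "q ^ (n + 1) + inverse q ^ (n + 1) = z + cnj z"
  shows "d \<le> 2"
  using q
proof (cases rule: admissible_cases)
  case root
  have "complex_of_real d = q + inverse q"
  proof -
    have "qnum q 0 = 0" by (simp add: qnum_def)
    then show ?thesis unfolding d using qnum_difference[OF q, of 0]
      by (simp only: add_0 diff_zero power_one_right)
  qed
  then have "cmod (complex_of_real d) \<le> cmod q + cmod (inverse q)" by (metis norm_triangle_ineq)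
  then show ?thesis using root(1) by (simp add: norm_inverse)
next
  case (real x)
  define y where "y = x ^ (n + 1)"
  have y1: "y \<ge> 1" unfolding y_def using real(1) by (rule one_le_power)
  have "complex_of_real ((cmod z)\<^sup>2) = 1" using z(1) complex_norm_square[of z] by simp
  then have "(cmod z)\<^sup>2 = 1" by (simp only: of_real_eq_1_iff)
  then have "cmod z = 1" using norm_ge_zero[of z] unfolding power2_eq_1_iff by linarith
  then have "Re z \<le> 1" using complex_Re_le_cmod[of z] by simp
  moreover have "y + inverse y = Re (z + cnj z)"
    unfolding z(2)[symmetric] y_def real(2) by (simp flip: of_real_power of_real_inverse power_inverse of_real_add of_real_mult)
  ultimately have "y + inverse y \<le> 2" by simp
  then have "y * (y + inverse y) \<le> y * 2" using y1 by (intro mult_left_mono) auto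
  then have "(y - 1) ^ 2 \<le> 0" using y1 by (simp add: algebra_simps power2_eq_square)
  then have "y = 1" by simp
  have "x = 1"
  proof (rule ccontr)
    assume "x \<noteq> 1"
    then have "1 < y" unfolding y_def using real(1) by (intro one_less_power) auto
    then show False using \<open>y = 1\<close> by simp
  qed
  then have "complex_of_real d = complex_of_real 2" using d real(2) by (simp add: qnum_def)
  then have "d = 2" by (simp only: of_real_eq_iff)
  then show ?thesis by simp
qed

theorem theorem4p5:
  fixes PA :: "'v::ab_group_add planar_data"
    and q :: complex and d :: real and n :: nat
    and P Q R A P' Q' R' A' :: 'v and r r' :: real and \<sigma> :: complex
  assumes "subfactor_planar_algebra PA d"
    and "admissible q" and "complex_of_real d = qnum q 2"
    and "n \<ge> 2" and "even n"
    and "supertransitive PA (n - 1)" and "multiplicity PA n = 2"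
    and "Q_at PA Plus n P Q R" and "Q_at PA Minus n P' Q' R'"
    and "r = 2 * Re (Tr PA Plus n Q) / Re (Tr PA Plus n P)"
    and "r' = 2 * Re (Tr PA Minus n Q') / Re (Tr PA Minus n P')"
    and "A = smult PA (of_real r) P - (Q + R)"
    and "A' = smult PA (of_real r') P' - (Q' + R')"
    and "\<sigma> = (THE z. rotation PA Plus n A = smult PA (of_real (sqrt r / sqrt r') * z) A')"
    and "r = r'"
    and "\<forall>S \<in> vertices_at PA Plus (n + 1). edges PA (vertex PA (Plus, n, P)) S \<noteq> 0 \<longrightarrow>
           {T \<in> vertices_at PA Minus n. edges PA T (dual_vertex PA S) \<noteq> 0} =
           {vertex PA (Minus, n, P')}"
  shows "\<sigma> + inverse \<sigma> = qnum q (n + 2) - qnum q n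
    \<and> qnum q (n + 2) - qnum q n = q ^ (n + 1) + inverse q ^ (n + 1)
    \<and> d \<le> 2"
proof -
  interpret subfactor_planar_algebra PA d by fact
  interpret graphs: quadruple_point PA d n P Q R P' Q' R'
    by unfold_locales (use assms in auto)
  have r: "r = graphs.plus.ratio" "r' = graphs.minus.ratio"
    by (simp_all add: assms graphs.plus.ratio_def graphs.minus.ratio_def)
  have A: "A = graphs.plus.A" "A' = graphs.minus.A"
    by (simp_all only: assms(12,13) r graphs.plus.A_def graphs.minus.A_def)
  obtain z where z: "rotation PA Plus n A = smult PA z A'" "z * cnj z = 1"
    "complex_of_real (qreal d (Suc (Suc n)) - qreal d n) = z + cnj z"
    using graphs.chirality_equation[OF _ assms(16)] assms(15) unfolding r A by blast
  have "sqrt r / sqrt r' = 1" using graphs.plus.Tr_q(2) assms(15) by (simp add: r)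
  moreover have "A' \<noteq> 0" using graphs.minus.A_nonzero A by simp
  ultimately have \<sigma>: "\<sigma> = z"
    unfolding assms(14) using z(1) by (intro the_equality) (auto simp: scale_right_imp_eq)
  have "inverse \<sigma> = cnj \<sigma>" using z(2) \<sigma> by (simp add: inverse_unique)
  moreover have "qnum q (n + 2) - qnum q n = z + cnj z"
    using z(3) qnum_eq_qreal[OF assms(2,3)] by simp
  ultimately show ?thesis
    using \<sigma> qnum_difference[OF assms(2), of n] modulus_le_2[OF assms(2,3) z(2), of n] by simp
qed

end
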